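(* Let $d\ge3$ be an integer and $q>2$ real. The random cluster model on a sequence of locally tree-like $d$-regular graphs undergoes a first-order phase transition at the critical curve $\mathscr C=\{(w,B): w=w_c(B),\ 0\le B<B_+\}$. More precisely, for $0\le B<B_+$, $$\partial_w\varphi(w_c(B)^+,B)\ne\partial_w\varphi(w_c(B)^-,B)$$ (right and left derivatives in $w$ at $w_c(B)$). For $w,B\ge 0$ with $(w,B)\notin\mathscr C$, instead, there is no phase transition, that is, $w\mapsto\varphi(w,B)$ is analytic (at $w$).
   Context: For $q>2$, $d\ge3$ put $$\ell_{q,d}(x)=\frac{x^{2/d}-1}{1-\frac1{q-1}x^{2/d}},\qquad w_c(B)=\ell_{q,d}\big((q-1)e^{-B}\big),$$ and let $B_+>0$ be the unique positive solution of $$(1+w_c(B_+))\Big(1+\frac{w_c(B_+)}{q-1}\Big)=\Big(\frac{d}{d-2}\Big)^2.$$ For $w,B\ge0$, $\varphi(w,B)=\lim_{n\to\infty}\frac1n\log Z_{G_n}(q,w,B)$ is the pressure per particle of the random cluster model on locally tree-like $d$-regular graphs $G_n$ on $n$ vertices (limit in probability). Here, for a finite graph $G$, $$Z_G(q,w,B)=\sum_{\omega\in\{0,1\}^{E(G)}}\prod_{e\in E(G)}w^{\omega_e}\prod_{C\in\mathscr C(\omega)}\big(1+(q-1)e^{-B|C|}\big),$$ where $\mathscr C(\omega)$ is the collection of connected components of $(V(G),\{e:\omega_e=1\})$ and $|C|$ is the number of vertices of $C$. It is given by $$\varphi(w,B)=\frac{\beta^*d}{2}+\frac12\log\big(e^{-B}(q-1)\big)+\varphi^{\mathrm{Ising}}(\beta^*,B^*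 ),$$ $$\beta^*=\frac14\log\big((1+w)(1+w/(q-1))\big),\qquad B^*=\frac d4\log\Big(\frac{1+w}{1+w/(q-1)}\Big)+\frac12\log\Big(\frac{e^B}{q-1}\Big).$$ Here $\varphi^{\mathrm{Ising}}(\beta,b)$ is the limit in probability of $\frac1n\log Z^{\mathrm{Ising}}_{G_n}(\beta,b)$, with $Z^{\mathrm{Ising}}_{G}(\beta,b)=\sum_{\sigma\in\{-1,1\}^{V(G)}}\exp\big(\beta\sum_{\{u,v\}\in E(G)}\sigma_u\sigma_v+b\sum_{v}\sigma_v\big)$, which is known to exist and depends only on $d,\beta,b$. A sequence of $d$-regular (possibly random) graphs is locally tree-like if for each $r\ge0$ the proportion of vertices whose $r$-neighbourhood is a tree tends to $1$ in probability. Analytic at $w$ means: equal to a convergent power series on a neighbourhood of $w$ in $[0,\infty)$.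
   Formalization: Analyticity is not claimed at the end point (w_c(B_+),B_+), where the statement fails: there the w-derivative of the pressure varies like a cube root of w-w_c(B_+). At that single point only differentiability of the pressure in w is asserted. *)

theory Defs
  imports "HOL-Analysis.Analysis" "HOL-Probability.Probability"
begin

section \<open>Finite simple graphs\<close>

text \<open>A graph is given by a vertex set \<open>V\<close> and a set \<open>E\<close> of two-element subsets of \<open>V\<close>.\<close>

definition simple_graph :: "'v set \<Rightarrow> 'v set set \<Rightarrow> bool" where
  "simple_graph V E \<longleftrightarrow> finite V \<and> (\<forall>e\<in>E. e \<subseteq> V \<and> card e = 2)"

definition regular_graph :: "nat \<Rightarrow> 'v set \<Rightarrow> 'v set set \<Rightarrow> bool" where
  "regular_graph d V E \<longleftrightarrow> simple_graph V E \<and> (\<forall>v\<in>V. card {e \<in> E. v \<in> e} = d)"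

definition adj :: "'v set set \<Rightarrow> ('v \<times> 'v) set" where
  "adj E = {(u, v). {u, v} \<in> E}"

definition components :: "'v set \<Rightarrow> 'v set set \<Rightarrow> 'v set set" where
  "components V E = V // {(u, v). u \<in> V \<and> v \<in> V \<and> (u, v) \<in> (adj E)\<^sup>*}"

definition connected_graph :: "'v set \<Rightarrow> 'v set set \<Rightarrow> bool" where
  "connected_graph V E \<longleftrightarrow> V \<noteq> {} \<and> (\<forall>u\<in>V. \<forall>v\<in>V. (u, v) \<in> (adj E)\<^sup>*)"

definition is_cycle :: "'v set set \<Rightarrow> 'v list \<Rightarrow> bool" where
  "is_cycle E xs \<longleftrightarrow> length xs \<ge> 3 \<and> distinct xs \<and>
     (\<forall>i<length xs. {xs ! i, xs ! ((i + 1) mod length xs)} \<in> E)"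

definition is_tree :: "'v set \<Rightarrow> 'v set set \<Rightarrow> bool" where
  "is_tree V E \<longleftrightarrow> connected_graph V E \<and> (\<nexists>xs. is_cycle E xs)"

definition nbhd :: "'v set \<Rightarrow> 'v set set \<Rightarrow> nat \<Rightarrow> 'v \<Rightarrow> 'v set" where
  "nbhd V E r v = {u \<in> V. \<exists>k\<le>r. (v, u) \<in> adj E ^^ k}"

definition induced_edges :: "'v set set \<Rightarrow> 'v set \<Rightarrow> 'v set set" where
  "induced_edges E U = {e \<in> E. e \<subseteq> U}"

definition tree_proportion :: "'v set \<Rightarrow> 'v set set \<Rightarrow> nat \<Rightarrow> real" where
  "tree_proportion V E r =
     card {v \<in> V. is_tree (nbhd V E r v) (induced_edges E (nbhd V E r v))} / card V"


section \<open>Sequences of random graphs\<close>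

text \<open>
  The \<open>k\<close>-th random graph of a sequence has vertex set \<open>{..<N k}\<close>; there are finitely many
  graphs on this set, so its law is a probability mass function on edge sets, with point
  masses for a deterministic graph.  Sizes are indexed by \<open>k\<close> because \<open>d\<close>-regular graphs on
  \<open>n\<close> vertices do not exist for every \<open>n\<close>.  Convergence in probability to a constant depends
  only on the individual laws.
\<close>

definition tendsto_in_prob :: "(nat \<Rightarrow> 'a pmf) \<Rightarrow> (nat \<Rightarrow> 'a \<Rightarrow> real) \<Rightarrow> real \<Rightarrow> bool" where
  "tendsto_in_prob P X c \<longleftrightarrow>
     (\<forall>\<epsilon>>0. (\<lambda>k. measure_pmf.prob (P k) {x. \<bar>X k x - c\<bar> > \<epsilon>}) \<longlonglongrightarrow> 0)"

definition locally_tree_like :: "(nat \<Rightarrow> nat) \<Rightarrow> (nat \<Rightarrow> nat set set pmf) \<Rightarrow> bool" where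
  "locally_tree_like N G \<longleftrightarrow>
     (\<forall>r. tendsto_in_prob G (\<lambda>k E. tree_proportion {..<N k} E r) 1)"


section \<open>The random cluster model\<close>

text \<open>A configuration in \<open>{0,1}\<close> to the power \<open>E\<close> is identified with its set \<open>A\<close> of open edges.\<close>

definition Z_rc :: "'v set \<Rightarrow> 'v set set \<Rightarrow> real \<Rightarrow> real \<Rightarrow> real \<Rightarrow> real" where
  "Z_rc V E q w B =
     (\<Sum>A\<in>Pow E. w ^ card A * (\<Prod>C\<in>components V A. 1 + (q - 1) * exp (- B * real (card C))))"

definition is_pressure ::
  "(nat \<Rightarrow> nat) \<Rightarrow> (nat \<Rightarrow> nat set set pmf) \<Rightarrow> real \<Rightarrow> (real \<Rightarrow> real \<Rightarrow> real) \<Rightarrow> bool" where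
  "is_pressure N G q \<phi> \<longleftrightarrow>
     (\<forall>w\<ge>0. \<forall>B\<ge>0.
        tendsto_in_prob G (\<lambda>k E. ln (Z_rc {..<N k} E q w B) / real (N k)) (\<phi> w B))"


section \<open>The critical curve\<close>

definition ell :: "real \<Rightarrow> nat \<Rightarrow> real \<Rightarrow> real" where
  "ell q d x = (x powr (2 / real d) - 1) / (1 - 1 / (q - 1) * x powr (2 / real d))"

definition w_c :: "real \<Rightarrow> nat \<Rightarrow> real \<Rightarrow> real" where
  "w_c q d B = ell q d ((q - 1) * exp (- B))"

definition B_plus :: "real \<Rightarrow> nat \<Rightarrow> real" where
  "B_plus q d = (THE B. B > 0 \<and>
     (1 + w_c q d B) * (1 + w_c q d B / (q - 1)) = (real d / (real d - 2))\<^sup>2)"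

definition critical_curve :: "real \<Rightarrow> nat \<Rightarrow> (real \<times> real) set" where
  "critical_curve q d = {(w, B). w = w_c q d B \<and> 0 \<le> B \<and> B < B_plus q d}"

text \<open>
  The end point of the curve, not on the curve itself.  It corresponds to the Ising model on
  the \<open>d\<close>-regular tree at critical temperature and zero field, where the magnetization behaves
  like the cube root of the field.  There the pressure is differentiable in \<open>w\<close> but not
  analytic: its \<open>w\<close>-derivative varies like a cube root.
\<close>

definition critical_endpoint :: "real \<Rightarrow> nat \<Rightarrow> real \<times> real" where
  "critical_endpoint q d = (w_c q d (B_plus q d), B_plus q d)"


section \<open>Analyticity relative to the half-line\<close>

definition analytic_at_nonneg :: "(real \<Rightarrow> real) \<Rightarrow> real \<Rightarrow> bool" where
  "analytic_at_nonneg f w \<longleftrightarrow>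
     (\<exists>(a :: nat \<Rightarrow> real) r. r > 0 \<and>
        (\<forall>x\<ge>0. \<bar>x - w\<bar> < r \<longrightarrow> (\<lambda>n. a n * (x - w) ^ n) sums f x))"

end

theory Submission
  imports Defs "HOL-Complex_Analysis.Complex_Analysis" "HOL-Real_Asymp.Real_Asymp"
begin

text \<open>
  Expanding each component factor \<open>1 + (q - 1) exp (- B |C|)\<close> and counting every component as a
  tree turns the random cluster model into an Ising model. The error is at most a factor \<open>q\<close> per
  component that contains a cycle, and on tree-like graphs there are only \<open>o(n)\<close> of these.

  The Ising pressure is the maximum over messages \<open>R > 0\<close> of the Bethe free energy. The gauge
  expansion around a fixed point gives the lower bound. For the upper bound at positive field, the
  second Griffiths inequality bounds the magnetization from below by that of a \<open>d\<close>-regular tree with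
  free boundary, which converges to the slope of the Bethe free energy in the field; integrating
  from infinite field, where both free energies agree, gives the claim. Negative fields follow by
  spin flip and zero field by continuity.

  At positive field the maximizer is the unique fixed point \<open>R > 1\<close> and a simple zero of a
  polynomial equation, so it continues holomorphically. At zero field, that is on \<open>w = w_c(B)\<close>, the
  maximizers are \<open>R\<close> and \<open>1 / R\<close>, with \<open>R > 1\<close> exactly for \<open>B < B\<^sub>+\<close>. By the envelope theorem the
  one-sided derivatives are the partial derivatives at the two maximizers, and they differ because
  the coupling favours the first colour when \<open>q > 2\<close>.
\<close>


section \<open>The Griffiths inequalities\<close>

text \<open>On a tree with \<open>n\<close> vertices
  \<open>(q - 1) ^ n / (q - 1) ^ (n - 1) = q - 1\<close>, so there the component factor splits over
  vertices and edges; this is where the second edge weight \<open>1 + w / (q - 1)\<close> comes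
  from. Integrating down from infinite field requires the Ising limit at all larger fields. It is
  available because at fixed \<open>w\<close> the coupling does not depend on \<open>B\<close> and
  the field is \<open>B\<close> plus a constant, so the pressures at larger \<open>B\<close> supply
  it. A tree with free boundary is blind at zero field: the recursion starts at the symmetric
  message 1 and stays there. That forces the detour through positive fields. The Ising parameters
  contain \<open>sqrt (1 + w)\<close> and \<open>sqrt (1 + w / (q - 1))\<close>; rescaling the
  message removes them, so that the equation to be continued is polynomial. At
  \<open>B = B_plus q d\<close> the symmetric root is not simple and the implicit function argument
  breaks down. The root is still continuous there, which is all that the envelope theorem asks of
  it; hence differentiability.\<close>

text \<open>The subsets of \<open>V\<close> form a group under symmetric difference, and these are
  its real characters. With sets of minus spins as configurations, products of spins become
  characters.\<close>

definition character :: "'v set \<Rightarrow> ('v set \<Rightarrow> real) \<Rightarrow> bool" where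
  "character V \<xi> \<longleftrightarrow> (\<forall>T\<in>Pow V. \<xi> T = 1 \<or> \<xi> T = -1) \<and>
     (\<forall>T\<in>Pow V. \<forall>U\<in>Pow V. \<xi> (sym_diff T U) = \<xi> T * \<xi> U)"

lemma character_sign: "character V \<xi> \<Longrightarrow> T \<subseteq> V \<Longrightarrow> \<xi> T = 1 \<or> \<xi> T = -1"
  unfolding character_def by blast

lemma character_sym_diff:
  "character V \<xi> \<Longrightarrow> T \<subseteq> V \<Longrightarrow> U \<subseteq> V \<Longrightarrow> \<xi> (sym_diff T U) = \<xi> T * \<xi> U"
  unfolding character_def by blast

lemma character_mult:
  assumes "character V \<xi>" and "character V \<eta>"
  shows "character V (\<lambda>T. \<xi> T * \<eta> T)"
  unfolding character_def
proof (intro conjI ballI)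
  fix T assume "T \<in> Pow V"
  then show "\<xi> T * \<eta> T = 1 \<or> \<xi> T * \<eta> T = -1"
    using character_sign[OF assms(1), of T] character_sign[OF assms(2), of T] by auto
next
  fix T U assume "T \<in> Pow V" "U \<in> Pow V"
  then show "\<xi> (sym_diff T U) * \<eta> (sym_diff T U) = \<xi> T * \<eta> T * (\<xi> U * \<eta> U)"
    using character_sym_diff[OF assms(1), of T U] character_sym_diff[OF assms(2), of T U] by simp
qed

lemma bij_betw_sym_diff_Pow:
  assumes "U \<subseteq> V"
  shows "bij_betw (\<lambda>T. sym_diff T U) (Pow V) (Pow V)"
  by (rule bij_betw_byWitness[where f' = "\<lambda>T. sym_diff T U"]) (use assms in auto)

text \<open>Translating by a set on which the character is -1 shows that a nontrivial character sums
  to zero.\<close>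

lemma sum_character_nonneg:
  assumes "finite V" and "character V \<eta>"
  shows "(\<Sum>T\<in>Pow V. \<eta> T) \<ge> 0"
proof (cases "\<exists>U\<in>Pow V. \<eta> U = -1")
  case True
  then obtain U where U: "U \<in> Pow V" "\<eta> U = -1" by blast
  have "(\<Sum>T\<in>Pow V. \<eta> T) = (\<Sum>T\<in>Pow V. \<eta> (sym_diff T U))"
    using sum.reindex_bij_betw[OF bij_betw_sym_diff_Pow[of U V], of \<eta>] U by simp
  also have "\<dots> = (\<Sum>T\<in>Pow V. - \<eta> T)"
    using assms(2) U unfolding character_def by (intro sum.cong) auto
  finally show ?thesis by (simp add: sum_negf)
next
  case False
  then have "\<forall>T\<in>Pow V. \<eta> T = 1" using assms(2) unfolding character_def by blast
  then show ?thesis by (intro sum_nonneg) auto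
qed

text \<open>Expanding one factor at a time absorbs its character into \<open>\<eta>\<close>, which
  is why \<open>\<eta>\<close> is arbitrary; in the end only sums of characters with nonnegative
  coefficients remain.\<close>

lemma GKS_first:
  assumes "finite V" and "finite I" and "character V \<eta>"
    and "\<And>i. i \<in> I \<Longrightarrow> character V (\<xi> i) \<and> 0 \<le> p i \<and> 0 \<le> r i"
  shows "(\<Sum>T\<in>Pow V. \<eta> T * (\<Prod>i\<in>I. p i + r i * \<xi> i T)) \<ge> (0::real)"
  using assms(2,3,4)
proof (induction I arbitrary: \<eta> rule: finite_induct)
  case empty
  then show ?case using sum_character_nonneg[OF assms(1)] by simp
next
  case (insert j I)
  have "(\<Sum>T\<in>Pow V. \<eta> T * (\<Prod>i\<in>insert j I. p i + r i * \<xi> i T)) =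
     p j * (\<Sum>T\<in>Pow V. \<eta> T * (\<Prod>i\<in>I. p i + r i * \<xi> i T)) +
     r j * (\<Sum>T\<in>Pow V. (\<eta> T * \<xi> j T) * (\<Prod>i\<in>I. p i + r i * \<xi> i T))"
    unfolding sum_distrib_left sum.distrib[symmetric] using insert(1,2)
    by (intro sum.cong) (auto simp: algebra_simps)
  moreover have "(\<Sum>T\<in>Pow V. \<eta> T * (\<Prod>i\<in>I. p i + r i * \<xi> i T)) \<ge> 0"
    using insert.prems by (intro insert.IH) auto
  moreover have "(\<Sum>T\<in>Pow V. (\<eta> T * \<xi> j T) * (\<Prod>i\<in>I. p i + r i * \<xi> i T)) \<ge> 0"
    using insert.prems by (intro insert.IH character_mult) auto
  ultimately show ?case using insert.prems by simp
qed

text \<open>Substituting \<open>T' = T \<triangle> U\<close> in the duplicated system turns the covariance, for each fixed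
  \<open>U\<close>, into a sum to which the first inequality applies; this uses \<open>r i \<le> p i\<close>.\<close>

lemma GKS_second:
  assumes V: "finite V" and I: "finite I" and \<eta>: "character V \<eta>" and \<zeta>: "character V \<zeta>"
    and ch: "\<And>i. i \<in> I \<Longrightarrow> character V (\<xi> i) \<and> 0 \<le> r i \<and> r i \<le> p i"
  defines "W \<equiv> \<lambda>T. \<Prod>i\<in>I. p i + r i * \<xi> i T"
  shows "(\<Sum>T\<in>Pow V. \<eta> T * W T) * (\<Sum>T\<in>Pow V. \<zeta> T * W T) \<le>
         (\<Sum>T\<in>Pow V. W T) * (\<Sum>T\<in>Pow V. \<eta> T * \<zeta> T * W T)"
proof -
  define D where "D U T = \<eta> T * \<zeta> T * (1 - \<zeta> U) *
      (\<Prod>i\<in>I. (p i + r i * \<xi> i T) * (p i + r i * \<xi> i T * \<xi> i U))" for U T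
  have "(\<Sum>T\<in>Pow V. W T) * (\<Sum>T\<in>Pow V. \<eta> T * \<zeta> T * W T)
      - (\<Sum>T\<in>Pow V. \<eta> T * W T) * (\<Sum>T\<in>Pow V. \<zeta> T * W T)
      = (\<Sum>T\<in>Pow V. \<Sum>T'\<in>Pow V. \<eta> T * (\<zeta> T - \<zeta> T') * W T * W T')"
    apply (subst mult.commute)
    unfolding sum_product sum_subtractf[symmetric]
    by (intro sum.cong) (auto simp: algebra_simps)
  also have "\<dots> = (\<Sum>T\<in>Pow V. \<Sum>U\<in>Pow V. D U T)"
  proof (rule sum.cong[OF refl])
    fix T assume T: "T \<in> Pow V"
    have "(\<Sum>T'\<in>Pow V. \<eta> T * (\<zeta> T - \<zeta> T') * W T * W T') =
          (\<Sum>U\<in>Pow V. \<eta> T * (\<zeta> T - \<zeta> (sym_diff U T)) * W T * W (sym_diff U T))"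
      using sum.reindex_bij_betw[OF bij_betw_sym_diff_Pow[of T V],
          of "\<lambda>T'. \<eta> T * (\<zeta> T - \<zeta> T') * W T * W T'"] T by simp
    also have "\<dots> = (\<Sum>U\<in>Pow V. D U T)"
    proof (rule sum.cong[OF refl])
      fix U assume U: "U \<in> Pow V"
      have 1: "\<zeta> (sym_diff U T) = \<zeta> U * \<zeta> T" using character_sym_diff[OF \<zeta>] U T by simp
      have 2: "\<xi> i (sym_diff U T) = \<xi> i U * \<xi> i T" if "i \<in> I" for i
        using character_sym_diff[of V "\<xi> i"] ch[OF that] U T by simp
      have "W T * W (sym_diff U T) = (\<Prod>i\<in>I. (p i + r i * \<xi> i T) * (p i + r i * \<xi> i T * \<xi> i U))"
        unfolding W_def prod.distrib[symmetric] by (intro prod.cong) (auto simp: 2)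
      moreover have "\<eta> T * (\<zeta> T - \<zeta> (sym_diff U T)) * W T * W (sym_diff U T) =
          \<eta> T * \<zeta> T * (1 - \<zeta> U) * (W T * W (sym_diff U T))"
        unfolding 1 by (simp add: algebra_simps)
      ultimately show "\<eta> T * (\<zeta> T - \<zeta> (sym_diff U T)) * W T * W (sym_diff U T) = D U T"
        unfolding D_def by simp
    qed
    finally show "(\<Sum>T'\<in>Pow V. \<eta> T * (\<zeta> T - \<zeta> T') * W T * W T') = (\<Sum>U\<in>Pow V. D U T)" .
  qed
  also have "\<dots> = (\<Sum>U\<in>Pow V. \<Sum>T\<in>Pow V. D U T)" by (rule sum.swap)
  also have "\<dots> \<ge> 0"
  proof (rule sum_nonneg)
    fix U assume U: "U \<in> Pow V"
    define p' where "p' i = p i ^ 2 + r i ^ 2 * \<xi> i U" for i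
    define r' where "r' i = p i * r i * (1 + \<xi> i U)" for i
    have sq: "\<xi> i T * \<xi> i T = 1" if "i \<in> I" "T \<in> Pow V" for i T
      using character_sign[of V "\<xi> i" T] ch[OF that(1)] that(2) by auto
    have e: "(p i + r i * \<xi> i T) * (p i + r i * \<xi> i T * \<xi> i U) = p' i + r' i * \<xi> i T"
      if "i \<in> I" "T \<in> Pow V" for i T
    proof -
      have "(p i + r i * \<xi> i T) * (p i + r i * \<xi> i T * \<xi> i U) =
        p i ^ 2 + r i ^ 2 * (\<xi> i T * \<xi> i T) * \<xi> i U + p i * r i * (1 + \<xi> i U) * \<xi> i T"
        by (simp add: algebra_simps power2_eq_square)
      then show ?thesis unfolding p'_def r'_def sq[OF that] by simp
    qed
    have pos: "0 \<le> p' i \<and> 0 \<le> r' i" if "i \<in> I" for i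
      using character_sign[of V "\<xi> i" U] U ch[OF that] unfolding p'_def r'_def
      by (auto intro: power_mono)
    have "(\<Sum>T\<in>Pow V. D U T) = (1 - \<zeta> U) * (\<Sum>T\<in>Pow V. (\<eta> T * \<zeta> T) * (\<Prod>i\<in>I. p' i + r' i * \<xi> i T))"
      unfolding sum_distrib_left
    proof (rule sum.cong[OF refl])
      fix T assume T: "T \<in> Pow V"
      have *: "(\<Prod>i\<in>I. (p i + r i * \<xi> i T) * (p i + r i * \<xi> i T * \<xi> i U)) = (\<Prod>i\<in>I. p' i + r' i * \<xi> i T)"
        by (intro prod.cong refl e T)
      show "D U T = (1 - \<zeta> U) * ((\<eta> T * \<zeta> T) * (\<Prod>i\<in>I. p' i + r' i * \<xi> i T))"
        unfolding D_def * by (simp only: mult_ac)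
    qed
    moreover have "(\<Sum>T\<in>Pow V. (\<eta> T * \<zeta> T) * (\<Prod>i\<in>I. p' i + r' i * \<xi> i T)) \<ge> 0"
      using ch pos by (intro GKS_first V I character_mult \<eta> \<zeta>) auto
    moreover have "1 - \<zeta> U \<ge> 0" using character_sign[OF \<zeta>, of U] U by auto
    ultimately show "(\<Sum>T\<in>Pow V. D U T) \<ge> 0" by simp
  qed
  finally show ?thesis by simp
qed


section \<open>Ising sums on finite graphs\<close>

text \<open>\<open>T\<close> is the set of minus spins. In terms of the usual coupling \<open>\<beta>\<close> and field \<open>b\<close> the parameters
  are \<open>\<kappa> = exp (- 2 \<beta>)\<close> and \<open>\<mu> = exp (2 b)\<close>, up to normalization.\<close>

definition ising_weight :: "real \<Rightarrow> real \<Rightarrow> 'v set \<Rightarrow> 'v set set \<Rightarrow> 'v set \<Rightarrow> real" where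
  "ising_weight \<kappa> \<mu> V E T =
     (\<Prod>v\<in>V. if v \<in> T then 1 else \<mu>) * (\<Prod>e\<in>E. if e \<subseteq> T \<or> e \<inter> T = {} then 1 else \<kappa>)"

definition Z_ising :: "real \<Rightarrow> real \<Rightarrow> 'v set \<Rightarrow> 'v set set \<Rightarrow> real" where
  "Z_ising \<kappa> \<mu> V E = (\<Sum>T\<in>Pow V. ising_weight \<kappa> \<mu> V E T)"

definition Z_plus :: "real \<Rightarrow> real \<Rightarrow> 'v set \<Rightarrow> 'v set set \<Rightarrow> 'v \<Rightarrow> real" where
  "Z_plus \<kappa> \<mu> V E v = (\<Sum>T\<in>Pow V. if v \<in> T then 0 else ising_weight \<kappa> \<mu> V E T)"

definition Z_minus :: "real \<Rightarrow> real \<Rightarrow> 'v set \<Rightarrow> 'v set set \<Rightarrow> 'v \<Rightarrow> real" where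
  "Z_minus \<kappa> \<mu> V E v = (\<Sum>T\<in>Pow V. if v \<in> T then ising_weight \<kappa> \<mu> V E T else 0)"

lemma Z_plus_minus: "Z_plus \<kappa> \<mu> V E v + Z_minus \<kappa> \<mu> V E v = Z_ising \<kappa> \<mu> V E"
  unfolding Z_plus_def Z_minus_def Z_ising_def sum.distrib[symmetric] by (intro sum.cong) auto

lemma ising_weight_pos: "\<kappa> > 0 \<Longrightarrow> \<mu> > 0 \<Longrightarrow> ising_weight \<kappa> \<mu> V E T > 0"
  unfolding ising_weight_def by (intro mult_pos_pos prod_pos) auto

lemma Z_ising_pos: "finite V \<Longrightarrow> \<kappa> > 0 \<Longrightarrow> \<mu> > 0 \<Longrightarrow> Z_ising \<kappa> \<mu> V E > 0"
  unfolding Z_ising_def by (intro sum_pos ising_weight_pos) auto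

lemma Z_plus_nonneg: "\<kappa> > 0 \<Longrightarrow> \<mu> > 0 \<Longrightarrow> Z_plus \<kappa> \<mu> V E v \<ge> 0"
  unfolding Z_plus_def by (intro sum_nonneg) (auto intro: less_imp_le[OF ising_weight_pos])

lemma Z_minus_nonneg: "\<kappa> > 0 \<Longrightarrow> \<mu> > 0 \<Longrightarrow> Z_minus \<kappa> \<mu> V E v \<ge> 0"
  unfolding Z_minus_def by (intro sum_nonneg) (auto intro: less_imp_le[OF ising_weight_pos])

lemma Z_minus_pos:
  assumes "finite V" "\<kappa> > 0" "\<mu> > 0" "v \<in> V" shows "Z_minus \<kappa> \<mu> V E v > 0"
proof -
  have "0 < (if v \<in> V then ising_weight \<kappa> \<mu> V E V else 0)" using assms ising_weight_pos by simp
  also have "\<dots> \<le> Z_minus \<kappa> \<mu> V E v" unfolding Z_minus_def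
    by (rule member_le_sum) (use assms in \<open>auto intro: less_imp_le[OF ising_weight_pos]\<close>)
  finally show ?thesis .
qed

section \<open>Spin products and monotonicity of the plus-minus ratio in the edge set\<close>

definition spin_prod :: "'v set \<Rightarrow> 'v set \<Rightarrow> real" where
  "spin_prod C T = (\<Prod>v\<in>C. if v \<in> T then -1 else 1)"

lemma character_spin_prod: "character V (spin_prod C)"
proof -
  have "spin_prod C T = 1 \<or> spin_prod C T = -1" for T
  proof (cases "finite C")
    case True
    then show ?thesis unfolding spin_prod_def by (induction C rule: finite_induct) auto
  qed (simp add: spin_prod_def)
  moreover have "spin_prod C (sym_diff T U) = spin_prod C T * spin_prod C U" for T U
    unfolding spin_prod_def prod.distrib[symmetric] by (intro prod.cong) auto
  ultimately show ?thesis unfolding character_def by auto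
qed

text \<open>A function of a sign is affine in it. Vertices enter as singletons, told apart from
  edges by their cardinality, so that one index set carries both kinds of factors into the Griffiths
  inequalities; \<open>0 \<le> r C\<close> then amounts to \<open>\<mu> \<ge> 1\<close> and
  \<open>\<kappa> \<le> 1\<close>.\<close>

lemma ising_weight_eq_spin_prod:
  fixes \<kappa> \<mu> :: real
  assumes V: "finite V" and E: "finite E" "\<forall>e\<in>E. card e = 2"
  defines "p \<equiv> \<lambda>C. if card C = 1 then (\<mu> + 1) / 2 else (1 + \<kappa>) / 2"
    and "r \<equiv> \<lambda>C. if card C = 1 then (\<mu> - 1) / 2 else (1 - \<kappa>) / 2"
  shows "ising_weight \<kappa> \<mu> V E T = (\<Prod>C\<in>(\<lambda>v. {v}) ` V \<union> E. p C + r C * spin_prod C T)"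
proof -
  have "(\<lambda>v. {v}) ` V \<inter> E = {}" using E(2) by auto
  then have "(\<Prod>C\<in>(\<lambda>v. {v}) ` V \<union> E. p C + r C * spin_prod C T) =
      (\<Prod>C\<in>(\<lambda>v. {v}) ` V. p C + r C * spin_prod C T) * (\<Prod>C\<in>E. p C + r C * spin_prod C T)"
    using V E by (intro prod.union_disjoint) auto
  moreover have "(\<Prod>C\<in>(\<lambda>v. {v}) ` V. p C + r C * spin_prod C T) = (\<Prod>v\<in>V. if v \<in> T then 1 else \<mu>)"
    by (subst prod.reindex) (auto simp: p_def r_def spin_prod_def field_simps intro!: prod.cong)
  moreover have "(\<Prod>C\<in>E. p C + r C * spin_prod C T) =
      (\<Prod>e\<in>E. if e \<subseteq> T \<or> e \<inter> T = {} then 1 else \<kappa>)"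
  proof (rule prod.cong[OF refl])
    fix e assume e: "e \<in> E"
    then obtain x y where "e = {x, y}" "x \<noteq> y" using E(2) by (auto simp: card_2_iff)
    then show "p e + r e * spin_prod e T = (if e \<subseteq> T \<or> e \<inter> T = {} then 1 else \<kappa>)"
      by (auto simp: p_def r_def spin_prod_def field_simps)
  qed
  ultimately show ?thesis unfolding ising_weight_def by simp
qed

text \<open>The new edge multiplies the weight by \<open>p + r * spin_prod e\<close>, so the
  magnetization at \<open>v\<close> changes by \<open>r\<close> times a covariance, up to a positive
  normalization, and the covariance is nonnegative by the second inequality. Cross-multiplication
  avoids quotients.\<close>

lemma Z_ratio_insert_edge:
  assumes V: "finite V" and F: "finite F" "\<forall>e\<in>F. card e = 2" and e: "card e = 2" "e \<notin> F"
    and \<kappa>: "0 < \<kappa>" "\<kappa> \<le> 1" and \<mu>: "\<mu> \<ge> 1"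
  shows "Z_plus \<kappa> \<mu> V F v * Z_minus \<kappa> \<mu> V (insert e F) v \<le>
         Z_plus \<kappa> \<mu> V (insert e F) v * Z_minus \<kappa> \<mu> V F v"
proof -
  define W where "W = ising_weight \<kappa> \<mu> V F"
  define W' where "W' = ising_weight \<kappa> \<mu> V (insert e F)"
  define p r where "p = (1 + \<kappa>) / 2" and "r = (1 - \<kappa>) / 2"
  define \<eta> where "\<eta> = spin_prod e"
  define \<zeta> where "\<zeta> = spin_prod {v}"
  have \<zeta>: "\<zeta> T = (if v \<in> T then -1 else 1)" for T by (simp add: \<zeta>_def spin_prod_def)
  have W': "W' T = (p + r * \<eta> T) * W T" for T
  proof -
    obtain x y where "e = {x, y}" "x \<noteq> y" using e(1) by (auto simp: card_2_iff)
    then have "p + r * \<eta> T = (if e \<subseteq> T \<or> e \<inter> T = {} then 1 else \<kappa>)"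
      by (auto simp: p_def r_def \<eta>_def spin_prod_def field_simps)
    then show ?thesis using F e by (simp add: W'_def W_def ising_weight_def)
  qed
  have g: "(\<Sum>T\<in>Pow V. \<eta> T * W T) * (\<Sum>T\<in>Pow V. \<zeta> T * W T) \<le>
      (\<Sum>T\<in>Pow V. W T) * (\<Sum>T\<in>Pow V. \<eta> T * \<zeta> T * W T)"
    unfolding W_def ising_weight_eq_spin_prod[OF V F] \<eta>_def \<zeta>_def
    by (rule GKS_second) (use V F \<kappa> \<mu> in \<open>auto intro: character_spin_prod\<close>)
  have Z: "Z_plus \<kappa> \<mu> V F v + Z_minus \<kappa> \<mu> V F v = (\<Sum>T\<in>Pow V. W T)"
    "Z_plus \<kappa> \<mu> V (insert e F) v + Z_minus \<kappa> \<mu> V (insert e F) v = (\<Sum>T\<in>Pow V. W' T)"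
    by (simp_all add: Z_plus_minus Z_ising_def W_def W'_def)
  have S: "Z_plus \<kappa> \<mu> V F v - Z_minus \<kappa> \<mu> V F v = (\<Sum>T\<in>Pow V. \<zeta> T * W T)"
    "Z_plus \<kappa> \<mu> V (insert e F) v - Z_minus \<kappa> \<mu> V (insert e F) v = (\<Sum>T\<in>Pow V. \<zeta> T * W' T)"
    unfolding Z_plus_def Z_minus_def sum_subtractf[symmetric] W_def W'_def
    by (auto intro!: sum.cong simp: \<zeta>)
  have Z': "(\<Sum>T\<in>Pow V. W' T) = p * (\<Sum>T\<in>Pow V. W T) + r * (\<Sum>T\<in>Pow V. \<eta> T * W T)"
    unfolding sum_distrib_left sum.distrib[symmetric] W' by (auto intro!: sum.cong simp: algebra_simps)
  have S': "(\<Sum>T\<in>Pow V. \<zeta> T * W' T) =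
      p * (\<Sum>T\<in>Pow V. \<zeta> T * W T) + r * (\<Sum>T\<in>Pow V. \<eta> T * \<zeta> T * W T)"
    unfolding sum_distrib_left sum.distrib[symmetric] W' by (auto intro!: sum.cong simp: algebra_simps)
  have "(\<Sum>T\<in>Pow V. \<zeta> T * W' T) * (\<Sum>T\<in>Pow V. W T) - (\<Sum>T\<in>Pow V. \<zeta> T * W T) * (\<Sum>T\<in>Pow V. W' T)
     = r * ((\<Sum>T\<in>Pow V. W T) * (\<Sum>T\<in>Pow V. \<eta> T * \<zeta> T * W T)
         - (\<Sum>T\<in>Pow V. \<eta> T * W T) * (\<Sum>T\<in>Pow V. \<zeta> T * W T))"
    unfolding Z' S' by (simp add: algebra_simps)
  also have "\<dots> \<ge> 0" using g \<kappa> by (simp add: r_def)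
  finally show ?thesis unfolding Z[symmetric] S[symmetric] by (simp add: algebra_simps)
qed

text \<open>This is what carries a lower bound computed on a tree-like subgraph over to the whole
  graph.\<close>

lemma Z_ratio_mono_edges:
  assumes V: "finite V" and E: "finite E" "\<forall>e\<in>E. card e = 2" and F: "F \<subseteq> E" and v: "v \<in> V"
    and \<kappa>: "0 < \<kappa>" "\<kappa> \<le> 1" and \<mu>: "\<mu> \<ge> 1"
    and R: "R * Z_minus \<kappa> \<mu> V F v \<le> Z_plus \<kappa> \<mu> V F v"
  shows "R * Z_minus \<kappa> \<mu> V E v \<le> Z_plus \<kappa> \<mu> V E v"
proof -
  have "finite (E - F)" using E by auto
  then have "E - F \<subseteq> E - F \<Longrightarrow> R * Z_minus \<kappa> \<mu> V (F \<union> (E - F)) v \<le> Z_plus \<kappa> \<mu> V (F \<union> (E - F)) v"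
  proof (induction rule: finite_subset_induct')
    case (insert e D)
    let ?F = "F \<union> D"
    have fin: "finite ?F" using E F insert finite_subset by blast
    have "Z_plus \<kappa> \<mu> V ?F v * Z_minus \<kappa> \<mu> V (insert e ?F) v \<le>
         Z_plus \<kappa> \<mu> V (insert e ?F) v * Z_minus \<kappa> \<mu> V ?F v"
      using E F insert fin by (intro Z_ratio_insert_edge V \<kappa> \<mu>) auto
    moreover have "R * Z_minus \<kappa> \<mu> V ?F v * Z_minus \<kappa> \<mu> V (insert e ?F) v
        \<le> Z_plus \<kappa> \<mu> V ?F v * Z_minus \<kappa> \<mu> V (insert e ?F) v"
      using insert \<kappa> \<mu> by (intro mult_right_mono Z_minus_nonneg) auto
    ultimately have "(R * Z_minus \<kappa> \<mu> V (insert e ?F) v) * Z_minus \<kappa> \<mu> V ?F v \<le>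
         Z_plus \<kappa> \<mu> V (insert e ?F) v * Z_minus \<kappa> \<mu> V ?F v" by (simp add: algebra_simps)
    moreover have "Z_minus \<kappa> \<mu> V ?F v > 0" using V \<kappa> \<mu> v by (intro Z_minus_pos) auto
    ultimately show ?case by simp
  qed (use R in auto)
  then show ?thesis using F by (simp add: Un_absorb1)
qed

section \<open>Gluing along disjoint vertex sets\<close>

lemma sum_Pow_Un:
  assumes "V1 \<inter> V2 = {}"
  shows "(\<Sum>T\<in>Pow (V1 \<union> V2). f T) = (\<Sum>T1\<in>Pow V1. \<Sum>T2\<in>Pow V2. f (T1 \<union> T2))"
proof -
  have "bij_betw (\<lambda>(T1, T2). T1 \<union> T2) (Pow V1 \<times> Pow V2) (Pow (V1 \<union> V2))"
    by (rule bij_betw_byWitness[where f' = "\<lambda>T. (T \<inter> V1, T \<inter> V2)"]) (use assms in auto)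
  from sum.reindex_bij_betw[OF this, of f, symmetric] show ?thesis
    by (simp add: sum.cartesian_product case_prod_unfold)
qed

lemma ising_weight_Un:
  assumes fin: "finite V1" "finite V2" "finite E1" "finite E2" and dis: "V1 \<inter> V2 = {}"
    and E: "\<forall>e\<in>E1. e \<subseteq> V1 \<and> e \<noteq> {}" "\<forall>e\<in>E2. e \<subseteq> V2 \<and> e \<noteq> {}"
    and T: "T1 \<subseteq> V1" "T2 \<subseteq> V2"
  shows "ising_weight \<kappa> \<mu> (V1 \<union> V2) (E1 \<union> E2) (T1 \<union> T2) =
         ising_weight \<kappa> \<mu> V1 E1 T1 * ising_weight \<kappa> \<mu> V2 E2 T2"
proof -
  have "E1 \<inter> E2 = {}" using E dis by fast
  moreover have "(\<Prod>v\<in>V1. if v \<in> T1 \<union> T2 then 1 else \<mu>) = (\<Prod>v\<in>V1. if v \<in> T1 then 1 else \<mu>)"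
    "(\<Prod>v\<in>V2. if v \<in> T1 \<union> T2 then 1 else \<mu>) = (\<Prod>v\<in>V2. if v \<in> T2 then 1 else \<mu>)"
    using T dis by (auto intro!: prod.cong)
  moreover have "e \<subseteq> T1 \<union> T2 \<longleftrightarrow> e \<subseteq> T1" "e \<inter> (T1 \<union> T2) = {} \<longleftrightarrow> e \<inter> T1 = {}" if "e \<in> E1" for e
    using E(1) T dis that by fast+
  moreover have "e \<subseteq> T1 \<union> T2 \<longleftrightarrow> e \<subseteq> T2" "e \<inter> (T1 \<union> T2) = {} \<longleftrightarrow> e \<inter> T2 = {}" if "e \<in> E2" for e
    using E(2) T dis that by fast+
  ultimately show ?thesis unfolding ising_weight_def
    using fin dis by (simp add: prod.union_disjoint cong: prod.cong)
qed

text \<open>The edge \<open>{v, u}\<close> is the only link between the two parts, so they factorize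
  once the spin at \<open>v\<close> is fixed. Dividing the two equations, the ratio at
  \<open>v\<close> is multiplied by \<open>msg \<kappa>\<close> of the ratio at
  \<open>u\<close>.\<close>

lemma Z_ratio_attach:
  assumes fin: "finite V1" "finite V2" "finite E1" "finite E2" and dis: "V1 \<inter> V2 = {}"
    and E: "\<forall>e\<in>E1. e \<subseteq> V1 \<and> e \<noteq> {}" "\<forall>e\<in>E2. e \<subseteq> V2 \<and> e \<noteq> {}"
    and vu: "v \<in> V1" "u \<in> V2"
  shows "Z_plus \<kappa> \<mu> (V1 \<union> V2) (insert {v, u} (E1 \<union> E2)) v =
           Z_plus \<kappa> \<mu> V1 E1 v * (Z_plus \<kappa> \<mu> V2 E2 u + \<kappa> * Z_minus \<kappa> \<mu> V2 E2 u)"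
    and "Z_minus \<kappa> \<mu> (V1 \<union> V2) (insert {v, u} (E1 \<union> E2)) v =
           Z_minus \<kappa> \<mu> V1 E1 v * (\<kappa> * Z_plus \<kappa> \<mu> V2 E2 u + Z_minus \<kappa> \<mu> V2 E2 u)"
proof -
  let ?W = "ising_weight \<kappa> \<mu> (V1 \<union> V2) (insert {v, u} (E1 \<union> E2))"
  have "{v, u} \<notin> E1 \<union> E2" using E dis vu by (metis Un_iff disjoint_iff insert_subset)
  then have W: "?W (T1 \<union> T2) = ising_weight \<kappa> \<mu> V1 E1 T1 * (ising_weight \<kappa> \<mu> V2 E2 T2 *
      (if v \<in> T1 \<longleftrightarrow> u \<in> T2 then 1 else \<kappa>))"
    if "T1 \<subseteq> V1" "T2 \<subseteq> V2" for T1 T2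
  proof -
    have "v \<notin> T2" "u \<notin> T1" using that vu dis by auto
    then have "({v, u} \<subseteq> T1 \<union> T2 \<or> {v, u} \<inter> (T1 \<union> T2) = {}) \<longleftrightarrow> (v \<in> T1 \<longleftrightarrow> u \<in> T2)" by auto
    moreover have "?W (T1 \<union> T2) = (if {v, u} \<subseteq> T1 \<union> T2 \<or> {v, u} \<inter> (T1 \<union> T2) = {} then 1 else \<kappa>) *
        ising_weight \<kappa> \<mu> (V1 \<union> V2) (E1 \<union> E2) (T1 \<union> T2)"
      unfolding ising_weight_def using fin \<open>{v, u} \<notin> E1 \<union> E2\<close> by simp
    ultimately show ?thesis unfolding ising_weight_Un[OF fin dis E that] by simp
  qed
  have v: "v \<notin> T2" if "T2 \<subseteq> V2" for T2 using that vu dis by auto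
  have comb: "Z_plus \<kappa> \<mu> V2 E2 u + \<kappa> * Z_minus \<kappa> \<mu> V2 E2 u =
      (\<Sum>T\<in>Pow V2. ising_weight \<kappa> \<mu> V2 E2 T * (if u \<in> T then \<kappa> else 1))"
    "\<kappa> * Z_plus \<kappa> \<mu> V2 E2 u + Z_minus \<kappa> \<mu> V2 E2 u =
      (\<Sum>T\<in>Pow V2. ising_weight \<kappa> \<mu> V2 E2 T * (if u \<in> T then 1 else \<kappa>))"
    unfolding Z_plus_def Z_minus_def sum_distrib_left sum.distrib[symmetric] by (auto intro!: sum.cong)
  show "Z_plus \<kappa> \<mu> (V1 \<union> V2) (insert {v, u} (E1 \<union> E2)) v =
           Z_plus \<kappa> \<mu> V1 E1 v * (Z_plus \<kappa> \<mu> V2 E2 u + \<kappa> * Z_minus \<kappa> \<mu> V2 E2 u)"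
    unfolding comb unfolding Z_plus_def sum_Pow_Un[OF dis] sum_product
    by (intro sum.cong refl) (auto simp: W v)
  show "Z_minus \<kappa> \<mu> (V1 \<union> V2) (insert {v, u} (E1 \<union> E2)) v =
           Z_minus \<kappa> \<mu> V1 E1 v * (\<kappa> * Z_plus \<kappa> \<mu> V2 E2 u + Z_minus \<kappa> \<mu> V2 E2 u)"
    unfolding comb unfolding Z_minus_def sum_Pow_Un[OF dis] sum_product
    by (intro sum.cong refl) (auto simp: W v)
qed

text \<open>Isolated vertices contribute a common factor to both sums, which cancels from their
  ratio.\<close>

lemma Z_extend_vertices:
  assumes fin: "finite V" "finite E" and W: "W \<subseteq> V" and E: "\<forall>e\<in>E. e \<subseteq> W \<and> e \<noteq> {}" and v: "v \<in> W"
  shows "Z_plus \<kappa> \<mu> V E v = Z_plus \<kappa> \<mu> W E v * Z_ising \<kappa> \<mu> (V - W) {}"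
    and "Z_minus \<kappa> \<mu> V E v = Z_minus \<kappa> \<mu> W E v * Z_ising \<kappa> \<mu> (V - W) {}"
proof -
  have V: "V = W \<union> (V - W)" using W by auto
  have w: "ising_weight \<kappa> \<mu> V E (T1 \<union> T2) = ising_weight \<kappa> \<mu> W E T1 * ising_weight \<kappa> \<mu> (V - W) {} T2"
    if "T1 \<subseteq> W" "T2 \<subseteq> V - W" for T1 T2
    using ising_weight_Un[of W "V - W" E "{}" T1 T2 \<kappa> \<mu>] fin W E that finite_subset[OF W] V by (simp add: Un_absorb1)
  have v': "v \<notin> T2" if "T2 \<subseteq> V - W" for T2 using that v by auto
  have dis: "W \<inter> (V - W) = {}" by auto
  have sumV: "(\<Sum>T\<in>Pow V. f T) = (\<Sum>T1\<in>Pow W. \<Sum>T2\<in>Pow (V - W). f (T1 \<union> T2))" for f :: "'a set \<Rightarrow> real"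
    using sum_Pow_Un[OF dis, of f] V by simp
  show "Z_plus \<kappa> \<mu> V E v = Z_plus \<kappa> \<mu> W E v * Z_ising \<kappa> \<mu> (V - W) {}"
    unfolding Z_plus_def Z_ising_def sumV sum_product by (intro sum.cong refl) (auto simp: w v')
  show "Z_minus \<kappa> \<mu> V E v = Z_minus \<kappa> \<mu> W E v * Z_ising \<kappa> \<mu> (V - W) {}"
    unfolding Z_minus_def Z_ising_def sumV sum_product by (intro sum.cong refl) (auto simp: w v')
qed


section \<open>Magnetization of tree-like balls\<close>

lemma card_2_other_end:
  assumes "card e = 2" and "x \<in> e"
  obtains y where "e = {x, y}" "x \<noteq> y"
proof -
  obtain a b where "e = {a, b}" "a \<noteq> b" using assms(1) by (auto simp: card_2_iff)
  then show thesis using that[of a] that[of b] assms(2) by (auto simp: insert_commute)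
qed

lemma relpow_subset: "R \<subseteq> S \<Longrightarrow> R ^^ k \<subseteq> S ^^ k" for R S :: "('a \<times> 'a) set"
  by (induction k) auto

lemma rtrancl_imp_distinct_path:
  assumes "(a, b) \<in> R\<^sup>*"
  shows "\<exists>xs. distinct xs \<and> xs \<noteq> [] \<and> hd xs = a \<and> last xs = b \<and>
           (\<forall>i. Suc i < length xs \<longrightarrow> (xs ! i, xs ! Suc i) \<in> R)"
  using assms
proof (induction rule: rtrancl_induct)
  case base
  show ?case by (rule exI[of _ "[a]"]) auto
next
  case (step b c)
  then obtain xs where xs: "distinct xs" "xs \<noteq> []" "hd xs = a" "last xs = b"
    "\<forall>i. Suc i < length xs \<longrightarrow> (xs ! i, xs ! Suc i) \<in> R" by blast
  show ?case
  proof (cases "c \<in> set xs")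
    case True
    then obtain k where k: "k < length xs" "xs ! k = c" by (auto simp: in_set_conv_nth)
    \<comment> \<open>When the new endpoint already lies on the path, the path is cut there instead
      of extended.\<close>
    let ?ys = "take (Suc k) xs"
    have "last ?ys = c" using k by (simp add: take_Suc_conv_app_nth)
    moreover have "hd ?ys = a" "?ys \<noteq> []" using xs by (auto simp: hd_take)
    ultimately show ?thesis using xs k by (intro exI[of _ ?ys]) auto
  next
    case False
    have "(xs @ [c]) ! i = xs ! i" if "Suc i < length (xs @ [c])" for i
      using that by (simp add: nth_append)
    moreover have "((xs @ [c]) ! i, (xs @ [c]) ! Suc i) \<in> R" if "Suc i < length (xs @ [c])" for i
    proof (cases "Suc i < length xs")
      case True
      then show ?thesis using xs(5) by (simp add: nth_append)
    next
      case F: False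
      then have "Suc i = length xs" using that by simp
      then have "xs ! i = last xs" by (metis xs(2) diff_Suc_1 last_conv_nth)
      then show ?thesis using \<open>Suc i = length xs\<close> step(2) xs(4) by (simp add: nth_append)
    qed
    ultimately show ?thesis using xs False by (intro exI[of _ "xs @ [c]"]) auto
  qed
qed

text \<open>A repetition-free path from \<open>u\<close> to \<open>u'\<close> along edges avoiding
  \<open>v\<close> closes up through \<open>v\<close>. It has at least two vertices because
  \<open>u \<noteq> u'\<close>, so with \<open>v\<close> there are the three that
  \<open>is_cycle\<close> demands.\<close>

lemma cycle_through_vertex:
  assumes "{v, u} \<in> F" "{v, u'} \<in> F" "u \<noteq> u'" "u \<noteq> v"
    and conn: "(u, u') \<in> (adj {e \<in> F. v \<notin> e})\<^sup>*"
  shows "\<exists>xs. is_cycle F xs"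
proof -
  let ?R = "adj {e \<in> F. v \<notin> e}"
  obtain xs where xs: "distinct xs" "xs \<noteq> []" "hd xs = u" "last xs = u'"
    "\<forall>i. Suc i < length xs \<longrightarrow> (xs ! i, xs ! Suc i) \<in> ?R"
    using rtrancl_imp_distinct_path[OF conn] by blast
  have "length xs \<noteq> 1" using xs assms(3) by (auto simp: length_Suc_conv)
  then have len: "length xs \<ge> 2" using xs(2) by (cases xs) (auto simp: Suc_le_eq)
  have "x \<noteq> v" if x: "x \<in> set xs" for x
  proof -
    obtain i where i: "i < length xs" "xs ! i = x" using x by (auto simp: in_set_conv_nth)
    show ?thesis
    proof (cases i)
      case 0
      then have "(x, xs ! Suc 0) \<in> ?R" using xs(5) len i by auto
      then show ?thesis by (auto simp: adj_def)
    next
      case (Suc j)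
      then have "(xs ! j, x) \<in> ?R" using xs(5) i by auto
      then show ?thesis by (auto simp: adj_def)
    qed
  qed
  then have "distinct (v # xs)" using xs(1) by auto
  moreover have "{(v # xs) ! i, (v # xs) ! ((i + 1) mod length (v # xs))} \<in> F" if "i < length (v # xs)" for i
  proof (cases i)
    case 0
    then show ?thesis using assms(1) xs(2,3) len by (simp add: hd_conv_nth)
  next
    case (Suc j)
    show ?thesis
    proof (cases "Suc j < length xs")
      case True
      then have "(xs ! j, xs ! Suc j) \<in> ?R" using xs(5) by simp
      then show ?thesis using Suc True by (auto simp: adj_def)
    next
      case False
      then have "Suc j = length xs" using that Suc by simp
      then have "xs ! j = u'" using xs(2,4) by (metis diff_Suc_1 last_conv_nth)
      then have "(v # xs) ! i = u'" using Suc by simp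
      moreover have "(i + 1) mod length (v # xs) = 0" using Suc \<open>Suc j = length xs\<close> by simp
      ultimately show ?thesis using assms(2) by (simp add: insert_commute)
    qed
  qed
  ultimately show ?thesis unfolding is_cycle_def using len by (intro exI[of _ "v # xs"]) auto
qed

text \<open>Reachability uses only the edges that miss \<open>v\<close>, so in a forest this is the
  subtree hanging below the child \<open>u\<close> of \<open>v\<close>.\<close>

definition branch :: "'v set \<Rightarrow> 'v set set \<Rightarrow> 'v \<Rightarrow> 'v \<Rightarrow> 'v set" where
  "branch V F v u = {x \<in> V. (u, x) \<in> (adj {e \<in> F. v \<notin> e})\<^sup>*}"

definition branch_edges :: "'v set \<Rightarrow> 'v set set \<Rightarrow> 'v \<Rightarrow> 'v \<Rightarrow> 'v set set" where
  "branch_edges V F v u = {e \<in> F. v \<notin> e \<and> e \<subseteq> branch V F v u}"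

lemma branch_disjoint:
  assumes "\<nexists>xs. is_cycle F xs" and "{v, u} \<in> F" "{v, u'} \<in> F" "u \<noteq> u'" "u \<noteq> v"
  shows "branch V F v u \<inter> branch V F v u' = {}"
proof (rule ccontr)
  let ?R = "adj {e \<in> F. v \<notin> e}"
  assume "branch V F v u \<inter> branch V F v u' \<noteq> {}"
  then obtain x where x: "(u, x) \<in> ?R\<^sup>*" "(u', x) \<in> ?R\<^sup>*" by (auto simp: branch_def)
  have "sym ?R" unfolding sym_def adj_def by (auto simp: insert_commute)
  then have "sym (?R\<^sup>*)" by (rule sym_rtrancl)
  then have "(u, u') \<in> ?R\<^sup>*" using x by (meson rtrancl_trans symD)
  then show False using cycle_through_vertex[of v u F u'] assms by auto
qed

lemma branch_root:
  assumes "\<forall>e\<in>F. e \<subseteq> V \<and> card e = 2" and "{v, u} \<in> F"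
  shows "u \<in> branch V F v u" "u \<noteq> v" "v \<notin> branch V F v u"
proof -
  show "u \<in> branch V F v u" using assms by (auto simp: branch_def)
  show "u \<noteq> v" using assms by fastforce
  show "v \<notin> branch V F v u"
  proof
    assume "v \<in> branch V F v u"
    then have "(u, v) \<in> (adj {e \<in> F. v \<notin> e})\<^sup>*" by (auto simp: branch_def)
    then show False using \<open>u \<noteq> v\<close> by (cases rule: rtranclE) (auto simp: adj_def)
  qed
qed

text \<open>An edge from a vertex \<open>x \<noteq> u\<close> of the branch back to \<open>v\<close>
  would close a cycle. So every vertex of the branch keeps its full degree, except that the root
  \<open>u\<close> loses the edge to its parent.\<close>

lemma branch_edges_at:
  assumes F: "\<forall>e\<in>F. e \<subseteq> V \<and> card e = 2" and acyc: "\<nexists>xs. is_cycle F xs"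
    and vu: "{v, u} \<in> F" and x: "x \<in> branch V F v u"
  shows "{e \<in> F. x \<in> e} - {{v, u}} = {e \<in> branch_edges V F v u. x \<in> e}"
proof -
  let ?R = "adj {e \<in> F. v \<notin> e}"
  have "e \<in> branch_edges V F v u" if e: "e \<in> F" "x \<in> e" "e \<noteq> {v, u}" for e
  proof -
    obtain y where y: "e = {x, y}" "x \<noteq> y" using F e card_2_other_end by metis
    have "y \<noteq> v"
    proof
      assume yv: "y = v"
      then have "u \<noteq> x" using e y by auto
      moreover have "(u, x) \<in> ?R\<^sup>*" using x by (simp add: branch_def)
      ultimately show False
        using cycle_through_vertex[of v u F x] vu e y yv branch_root(2)[OF F vu] acyc by (simp add: insert_commute)
    qed
    moreover have "x \<noteq> v" using x branch_root(3)[OF F vu] by auto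
    ultimately have "(x, y) \<in> ?R" using e y by (auto simp: adj_def)
    then have "y \<in> branch V F v u" using x F e y by (auto simp: branch_def)
    then show ?thesis using x e y \<open>y \<noteq> v\<close> \<open>x \<noteq> v\<close> by (auto simp: branch_edges_def)
  qed
  then show ?thesis by (auto simp: branch_edges_def)
qed

text \<open>The ratio of plus to minus weight passed along an edge by a branch whose root has ratio \<open>R\<close>.\<close>

definition msg :: "real \<Rightarrow> real \<Rightarrow> real" where
  "msg \<kappa> R = (R + \<kappa>) / (\<kappa> * R + 1)"

lemma msg_ge_1: "0 < \<kappa> \<Longrightarrow> \<kappa> \<le> 1 \<Longrightarrow> R \<ge> 1 \<Longrightarrow> msg \<kappa> R \<ge> 1"
proof -
  assume a: "0 < \<kappa>" "\<kappa> \<le> 1" "R \<ge> 1"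
  then have "(1 - \<kappa>) * (R - 1) \<ge> 0" by simp
  moreover have "\<kappa> * R + 1 > 0" using a by (simp add: add_pos_pos)
  ultimately show ?thesis unfolding msg_def by (simp add: le_divide_eq algebra_simps)
qed

text \<open>Cross-multiplied monotonicity of \<open>msg \<kappa>\<close>: the two sides differ by a
  positive multiple of \<open>(p - R * m) * (1 - \<kappa>) * (1 + \<kappa>)\<close>.\<close>

lemma msg_bound:
  assumes \<kappa>: "0 < \<kappa>" "\<kappa> \<le> 1" and R: "R \<ge> 1" and p: "p \<ge> 0" "m \<ge> 0" "p + m > 0" and r: "R * m \<le> p"
  shows "msg \<kappa> R * (\<kappa> * p + m) \<le> p + \<kappa> * m"
proof -
  have pos: "\<kappa> * R + 1 > 0" using \<kappa> R by (simp add: add_pos_pos)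
  have "(p - R * m) * ((1 - \<kappa>) * (1 + \<kappa>)) \<ge> 0" using \<kappa> r by simp
  then have "(R + \<kappa>) * (\<kappa> * p + m) \<le> (p + \<kappa> * m) * (\<kappa> * R + 1)" by (simp add: algebra_simps)
  then show ?thesis unfolding msg_def using pos by (simp add: divide_le_eq)
qed

text \<open>Starting from the bare vertex \<open>v\<close> with ratio \<open>\<mu>\<close>, the
  branches are attached one at a time, and each multiplies the ratio by at least
  \<open>msg \<kappa> R\<close>.\<close>

lemma tree_step:
  assumes V: "finite V" and F: "\<forall>e\<in>F. e \<subseteq> V \<and> card e = 2" and acyc: "\<nexists>xs. is_cycle F xs"
    and v: "v \<in> V" and \<kappa>: "0 < \<kappa>" "\<kappa> \<le> 1" and \<mu>: "\<mu> \<ge> 1" and R: "R \<ge> 1"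
    and child: "\<And>u. {v, u} \<in> F \<Longrightarrow>
       R * Z_minus \<kappa> \<mu> (branch V F v u) (branch_edges V F v u) u
       \<le> Z_plus \<kappa> \<mu> (branch V F v u) (branch_edges V F v u) u"
  shows "\<mu> * msg \<kappa> R ^ card {e \<in> F. v \<in> e} * Z_minus \<kappa> \<mu> V F v \<le> Z_plus \<kappa> \<mu> V F v"
proof -
  define U where "U = {u. {v, u} \<in> F}"
  have "F \<subseteq> Pow V" using F by auto
  then have finF: "finite F" using V by (meson finite_Pow_iff finite_subset)
  have "U \<subseteq> V" using F by (auto simp: U_def)
  then have finU: "finite U" using V finite_subset by blast
  have root: "u \<in> branch V F v u" "u \<noteq> v" "v \<notin> branch V F v u" if "u \<in> U" for u
    using branch_root[OF F, of v u] that by (auto simp: U_def)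
  have "{e \<in> F. v \<in> e} = (\<lambda>u. {v, u}) ` U"
  proof -
    have "e \<in> (\<lambda>u. {v, u}) ` U" if e: "e \<in> F" "v \<in> e" for e
    proof -
      obtain y where "e = {v, y}" using F e card_2_other_end by metis
      then show ?thesis using e by (auto simp: U_def)
    qed
    then show ?thesis by (auto simp: U_def)
  qed
  then have cardU: "card {e \<in> F. v \<in> e} = card U"
    by (simp add: card_image inj_on_def doubleton_eq_iff)
  define VD where "VD D = insert v (\<Union>u\<in>D. branch V F v u)" for D
  define FD where "FD D = (\<lambda>u. {v, u}) ` D \<union> (\<Union>u\<in>D. branch_edges V F v u)" for D
  have br: "branch V F v u \<subseteq> V" "branch_edges V F v u \<subseteq> F" for u
    by (auto simp: branch_def branch_edges_def)
  have FDF: "FD D \<subseteq> F" if "D \<subseteq> U" for D using that br unfolding FD_def U_def by blast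
  have FDV: "\<forall>e\<in>FD D. e \<subseteq> VD D \<and> e \<noteq> {}" if "D \<subseteq> U" for D
  proof
    fix e assume "e \<in> FD D"
    then consider u where "u \<in> D" "e = {v, u}" | u where "u \<in> D" "e \<in> branch_edges V F v u"
      by (auto simp: FD_def)
    then show "e \<subseteq> VD D \<and> e \<noteq> {}"
    proof cases
      case 1
      then have "u \<in> branch V F v u" using that root by auto
      then show ?thesis using 1 by (auto simp: VD_def)
    next
      case 2
      then show ?thesis using F by (auto simp: branch_edges_def VD_def)
    qed
  qed
  have "U \<subseteq> U \<Longrightarrow> \<mu> * msg \<kappa> R ^ card U * Z_minus \<kappa> \<mu> (VD U) (FD U) v \<le> Z_plus \<kappa> \<mu> (VD U) (FD U) v"
    using finU
  proof (induction rule: finite_subset_induct')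
    case empty
    have "Pow {v} = {{}, {v}}" by auto
    then show ?case by (simp add: VD_def FD_def Z_plus_def Z_minus_def ising_weight_def)
  next
    case (insert u D)
    let ?B = "branch V F v u" and ?E = "branch_edges V F v u"
    have dis: "VD D \<inter> ?B = {}"
    proof -
      have "branch V F v u' \<inter> ?B = {}" if "u' \<in> D" for u'
        using branch_disjoint[OF acyc, of v u' u] insert that root(2)[of u'] by (auto simp: U_def)
      then show ?thesis using root(3)[of u] insert by (auto simp: VD_def)
    qed
    have finite: "finite (VD D)" "finite ?B" "finite (FD D)" "finite ?E"
      using V br insert finite_subset[OF FDF finF] finite_subset[OF br(2) finF]
      by (auto simp: VD_def intro: finite_subset)
    have eq: "VD (insert u D) = VD D \<union> ?B" "FD (insert u D) = insert {v, u} (FD D \<union> ?E)"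
      by (auto simp: VD_def FD_def)
    have E: "\<forall>e\<in>?E. e \<subseteq> ?B \<and> e \<noteq> {}" using F by (auto simp: branch_edges_def)
    have vD: "v \<in> VD D" by (simp add: VD_def)
    have pm: "Z_plus \<kappa> \<mu> ?B ?E u \<ge> 0" "Z_minus \<kappa> \<mu> ?B ?E u > 0"
      using \<kappa> \<mu> root insert finite by (auto intro: Z_plus_nonneg Z_minus_pos)
    have m: "msg \<kappa> R * (\<kappa> * Z_plus \<kappa> \<mu> ?B ?E u + Z_minus \<kappa> \<mu> ?B ?E u)
        \<le> Z_plus \<kappa> \<mu> ?B ?E u + \<kappa> * Z_minus \<kappa> \<mu> ?B ?E u"
      using pm child[of u] insert by (intro msg_bound \<kappa> R) (auto simp: U_def)
    have "(\<mu> * msg \<kappa> R ^ card D * Z_minus \<kappa> \<mu> (VD D) (FD D) v) *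
        (msg \<kappa> R * (\<kappa> * Z_plus \<kappa> \<mu> ?B ?E u + Z_minus \<kappa> \<mu> ?B ?E u))
       \<le> Z_plus \<kappa> \<mu> (VD D) (FD D) v * (Z_plus \<kappa> \<mu> ?B ?E u + \<kappa> * Z_minus \<kappa> \<mu> ?B ?E u)"
      using insert m pm \<kappa> \<mu> msg_ge_1[OF \<kappa> R] by (intro mult_mono Z_plus_nonneg) auto
    then show ?case unfolding eq
      unfolding Z_ratio_attach[OF finite dis FDV[OF insert(3)] E vD root(1)[OF insert(2)]]
      using insert finU by (simp add: algebra_simps)
  qed
  then have base: "\<mu> * msg \<kappa> R ^ card U * Z_minus \<kappa> \<mu> (VD U) (FD U) v \<le> Z_plus \<kappa> \<mu> (VD U) (FD U) v" by simp
  have VDV: "VD U \<subseteq> V" using br v by (auto simp: VD_def)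
  have vU: "v \<in> VD U" by (simp add: VD_def)
  have finFU: "finite (FD U)" using FDF[of U] finF finite_subset by blast
  \<comment> \<open>Vertices outside \<open>VD U\<close> are isolated with respect to
    \<open>FD U\<close>; edges of \<open>F\<close> out of reach of \<open>v\<close> are put back by
    monotonicity, so \<open>F\<close> may be disconnected.\<close>
  have "\<mu> * msg \<kappa> R ^ card U * Z_minus \<kappa> \<mu> V (FD U) v \<le> Z_plus \<kappa> \<mu> V (FD U) v"
    unfolding Z_extend_vertices[OF V finFU VDV FDV[OF order_refl] vU]
    using mult_right_mono[OF base, of "Z_ising \<kappa> \<mu> (V - VD U) {}"] Z_ising_pos[of "V - VD U" \<kappa> \<mu> "{}"] V \<kappa> \<mu>
    by (simp add: mult.assoc)
  then show ?thesis unfolding cardU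
    using F by (intro Z_ratio_mono_edges[OF V finF _ FDF[OF order_refl] v \<kappa> \<mu>]) auto
qed

text \<open>The value 1 at depth 0 is a lower bound for the ratio at any vertex, whatever lies
  beyond it, and an inner vertex of the \<open>d\<close>-regular tree has \<open>d - 1\<close>
  children.\<close>

fun tree_ratio :: "nat \<Rightarrow> real \<Rightarrow> real \<Rightarrow> nat \<Rightarrow> real" where
  "tree_ratio d \<kappa> \<mu> 0 = 1"
| "tree_ratio d \<kappa> \<mu> (Suc j) = \<mu> * msg \<kappa> (tree_ratio d \<kappa> \<mu> j) ^ (d - 1)"

lemma tree_ratio_ge_1:
  assumes "0 < \<kappa>" "\<kappa> \<le> 1" "\<mu> \<ge> 1"
  shows "tree_ratio d \<kappa> \<mu> j \<ge> 1"
proof (induction j)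
  case (Suc j)
  have "1 * 1 \<le> \<mu> * msg \<kappa> (tree_ratio d \<kappa> \<mu> j) ^ (d - 1)"
    using assms Suc by (intro mult_mono one_le_power msg_ge_1) auto
  then show ?case by simp
qed simp

lemma adj_branch_edges_relpow:
  "(u, x) \<in> adj (branch_edges V F v u) ^^ k \<Longrightarrow> (u, x) \<in> adj F ^^ k"
  by (rule subsetD[OF relpow_subset]) (auto simp: adj_def branch_edges_def)

text \<open>Without edges the ratio is \<open>\<mu> \<ge> 1\<close>, and restoring the edges can
  only increase it.\<close>

lemma isolated_ratio:
  assumes V: "finite V" and F: "\<forall>e\<in>F. e \<subseteq> V \<and> card e = 2"
    and v: "v \<in> V" and \<kappa>: "0 < \<kappa>" "\<kappa> \<le> 1" and \<mu>: "\<mu> \<ge> 1"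
  shows "1 * Z_minus \<kappa> \<mu> V F v \<le> Z_plus \<kappa> \<mu> V F v"
proof -
  have "F \<subseteq> Pow V" using F by auto
  then have finF: "finite F" using V by (meson finite_Pow_iff finite_subset)
  have "{v} \<subseteq> V" using v by auto
  from Z_extend_vertices[OF V finite.emptyI this] have
    e: "Z_plus \<kappa> \<mu> V {} v = Z_plus \<kappa> \<mu> {v} {} v * Z_ising \<kappa> \<mu> (V - {v}) {}"
    "Z_minus \<kappa> \<mu> V {} v = Z_minus \<kappa> \<mu> {v} {} v * Z_ising \<kappa> \<mu> (V - {v}) {}" by auto
  have "Pow {v} = {{}, {v}}" by auto
  then have "Z_plus \<kappa> \<mu> {v} {} v = \<mu>" "Z_minus \<kappa> \<mu> {v} {} v = 1"
    by (auto simp: Z_plus_def Z_minus_def ising_weight_def)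
  then have "1 * Z_minus \<kappa> \<mu> V {} v \<le> Z_plus \<kappa> \<mu> V {} v"
    using e \<mu> Z_ising_pos[of "V - {v}" \<kappa> \<mu> "{}"] V \<kappa> by simp
  then show ?thesis
    using F finF by (intro Z_ratio_mono_edges[OF V finF _ empty_subsetI v \<kappa> \<mu>]) auto
qed

text \<open>The degree of \<open>v\<close> itself is left free: the centre of a ball has
  \<open>d\<close> neighbours below it, while the root of a branch has one fewer. One statement thus
  serves both and the induction closes.\<close>

lemma rooted_ratio:
  assumes V: "finite V" and F: "\<forall>e\<in>F. e \<subseteq> V \<and> card e = 2" and acyc: "\<nexists>xs. is_cycle F xs"
    and v: "v \<in> V" and \<kappa>: "0 < \<kappa>" "\<kappa> \<le> 1" and \<mu>: "\<mu> \<ge> 1"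
    and deg: "\<And>k u. k \<le> j \<Longrightarrow> (v, u) \<in> adj F ^^ k \<Longrightarrow> u \<noteq> v \<Longrightarrow> card {e \<in> F. u \<in> e} \<ge> d"
  shows "\<mu> * msg \<kappa> (tree_ratio d \<kappa> \<mu> j) ^ card {e \<in> F. v \<in> e} * Z_minus \<kappa> \<mu> V F v \<le> Z_plus \<kappa> \<mu> V F v"
  using V F acyc v deg
proof (induction j arbitrary: V F v)
  case (0 V F v)
  \<comment> \<open>At depth 0 the branches are bounded by the trivial ratio 1, without any
    knowledge of degrees.\<close>
  show ?case
    by (rule tree_step[OF 0(1-4) \<kappa> \<mu> tree_ratio_ge_1[OF \<kappa> \<mu>]], unfold tree_ratio.simps,
        rule isolated_ratio[OF _ _ _ \<kappa> \<mu>])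
      (use 0 branch_root[OF 0(2)] in \<open>auto simp: branch_def branch_edges_def\<close>)
next
  case (Suc j V F v)
  let ?R = "tree_ratio d \<kappa> \<mu> j"
  have R: "?R \<ge> 1" using tree_ratio_ge_1 \<kappa> \<mu> by blast
  show ?case
  proof (rule tree_step[OF Suc.prems(1-4) \<kappa> \<mu> tree_ratio_ge_1[OF \<kappa> \<mu>]])
    fix u assume u: "{v, u} \<in> F"
    let ?B = "branch V F v u" and ?E = "branch_edges V F v u"
    note r = branch_root[OF Suc.prems(2) u]
    have "\<mu> * msg \<kappa> ?R ^ card {e \<in> ?E. u \<in> e} * Z_minus \<kappa> \<mu> ?B ?E u \<le> Z_plus \<kappa> \<mu> ?B ?E u"
    proof (rule Suc.IH)
      show "finite ?B" using Suc.prems(1) by (auto simp: branch_def)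
      show "\<forall>e\<in>?E. e \<subseteq> ?B \<and> card e = 2" using Suc.prems(2) by (auto simp: branch_edges_def)
      show "\<nexists>xs. is_cycle ?E xs" using Suc.prems(3) by (auto simp: is_cycle_def branch_edges_def)
      show "u \<in> ?B" by (rule r)
      fix k x assume k: "k \<le> j" and x: "(u, x) \<in> adj ?E ^^ k" "x \<noteq> u"
      have xB: "x \<in> ?B"
      proof -
        have "(u, x) \<in> (adj {e \<in> F. v \<notin> e}) ^^ k"
          by (rule subsetD[OF relpow_subset x(1)]) (auto simp: adj_def branch_edges_def)
        moreover have "x \<in> V"
        proof -
          obtain k' where "k = Suc k'" using x by (cases k) auto
          then obtain y where "{y, x} \<in> ?E" using x(1) by (auto simp: adj_def)
          then show ?thesis using Suc.prems(2) by (auto simp: branch_edges_def)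
        qed
        ultimately show ?thesis by (auto simp: branch_def relpow_imp_rtrancl)
      qed
      \<comment> \<open>Depth \<open>k\<close> below \<open>u\<close> is depth \<open>Suc k\<close>
        below \<open>v\<close>, where the degree hypothesis still applies.\<close>
      have "(v, x) \<in> adj F ^^ Suc k"
        using u adj_branch_edges_relpow[OF x(1)] by (intro relpow_Suc_I2) (auto simp: adj_def)
      moreover have xv: "x \<noteq> v" using xB r by auto
      ultimately have "card {e \<in> F. x \<in> e} \<ge> d" using Suc.prems(5)[of "Suc k" x] k by simp
      moreover have "{e \<in> F. x \<in> e} - {{v, u}} = {e \<in> F. x \<in> e}" using x(2) xv by auto
      ultimately show "card {e \<in> ?E. x \<in> e} \<ge> d"
        using branch_edges_at[OF Suc.prems(2,3) u xB] by simp
    qed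
    moreover have "tree_ratio d \<kappa> \<mu> (Suc j) * Z_minus \<kappa> \<mu> ?B ?E u
        \<le> \<mu> * msg \<kappa> ?R ^ card {e \<in> ?E. u \<in> e} * Z_minus \<kappa> \<mu> ?B ?E u"
    proof -
      have "(v, u) \<in> adj F ^^ 1" using u by (simp add: adj_def)
      then have "card {e \<in> F. u \<in> e} \<ge> d" using Suc.prems(5)[of 1 u] r(2) by simp
      moreover have "card ({e \<in> F. u \<in> e} - {{v, u}}) \<ge> card {e \<in> F. u \<in> e} - 1"
        by (simp add: card_Diff_singleton_if)
      \<comment> \<open>Only the edge to the parent is missing inside the branch.\<close>
      ultimately have "card {e \<in> ?E. u \<in> e} \<ge> d - 1"
        unfolding branch_edges_at[OF Suc.prems(2,3) u r(1)] by linarith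
      then have "tree_ratio d \<kappa> \<mu> (Suc j) \<le> \<mu> * msg \<kappa> ?R ^ card {e \<in> ?E. u \<in> e}"
        using \<mu> msg_ge_1[OF \<kappa> R] by (auto intro!: mult_left_mono power_increasing)
      then show ?thesis using \<kappa> \<mu> by (intro mult_right_mono Z_minus_nonneg) auto
    qed
    ultimately show "tree_ratio d \<kappa> \<mu> (Suc j) * Z_minus \<kappa> \<mu> ?B ?E u \<le> Z_plus \<kappa> \<mu> ?B ?E u" by linarith
  qed
qed

text \<open>The ball of radius \<open>Suc j\<close> contains every edge at a vertex within distance
  \<open>j\<close> of \<open>v\<close>, so degrees inside it are still \<open>d\<close> to that
  depth. Edges outside the ball return by monotonicity.\<close>

lemma root_ratio:
  assumes reg: "regular_graph d V E" and v: "v \<in> V"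
    and tree: "is_tree (nbhd V E (Suc j) v) (induced_edges E (nbhd V E (Suc j) v))"
    and \<kappa>: "0 < \<kappa>" "\<kappa> \<le> 1" and \<mu>: "\<mu> \<ge> 1"
  shows "\<mu> * msg \<kappa> (tree_ratio d \<kappa> \<mu> j) ^ d * Z_minus \<kappa> \<mu> V E v \<le> Z_plus \<kappa> \<mu> V E v"
proof -
  define U where "U = nbhd V E (Suc j) v"
  define F where "F = induced_edges E U"
  have V: "finite V" and E: "\<forall>e\<in>E. e \<subseteq> V \<and> card e = 2" and deg: "\<forall>v\<in>V. card {e \<in> E. v \<in> e} = d"
    using reg by (auto simp: regular_graph_def simple_graph_def)
  have "E \<subseteq> Pow V" using E by auto
  then have finE: "finite E" using V by (meson finite_Pow_iff finite_subset)
  have F: "\<forall>e\<in>F. e \<subseteq> V \<and> card e = 2" using E by (auto simp: F_def induced_edges_def)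
  have FE: "F \<subseteq> E" by (auto simp: F_def induced_edges_def)
  have acyc: "\<nexists>xs. is_cycle F xs" using tree by (simp add: is_tree_def F_def U_def)
  have nb: "{e \<in> F. u \<in> e} = {e \<in> E. u \<in> e}" if "k < Suc j" "(v, u) \<in> adj F ^^ k" for k u
  proof -
    have vu: "(v, u) \<in> adj E ^^ k" by (rule subsetD[OF relpow_subset that(2)]) (use FE in \<open>auto simp: adj_def\<close>)
    have "e \<subseteq> U" if e: "e \<in> E" "u \<in> e" for e
    proof
      fix y assume y: "y \<in> e"
      have yV: "y \<in> V" using E e y by auto
      show "y \<in> U"
      proof (cases "y = u")
        case True
        then show ?thesis using vu \<open>k < Suc j\<close> yV by (auto simp: U_def nbhd_def intro!: exI[of _ k])
      next
        case False
        then have "e = {u, y}" using E e y card_2_other_end by (metis insert_iff singletonD)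
        then have "(v, y) \<in> adj E ^^ Suc k" using vu e by (auto simp: adj_def)
        then show ?thesis using \<open>k < Suc j\<close> yV unfolding U_def nbhd_def by (auto intro!: exI[of _ "Suc k"] simp del: relpow.simps)
      qed
    qed
    then show ?thesis by (auto simp: F_def induced_edges_def)
  qed
  have d: "card {e \<in> F. u \<in> e} = d" if "k < Suc j" "(v, u) \<in> adj F ^^ k" for k u
  proof -
    have "u \<in> V"
    proof (cases k)
      case (Suc k')
      then show ?thesis using that(2) F by (fastforce simp: adj_def)
    qed (use that v in auto)
    then show ?thesis using nb[OF that] deg by simp
  qed
  have "\<mu> * msg \<kappa> (tree_ratio d \<kappa> \<mu> j) ^ card {e \<in> F. v \<in> e} * Z_minus \<kappa> \<mu> V F v \<le> Z_plus \<kappa> \<mu> V F v"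
    by (rule rooted_ratio[OF V F acyc v \<kappa> \<mu>]) (simp add: d less_Suc_eq_le)
  then have "\<mu> * msg \<kappa> (tree_ratio d \<kappa> \<mu> j) ^ d * Z_minus \<kappa> \<mu> V F v \<le> Z_plus \<kappa> \<mu> V F v"
    using d[of 0 v] by simp
  then show ?thesis using E by (intro Z_ratio_mono_edges[OF V finE _ FE v \<kappa> \<mu>]) auto
qed


section \<open>The gauge expansion\<close>

lemma prod_edges_degree:
  assumes "finite V" "finite A" "\<forall>e\<in>A. e \<subseteq> V"
  shows "(\<Prod>e\<in>A. \<Prod>v\<in>e. g v) = (\<Prod>v\<in>V. (g v :: real) ^ card {e \<in> A. v \<in> e})"
proof -
  have "(\<Prod>e\<in>A. \<Prod>v\<in>e. g v) = (\<Prod>e\<in>A. \<Prod>v\<in>V. if v \<in> e then g v else 1)"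
  proof (rule prod.cong[OF refl])
    fix e assume "e \<in> A"
    then have "e \<subseteq> V" using assms by auto
    then have "V \<inter> {v. v \<in> e} = e" by auto
    then show "(\<Prod>v\<in>e. g v) = (\<Prod>v\<in>V. if v \<in> e then g v else 1)"
      using assms(1) by (simp add: prod.If_cases)
  qed
  also have "\<dots> = (\<Prod>v\<in>V. \<Prod>e\<in>A. if v \<in> e then g v else 1)" by (rule prod.swap)
  also have "\<dots> = (\<Prod>v\<in>V. g v ^ card {e \<in> A. v \<in> e})"
    by (intro prod.cong refl) (use assms in \<open>simp add: prod.If_cases Int_def\<close>)
  finally show ?thesis .
qed

text \<open>The edge matrix is \<open>\<alpha> \<alpha>\<^sup>T + \<gamma> \<gamma>\<^sup>T\<close>, where \<open>\<alpha>\<close> is proportional to the image of the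
  message vector \<open>(R, 1)\<close>. Expanding over the edges that carry \<open>\<gamma>\<close>, the fixed point equation
  kills the weight of degree one, and every other weight is nonnegative for the right sign
  of \<open>k\<close>. So the empty edge set alone is a lower bound.\<close>

lemma Z_ising_ge:
  assumes reg: "regular_graph d V E" and d: "d \<ge> 1" and \<kappa>: "0 < \<kappa>" "\<kappa> \<le> 1" and \<mu>: "\<mu> > 0" and R: "R > 0"
    and fp: "\<mu> * (R + \<kappa>) ^ (d - 1) = R * (\<kappa> * R + 1) ^ (d - 1)"
  shows "((\<mu> * (R + \<kappa>) ^ d + (\<kappa> * R + 1) ^ d) / sqrt (R\<^sup>2 + 2 * \<kappa> * R + 1) ^ d) ^ card V
         \<le> Z_ising \<kappa> \<mu> V E"
proof -
  have V: "finite V" and E: "\<forall>e\<in>E. e \<subseteq> V \<and> card e = 2" and deg: "\<forall>v\<in>V. card {e \<in> E. v \<in> e} = d"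
    using reg by (auto simp: regular_graph_def simple_graph_def)
  have "E \<subseteq> Pow V" using E by auto
  then have finE: "finite E" using V by (meson finite_Pow_iff finite_subset)
  define s where "s = sqrt (R\<^sup>2 + 2 * \<kappa> * R + 1)"
  have s2: "s\<^sup>2 = R\<^sup>2 + 2 * \<kappa> * R + 1" and s: "s > 0"
    using R \<kappa> by (auto simp: s_def add_nonneg_pos)
  define ap am where "ap = (R + \<kappa>) / s" and "am = (\<kappa> * R + 1) / s"
  have pos: "ap > 0" "am > 0" using R \<kappa> s by (auto simp: ap_def am_def add_pos_pos)
  define k where "k = (if 1 / ap \<ge> R / am then 1 else -1) * sqrt (1 - \<kappa>\<^sup>2) / s"
  have "1 - \<kappa>\<^sup>2 \<ge> 0" using \<kappa> by (simp add: power_le_one)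
  then have k2: "k\<^sup>2 = (1 - \<kappa>\<^sup>2) / s\<^sup>2" by (simp add: k_def power_mult_distrib power_divide)
  have kpos: "1 / ap \<ge> R / am \<Longrightarrow> k \<ge> 0" "\<not> 1 / ap \<ge> R / am \<Longrightarrow> k \<le> 0"
    using s \<open>1 - \<kappa>\<^sup>2 \<ge> 0\<close> by (auto simp: k_def)
  define \<alpha> where "\<alpha> T v = (if v \<in> T then am else ap)" for T and v :: 'a
  \<comment> \<open>The vector \<open>(k, - R * k)\<close> is orthogonal to the message vector
    \<open>(R, 1)\<close>; the size of \<open>k\<close> is fixed by asking that the rest of the edge
    matrix have rank one.\<close>
  define \<gamma> where "\<gamma> T v = (if v \<in> T then - R * k else k)" for T and v :: 'a
  \<comment> \<open>The weight of a vertex with \<open>j\<close> incident edges carrying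
    \<open>\<gamma>\<close>, summed over its spin.\<close>
  define f where "f j = \<mu> * ap ^ (d - j) * k ^ j + am ^ (d - j) * (- R * k) ^ j" for j
  have edge: "(if e \<subseteq> T \<or> e \<inter> T = {} then 1 else \<kappa>) = (\<Prod>v\<in>e. \<gamma> T v) + (\<Prod>v\<in>e. \<alpha> T v)"
    if "e \<in> E" for e T
  proof -
    obtain x y where xy: "e = {x, y}" "x \<noteq> y" using E \<open>e \<in> E\<close> by (metis card_2_iff)
    have pp: "ap * ap + k * k = 1"
    proof -
      have "ap * ap + k * k = ((R + \<kappa>)\<^sup>2 + (1 - \<kappa>\<^sup>2)) / s\<^sup>2"
        unfolding add_divide_distrib[of "(R + \<kappa>)\<^sup>2"] k2[symmetric] by (simp add: ap_def power2_eq_square)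
      also have "(R + \<kappa>)\<^sup>2 + (1 - \<kappa>\<^sup>2) = s\<^sup>2" unfolding s2 by (simp add: power2_eq_square algebra_simps)
      finally show ?thesis using s by simp
    qed
    have mm: "am * am + (R * k) * (R * k) = 1"
    proof -
      have "am * am + (R * k) * (R * k) = am * am + R\<^sup>2 * k\<^sup>2" by (simp add: power2_eq_square)
      also have "\<dots> = ((\<kappa> * R + 1)\<^sup>2 + R\<^sup>2 * (1 - \<kappa>\<^sup>2)) / s\<^sup>2"
        unfolding k2 add_divide_distrib[of "(\<kappa> * R + 1)\<^sup>2"] by (simp add: am_def power2_eq_square)
      also have "(\<kappa> * R + 1)\<^sup>2 + R\<^sup>2 * (1 - \<kappa>\<^sup>2) = s\<^sup>2"
        unfolding s2 by (simp add: power2_eq_square algebra_simps)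
      finally show ?thesis using s by simp
    qed
    have pm: "ap * am - R * k * k = \<kappa>"
    proof -
      have "ap * am - R * k * k = ap * am - R * k\<^sup>2" by (simp add: power2_eq_square)
      also have "\<dots> = ((R + \<kappa>) * (\<kappa> * R + 1) - R * (1 - \<kappa>\<^sup>2)) / s\<^sup>2"
        unfolding k2 diff_divide_distrib[of "(R + \<kappa>) * (\<kappa> * R + 1)"] by (simp add: ap_def am_def power2_eq_square)
      also have "(R + \<kappa>) * (\<kappa> * R + 1) - R * (1 - \<kappa>\<^sup>2) = \<kappa> * s\<^sup>2"
        unfolding s2 by (simp add: power2_eq_square algebra_simps)
      finally show ?thesis using s by simp
    qed
    show ?thesis using xy pp mm pm by (auto simp: \<alpha>_def \<gamma>_def algebra_simps)
  qed
  have expand: "(\<Prod>v\<in>V. if v \<in> T then 1 else \<mu>) * ((\<Prod>e\<in>A. \<Prod>v\<in>e. \<gamma> T v) * (\<Prod>e\<in>E - A. \<Prod>v\<in>e. \<alpha> T v)) =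
      (\<Prod>v\<in>T. am ^ (d - card {e \<in> A. v \<in> e}) * (- R * k) ^ card {e \<in> A. v \<in> e}) *
      (\<Prod>v\<in>V - T. \<mu> * ap ^ (d - card {e \<in> A. v \<in> e}) * k ^ card {e \<in> A. v \<in> e})"
    if A: "A \<subseteq> E" and T: "T \<subseteq> V" for A T
  proof -
    have finA: "finite A" using A finE finite_subset by blast
    have dd: "card {e \<in> E. e \<notin> A \<and> v \<in> e} = d - card {e \<in> A. v \<in> e}" if "v \<in> V" for v
    proof -
      have "{e \<in> E. e \<notin> A \<and> v \<in> e} = {e \<in> E. v \<in> e} - {e \<in> A. v \<in> e}" by auto
      then show ?thesis using deg that A finA by (simp add: card_Diff_subset Collect_mono_iff subset_iff)
    qed
    have "(\<Prod>v\<in>V. if v \<in> T then 1 else \<mu>) * ((\<Prod>e\<in>A. \<Prod>v\<in>e. \<gamma> T v) * (\<Prod>e\<in>E - A. \<Prod>v\<in>e. \<alpha> T v)) =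
      (\<Prod>v\<in>V. (if v \<in> T then 1 else \<mu>) * (\<gamma> T v ^ card {e \<in> A. v \<in> e} * \<alpha> T v ^ card {e \<in> E - A. v \<in> e}))"
      using A E finA finE V by (subst (1 2) prod_edges_degree[of V]) (auto simp: prod.distrib)
    also have "\<dots> = (\<Prod>v\<in>V. if v \<in> T then am ^ (d - card {e \<in> A. v \<in> e}) * (- R * k) ^ card {e \<in> A. v \<in> e}
        else \<mu> * ap ^ (d - card {e \<in> A. v \<in> e}) * k ^ card {e \<in> A. v \<in> e})"
      by (intro prod.cong refl) (auto simp: dd \<alpha>_def \<gamma>_def)
    also have "\<dots> = (\<Prod>v\<in>T. am ^ (d - card {e \<in> A. v \<in> e}) * (- R * k) ^ card {e \<in> A. v \<in> e}) *
      (\<Prod>v\<in>V - T. \<mu> * ap ^ (d - card {e \<in> A. v \<in> e}) * k ^ card {e \<in> A. v \<in> e})"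
    proof -
      have "V \<inter> {v. v \<in> T} = T" "V \<inter> - {v. v \<in> T} = V - T" using T by auto
      then show ?thesis using V by (simp add: prod.If_cases)
    qed
    finally show ?thesis .
  qed
  have "Z_ising \<kappa> \<mu> V E = (\<Sum>T\<in>Pow V. \<Sum>A\<in>Pow E. (\<Prod>v\<in>V. if v \<in> T then 1 else \<mu>) *
      ((\<Prod>e\<in>A. \<Prod>v\<in>e. \<gamma> T v) * (\<Prod>e\<in>E - A. \<Prod>v\<in>e. \<alpha> T v)))"
    unfolding Z_ising_def ising_weight_def sum_distrib_left[symmetric]
    by (intro sum.cong refl) (simp add: edge prod_add[OF finE] cong: prod.cong)
  also have "\<dots> = (\<Sum>A\<in>Pow E. \<Sum>T\<in>Pow V.
      (\<Prod>v\<in>T. am ^ (d - card {e \<in> A. v \<in> e}) * (- R * k) ^ card {e \<in> A. v \<in> e}) *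
      (\<Prod>v\<in>V - T. \<mu> * ap ^ (d - card {e \<in> A. v \<in> e}) * k ^ card {e \<in> A. v \<in> e}))"
    by (subst sum.swap) (intro sum.cong refl, auto simp: expand)
  also have "\<dots> = (\<Sum>A\<in>Pow E. \<Prod>v\<in>V. f (card {e \<in> A. v \<in> e}))"
    unfolding prod_add[OF V, symmetric] f_def by (simp add: add.commute)
  finally have Z: "Z_ising \<kappa> \<mu> V E = (\<Sum>A\<in>Pow E. \<Prod>v\<in>V. f (card {e \<in> A. v \<in> e}))" .
  have fp': "\<mu> * ap ^ (d - 1) = R * am ^ (d - 1)"
    using fp s by (simp add: ap_def am_def power_divide)
  have f: "f j \<ge> 0" if "j \<le> d" for j
  proof (cases j)
    case 0
    then show ?thesis using \<mu> pos by (simp add: f_def)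
  next
    case (Suc i)
    have e: "x ^ (d - j) = x ^ (d - 1) * (1 / x) ^ i" if "x > 0" for x :: real
    proof -
      have "x ^ (d - 1) = x ^ (d - j) * x ^ i" using Suc \<open>j \<le> d\<close> by (simp flip: power_add)
      then show ?thesis using that by (simp add: power_divide)
    qed
    have "f j = \<mu> * ap ^ (d - 1) * (1 / ap) ^ i * k ^ j + am ^ (d - 1) * (1 / am) ^ i * (- R * k) ^ j"
      unfolding f_def e[OF pos(1)] e[OF pos(2)] by simp
    also have "\<dots> = R * am ^ (d - 1) * (k ^ j * ((1 / ap) ^ i - (- R / am) ^ i))"
      unfolding fp' Suc by (simp add: algebra_simps power_divide power_mult_distrib power_minus')
    finally have fj: "f j = R * am ^ (d - 1) * (k ^ j * ((1 / ap) ^ i - (- R / am) ^ i))" .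
    \<comment> \<open>For even \<open>j\<close> both terms have the right sign. For odd
      \<open>j\<close> the bracket has the sign of \<open>1 / ap - R / am\<close> (or vanishes), and
      the sign of \<open>k\<close> was chosen to match it.\<close>
    have "k ^ j * ((1 / ap) ^ i - (- R / am) ^ i) \<ge> 0"
    proof (cases "even j")
      case True
      then have "odd i" using Suc by simp
      then have "(- R / am) ^ i \<le> 0" using R pos by (simp add: power_le_zero_eq divide_nonpos_pos)
      moreover have "(1 / ap) ^ i \<ge> 0" using pos by simp
      ultimately show ?thesis using True by (simp add: zero_le_even_power)
    next
      case False
      then have "even i" using Suc by simp
      then have i: "(- R / am) ^ i = (R / am) ^ i" by (simp flip: minus_divide_left)
      show ?thesis
      proof (cases "1 / ap \<ge> R / am")
        case True
        then have "(1 / ap) ^ i \<ge> (R / am) ^ i" using R pos by (intro power_mono) auto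
        then show ?thesis unfolding i using kpos(1)[OF True] by simp
      next
        case F: False
        then have "(1 / ap) ^ i \<le> (R / am) ^ i" using R pos by (intro power_mono) auto
        moreover have "k ^ j \<le> 0" using kpos(2)[OF F] \<open>even i\<close> Suc by (simp add: zero_le_even_power mult_nonpos_nonneg)
        ultimately show ?thesis unfolding i by (simp add: mult_nonpos_nonpos)
      qed
    qed
    then show ?thesis unfolding fj using R pos by simp
  qed
  have "f 0 ^ card V = (\<Prod>v\<in>V. f (card {e \<in> {}. v \<in> e}))" by simp
  also have "\<dots> \<le> Z_ising \<kappa> \<mu> V E" unfolding Z
  proof (rule member_le_sum)
    fix A assume A: "A \<in> Pow E - {{}}"
    have "card {e \<in> A. v \<in> e} \<le> d" if v: "v \<in> V" for v
    proof -
      have "card {e \<in> A. v \<in> e} \<le> card {e \<in> E. v \<in> e}" using A finE by (intro card_mono) auto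
      then show ?thesis using deg v by auto
    qed
    then show "(\<Prod>v\<in>V. f (card {e \<in> A. v \<in> e})) \<ge> 0" using f by (intro prod_nonneg) auto
  qed (use finE in auto)
  also have "f 0 = (\<mu> * (R + \<kappa>) ^ d + (\<kappa> * R + 1) ^ d) / s ^ d"
    unfolding f_def ap_def am_def power_divide add_divide_distrib[of "\<mu> * (R + \<kappa>) ^ d"] by simp
  finally show ?thesis unfolding s_def .
qed

text \<open>The rank two approximation of the random cluster model: \<open>T\<close> is the union of the components
  contributing \<open>(q - 1) exp (- B |C|)\<close> instead of \<open>1\<close>, and every component in \<open>T\<close> is counted
  as if it were a tree.\<close>

definition Z_two :: "real \<Rightarrow> real \<Rightarrow> real \<Rightarrow> 'v set \<Rightarrow> 'v set set \<Rightarrow> real" where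
  "Z_two a c l V E = (\<Sum>T\<in>Pow V. l ^ card T *
     (\<Prod>e\<in>E. if e \<subseteq> T then c else if e \<inter> T = {} then a else 1))"

text \<open>Each edge weight is a product of one square root per endpoint and an Ising interaction.
  By regularity the square roots collect to a \<open>d\<close>-th power at every vertex, that is, to
  a field.\<close>

lemma Z_two_eq_ising:
  assumes reg: "regular_graph d V E" and a: "a > 0" "c > 0" "l > 0"
  shows "Z_two a c l V E = (sqrt c ^ d * l) ^ card V *
     Z_ising (1 / (sqrt a * sqrt c)) (sqrt a ^ d / (sqrt c ^ d * l)) V E"
proof -
  have V: "finite V" and E: "\<forall>e\<in>E. e \<subseteq> V \<and> card e = 2" and deg: "\<forall>v\<in>V. card {e \<in> E. v \<in> e} = d"
    using reg by (auto simp: regular_graph_def simple_graph_def)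
  have "E \<subseteq> Pow V" using E by auto
  then have finE: "finite E" using V by (meson finite_Pow_iff finite_subset)
  let ?k = "1 / (sqrt a * sqrt c)"
  show ?thesis unfolding Z_two_def Z_ising_def sum_distrib_left
  proof (rule sum.cong[OF refl])
    fix T assume "T \<in> Pow V"
    then have T: "T \<subseteq> V" by simp
    define h where "h v = (if v \<in> T then sqrt c else sqrt a)" for v
    have "(\<Prod>e\<in>E. if e \<subseteq> T then c else if e \<inter> T = {} then a else 1) =
        (\<Prod>e\<in>E. (\<Prod>v\<in>e. h v) * (if e \<subseteq> T \<or> e \<inter> T = {} then 1 else ?k))"
    proof (rule prod.cong[OF refl])
      fix e assume "e \<in> E"
      then obtain x y where xy: "e = {x, y}" "x \<noteq> y" using E by (metis card_2_iff)
      then show "(if e \<subseteq> T then c else if e \<inter> T = {} then a else 1) =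
          (\<Prod>v\<in>e. h v) * (if e \<subseteq> T \<or> e \<inter> T = {} then 1 else ?k)"
        using a by (auto simp: h_def)
    qed
    also have "\<dots> = (\<Prod>v\<in>V. h v ^ d) * (\<Prod>e\<in>E. if e \<subseteq> T \<or> e \<inter> T = {} then 1 else ?k)"
      unfolding prod.distrib using V finE E deg by (subst prod_edges_degree[of V]) (auto intro!: prod.cong)
    finally have e: "(\<Prod>e\<in>E. if e \<subseteq> T then c else if e \<inter> T = {} then a else 1) =
       (\<Prod>v\<in>V. h v ^ d) * (\<Prod>e\<in>E. if e \<subseteq> T \<or> e \<inter> T = {} then 1 else ?k)" .
    have l: "l ^ card T = (\<Prod>v\<in>V. if v \<in> T then l else 1)"
    proof -
      have "V \<inter> {v. v \<in> T} = T" using T by auto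
      then show ?thesis using V by (simp add: prod.If_cases)
    qed
    have "l ^ card T * (\<Prod>v\<in>V. h v ^ d) = (\<Prod>v\<in>V. (sqrt c ^ d * l) *
        (if v \<in> T then 1 else sqrt a ^ d / (sqrt c ^ d * l)))"
      unfolding l prod.distrib[symmetric] using a by (auto intro!: prod.cong simp: h_def)
    also have "\<dots> = (sqrt c ^ d * l) ^ card V * (\<Prod>v\<in>V. if v \<in> T then 1 else sqrt a ^ d / (sqrt c ^ d * l))"
      by (simp add: prod.distrib)
    finally show "l ^ card T * (\<Prod>e\<in>E. if e \<subseteq> T then c else if e \<inter> T = {} then a else 1) =
      (sqrt c ^ d * l) ^ card V * ising_weight ?k (sqrt a ^ d / (sqrt c ^ d * l)) V E T"
      unfolding e ising_weight_def by (simp add: mult.assoc[symmetric])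
  qed
qed

lemma Z_ising_flip:
  assumes V: "finite V" and E: "\<forall>e\<in>E. e \<subseteq> V \<and> card e = 2" and \<mu>: "\<mu> > 0"
  shows "Z_ising \<kappa> \<mu> V E = \<mu> ^ card V * Z_ising \<kappa> (1 / \<mu>) V E"
proof -
  have "bij_betw (\<lambda>T. V - T) (Pow V) (Pow V)"
    by (rule bij_betw_byWitness[where f' = "\<lambda>T. V - T"]) auto
  from sum.reindex_bij_betw[OF this, of "ising_weight \<kappa> \<mu> V E", symmetric]
  have "Z_ising \<kappa> \<mu> V E = (\<Sum>T\<in>Pow V. ising_weight \<kappa> \<mu> V E (V - T))" by (simp add: Z_ising_def)
  also have "\<dots> = (\<Sum>T\<in>Pow V. \<mu> ^ card V * ising_weight \<kappa> (1 / \<mu>) V E T)"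
  proof (rule sum.cong[OF refl])
    fix T assume "T \<in> Pow V"
    have "(\<Prod>v\<in>V. if v \<in> V - T then 1 else \<mu>) = \<mu> ^ card V * (\<Prod>v\<in>V. if v \<in> T then 1 else 1 / \<mu>)"
      using \<mu> by (subst prod_constant[symmetric], subst prod.distrib[symmetric]) (auto intro!: prod.cong)
    moreover have "(\<Prod>e\<in>E. if e \<subseteq> V - T \<or> e \<inter> (V - T) = {} then 1 else \<kappa>) =
        (\<Prod>e\<in>E. if e \<subseteq> T \<or> e \<inter> T = {} then 1 else \<kappa>)"
    proof (rule prod.cong[OF refl])
      fix e assume "e \<in> E"
      then have "e \<subseteq> V" using E by auto
      then have "e \<subseteq> V - T \<longleftrightarrow> e \<inter> T = {}" "e \<inter> (V - T) = {} \<longleftrightarrow> e \<subseteq> T" by auto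
      then show "(if e \<subseteq> V - T \<or> e \<inter> (V - T) = {} then 1 else \<kappa>) = (if e \<subseteq> T \<or> e \<inter> T = {} then 1 else \<kappa>)"
        by auto
    qed
    ultimately show "ising_weight \<kappa> \<mu> V E (V - T) = \<mu> ^ card V * ising_weight \<kappa> (1 / \<mu>) V E T"
      unfolding ising_weight_def by simp
  qed
  finally show ?thesis by (simp add: Z_ising_def sum_distrib_left)
qed


section \<open>Comparison with the random cluster model\<close>

definition conn :: "'v set \<Rightarrow> 'v set set \<Rightarrow> ('v \<times> 'v) set" where
  "conn V A = {(u, v). u \<in> V \<and> v \<in> V \<and> (u, v) \<in> (adj A)\<^sup>*}"

lemma equiv_conn: "equiv V (conn V A)"
proof (rule equivI)
  have "sym (adj A)" unfolding sym_def adj_def by (auto simp: insert_commute)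
  then have "sym ((adj A)\<^sup>*)" by (rule sym_rtrancl)
  then show "sym (conn V A)" by (auto simp: conn_def sym_def)
  show "refl_on V (conn V A)" by (auto simp: conn_def refl_on_def)
  show "trans (conn V A)" unfolding trans_def conn_def by (blast intro: rtrancl_trans)
  show "conn V A \<subseteq> V \<times> V" unfolding conn_def by auto
qed

lemma components_quotient: "components V A = V // conn V A"
  by (simp add: components_def conn_def)

lemma Union_components: "\<Union> (components V A) = V"
  using Union_quotient[OF equiv_conn, of V A] unfolding components_quotient by simp

lemma finite_components: "finite V \<Longrightarrow> finite (components V A)"
  unfolding components_quotient by (rule finite_quotient) (auto simp: conn_def)

lemma component_subset: "C \<in> components V A \<Longrightarrow> C \<subseteq> V"
  using Union_components[of V A] by blast

lemma component_nonempty: "C \<in> components V A \<Longrightarrow> C \<noteq> {}"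
  using in_quotient_imp_non_empty[OF equiv_conn, of C V A] unfolding components_quotient by simp

lemma components_disjoint:
  "C \<in> components V A \<Longrightarrow> D \<in> components V A \<Longrightarrow> C \<noteq> D \<Longrightarrow> C \<inter> D = {}"
  using quotient_disj[OF equiv_conn, of C V A D] unfolding components_quotient by simp

lemma component_connected:
  "C \<in> components V A \<Longrightarrow> x \<in> C \<Longrightarrow> y \<in> C \<longleftrightarrow> y \<in> V \<and> (x, y) \<in> (adj A)\<^sup>*"
proof -
  assume C: "C \<in> components V A" "x \<in> C"
  obtain z where z: "C = conn V A `` {z}" using C(1) unfolding components_quotient by (rule quotientE)
  then have "(z, x) \<in> conn V A" using C(2) by simp
  then have "conn V A `` {z} = conn V A `` {x}" by (rule equiv_class_eq[OF equiv_conn])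
  then have "y \<in> C \<longleftrightarrow> (x, y) \<in> conn V A" unfolding z by auto
  moreover have "x \<in> V" using \<open>(z, x) \<in> conn V A\<close> by (simp add: conn_def)
  ultimately show ?thesis by (simp add: conn_def)
qed

lemma component_edge_subset:
  assumes "C \<in> components V A" "\<forall>e\<in>A. e \<subseteq> V \<and> card e = 2" "e \<in> A" "e \<inter> C \<noteq> {}"
  shows "e \<subseteq> C"
proof -
  obtain x where x: "x \<in> e" "x \<in> C" using assms(4) by auto
  have "card e = 2" using assms(2,3) by simp
  then obtain y where y: "e = {x, y}" using x(1) by (rule card_2_other_end)
  then have "(x, y) \<in> (adj A)\<^sup>*" using assms(3) by (auto simp: adj_def)
  then have "y \<in> C" using component_connected[OF assms(1) x(2)] assms y by auto
  then show ?thesis using x y by simp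
qed

text \<open>A vertex set cut by no edge of \<open>A\<close> is a union of components, and the family
  can be read off from its union because components are nonempty and disjoint.\<close>

lemma sum_over_unions_of_components:
  assumes V: "finite V" and A: "\<forall>e\<in>A. e \<subseteq> V \<and> card e = 2"
  shows "(\<Sum>T\<in>{T\<in>Pow V. \<forall>e\<in>A. e \<subseteq> T \<or> e \<inter> T = {}}. f T) = (\<Sum>D\<in>Pow (components V A). f (\<Union> D))"
proof (rule sum.reindex_bij_betw[symmetric], rule bij_betw_byWitness[where f' = "\<lambda>T. {C \<in> components V A. C \<subseteq> T}"])
  show "\<forall>D\<in>Pow (components V A). {C \<in> components V A. C \<subseteq> \<Union> D} = D"
  proof
    fix D assume D: "D \<in> Pow (components V A)"
    have "C \<in> D" if C: "C \<in> components V A" "C \<subseteq> \<Union> D" for C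
    proof -
      obtain x where "x \<in> C" using component_nonempty[OF C(1)] by auto
      then obtain C' where "C' \<in> D" "x \<in> C'" using C by auto
      then have "C' = C" using components_disjoint[OF C(1), of C'] D \<open>x \<in> C\<close> by auto
      then show ?thesis using \<open>C' \<in> D\<close> by simp
    qed
    then show "{C \<in> components V A. C \<subseteq> \<Union> D} = D" using D by auto
  qed
  show "\<forall>T\<in>{T\<in>Pow V. \<forall>e\<in>A. e \<subseteq> T \<or> e \<inter> T = {}}. \<Union> {C \<in> components V A. C \<subseteq> T} = T"
  proof
    fix T assume T: "T \<in> {T\<in>Pow V. \<forall>e\<in>A. e \<subseteq> T \<or> e \<inter> T = {}}"
    have "x \<in> \<Union> {C \<in> components V A. C \<subseteq> T}" if x: "x \<in> T" for x
    proof -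
      have "x \<in> \<Union> (components V A)" unfolding Union_components using x T by auto
      then obtain C where C: "C \<in> components V A" "x \<in> C" by auto
      have "y \<in> T" if "(x, y) \<in> (adj A)\<^sup>*" for y
        using that by (induction rule: rtrancl_induct) (use x T in \<open>auto simp: adj_def\<close>)
      then have "C \<subseteq> T" using component_connected[OF C] by auto
      then show ?thesis using C by auto
    qed
    then show "\<Union> {C \<in> components V A. C \<subseteq> T} = T" by auto
  qed
  show "\<Union> ` Pow (components V A) \<subseteq> {T \<in> Pow V. \<forall>e\<in>A. e \<subseteq> T \<or> e \<inter> T = {}}"
  proof safe
    fix D x C assume "D \<subseteq> components V A" "x \<in> C" "C \<in> D"
    then show "x \<in> V" using component_subset by blast
  next
    fix D e x y C
    assume D: "D \<subseteq> components V A" and e: "e \<in> A" "x \<in> e" "x \<notin> \<Union> D" "y \<in> e" "y \<in> C" "C \<in> D"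
    then have "e \<subseteq> C" using component_edge_subset[of C V A e] A by auto
    then show "y \<in> {}" using e by auto
  qed
qed auto

text \<open>Expanding the product selects the components that contribute their second term, and
  \<open>T\<close> is the union of these. Weight 0 for an edge crossing \<open>T\<close> lets the
  sum run over all vertex sets.\<close>

lemma rc_expansion:
  assumes V: "finite V" and A: "finite A" "\<forall>e\<in>A. e \<subseteq> V \<and> card e = 2" and p: "p > 0"
  shows "w ^ card A * (\<Prod>C\<in>components V A. 1 + l ^ card C * (1 / p) ^ card (A \<inter> Pow C)) =
    (\<Sum>T\<in>Pow V. l ^ card T * (\<Prod>e\<in>A. if e \<subseteq> T then w / p else if e \<inter> T = {} then w else (0::real)))"
    (is "_ = (\<Sum>T\<in>Pow V. ?g T)")
proof -
  define h where "h T = w ^ card A * (l ^ card T * (1 / p) ^ card (A \<inter> Pow T))" for T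
  have "w ^ card A * (\<Prod>C\<in>components V A. 1 + l ^ card C * (1 / p) ^ card (A \<inter> Pow C)) =
     w ^ card A * (\<Sum>D\<in>Pow (components V A). \<Prod>C\<in>D. l ^ card C * (1 / p) ^ card (A \<inter> Pow C))"
    using prod_add[OF finite_components[OF V, of A], of "\<lambda>C. l ^ card C * (1 / p) ^ card (A \<inter> Pow C)" "\<lambda>_. 1"]
    by (simp add: add.commute)
  also have "\<dots> = (\<Sum>D\<in>Pow (components V A). h (\<Union> D))"
    unfolding sum_distrib_left
  proof (rule sum.cong[OF refl])
    fix D assume "D \<in> Pow (components V A)"
    then have D: "D \<subseteq> components V A" by simp
    have finD: "finite D" using D finite_components[OF V] finite_subset by blast
    have dis: "pairwise disjnt D" using D components_disjoint unfolding pairwise_def disjnt_def by blast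
    have finC: "finite C" if "C \<in> D" for C using that D component_subset V finite_subset by (metis subsetD)
    have 1: "card (\<Union> D) = (\<Sum>C\<in>D. card C)" using dis finC by (intro card_Union_disjoint) auto
    have UN: "A \<inter> Pow (\<Union> D) = (\<Union>C\<in>D. A \<inter> Pow C)"
    proof
      show "A \<inter> Pow (\<Union> D) \<subseteq> (\<Union>C\<in>D. A \<inter> Pow C)"
      proof
        fix e assume e: "e \<in> A \<inter> Pow (\<Union> D)"
        then obtain x where "x \<in> e" using A(2) by fastforce
        then obtain C where "C \<in> D" "x \<in> C" using e by auto
        then have "e \<subseteq> C" using component_edge_subset[of C V A e] A D e \<open>x \<in> e\<close> by auto
        then show "e \<in> (\<Union>C\<in>D. A \<inter> Pow C)" using \<open>C \<in> D\<close> e by auto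
      qed
    qed auto
    have "(A \<inter> Pow C) \<inter> (A \<inter> Pow C') = {}" if "C \<in> D" "C' \<in> D" "C \<noteq> C'" for C C'
    proof -
      have "C \<inter> C' = {}" using components_disjoint[of C V A C'] D that by auto
      then have "e = {}" if "e \<subseteq> C" "e \<subseteq> C'" for e using that by auto
      moreover have "{} \<notin> A" using A(2) by auto
      ultimately show ?thesis by auto
    qed
    then have 2: "card (A \<inter> Pow (\<Union> D)) = (\<Sum>C\<in>D. card (A \<inter> Pow C))"
      unfolding UN using finD A(1) by (intro card_UN_disjoint) (simp, simp, blast)
    show "w ^ card A * (\<Prod>C\<in>D. l ^ card C * (1 / p) ^ card (A \<inter> Pow C)) = h (\<Union> D)"
      unfolding h_def 1 2 power_sum prod.distrib by simp
  qed
  also have "\<dots> = (\<Sum>T\<in>{T\<in>Pow V. \<forall>e\<in>A. e \<subseteq> T \<or> e \<inter> T = {}}. h T)"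
    by (rule sum_over_unions_of_components[OF V A(2), symmetric])
  also have "\<dots> = (\<Sum>T\<in>{T\<in>Pow V. \<forall>e\<in>A. e \<subseteq> T \<or> e \<inter> T = {}}. ?g T)"
  proof (rule sum.cong[OF refl])
    fix T assume T: "T \<in> {T\<in>Pow V. \<forall>e\<in>A. e \<subseteq> T \<or> e \<inter> T = {}}"
    have "(\<Prod>e\<in>A. if e \<subseteq> T then w / p else if e \<inter> T = {} then w else (0::real)) =
        (\<Prod>e\<in>A. w * (if e \<subseteq> T then 1 / p else 1))"
      using T by (intro prod.cong) auto
    also have "\<dots> = w ^ card A * (1 / p) ^ card (A \<inter> Pow T)"
      unfolding prod.distrib using A(1) by (simp add: prod.If_cases Pow_def)
    finally show "h T = ?g T" by (simp add: h_def)
  qed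
  also have "\<dots> = (\<Sum>T\<in>Pow V. ?g T)"
    by (rule sum.mono_neutral_left) (use V A(1) in auto)
  finally show ?thesis .
qed

text \<open>After exchanging the sums, the choice of \<open>A\<close> is independent from edge to
  edge, so a closed edge adds 1 to the weight of an open one.\<close>

lemma sum_rc_expansion:
  assumes V: "finite V" and E: "finite E" "\<forall>e\<in>E. e \<subseteq> V \<and> card e = 2" and p: "p > 0"
  shows "(\<Sum>A\<in>Pow E. w ^ card A * (\<Prod>C\<in>components V A. 1 + l ^ card C * (1 / p) ^ card (A \<inter> Pow C))) =
    Z_two (1 + w) (1 + w / p) l V E"
proof -
  have "(\<Sum>A\<in>Pow E. w ^ card A * (\<Prod>C\<in>components V A. 1 + l ^ card C * (1 / p) ^ card (A \<inter> Pow C))) =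
    (\<Sum>A\<in>Pow E. \<Sum>T\<in>Pow V. l ^ card T * (\<Prod>e\<in>A. if e \<subseteq> T then w / p else if e \<inter> T = {} then w else 0))"
    by (intro sum.cong refl rc_expansion[OF V _ _ p]) (use E in \<open>auto intro: finite_subset\<close>)
  also have "\<dots> = (\<Sum>T\<in>Pow V. l ^ card T * (\<Sum>A\<in>Pow E. \<Prod>e\<in>A. if e \<subseteq> T then w / p else if e \<inter> T = {} then w else 0))"
    by (subst sum.swap) (simp add: sum_distrib_left)
  also have "\<dots> = (\<Sum>T\<in>Pow V. l ^ card T * (\<Prod>e\<in>E. (if e \<subseteq> T then w / p else if e \<inter> T = {} then w else 0) + 1))"
    by (subst prod_add[OF E(1)]) simp
  also have "\<dots> = Z_two (1 + w) (1 + w / p) l V E"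
    unfolding Z_two_def by (intro sum.cong arg_cong2[where f = "(*)"] prod.cong refl) auto
  finally show ?thesis .
qed

text \<open>Every vertex except a chosen root sends an edge to a vertex closer to the root, and
  these edges are distinct because the distance strictly decreases along them.\<close>

lemma component_card_le:
  assumes V: "finite V" and A: "\<forall>e\<in>A. e \<subseteq> V \<and> card e = 2" and C: "C \<in> components V A"
  shows "card C \<le> card (A \<inter> Pow C) + 1"
proof -
  have "A \<subseteq> Pow V" using A by auto
  then have finA: "finite A" using V by (meson finite_Pow_iff finite_subset)
  obtain v where v: "v \<in> C" using component_nonempty[OF C] by auto
  define dist where "dist x = (LEAST k. (v, x) \<in> adj A ^^ k)" for x
  have "\<exists>y. {y, x} \<in> A \<inter> Pow C \<and> dist y < dist x" if x: "x \<in> C - {v}" for x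
  proof -
    have "(v, x) \<in> (adj A)\<^sup>*" using component_connected[OF C v, of x] x by auto
    then obtain k where "(v, x) \<in> adj A ^^ k" using rtrancl_power by blast
    then have d: "(v, x) \<in> adj A ^^ dist x" unfolding dist_def by (rule LeastI)
    moreover have "dist x \<noteq> 0" using d x by (intro notI) auto
    then obtain k where k: "dist x = Suc k" using not0_implies_Suc by blast
    then obtain y where y: "(v, y) \<in> adj A ^^ k" "{y, x} \<in> A" using d by (auto simp: adj_def)
    then have "dist y \<le> k" unfolding dist_def by (intro Least_le)
    moreover have "{y, x} \<subseteq> C" using component_edge_subset[OF C A y(2)] x by auto
    ultimately show ?thesis using y k by auto
  qed
  then have "\<forall>x\<in>C - {v}. \<exists>y. {y, x} \<in> A \<inter> Pow C \<and> dist y < dist x" by blast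
  from bchoice[OF this] obtain par
    where par: "\<And>x. x \<in> C - {v} \<Longrightarrow> {par x, x} \<in> A \<inter> Pow C \<and> dist (par x) < dist x"
    by blast
  have "inj_on (\<lambda>x. {par x, x}) (C - {v})"
  proof (rule inj_onI)
    fix x y assume xy: "x \<in> C - {v}" "y \<in> C - {v}" "{par x, x} = {par y, y}"
    then show "x = y" using par[OF xy(1)] par[OF xy(2)] by (auto simp: doubleton_eq_iff)
  qed
  moreover have "(\<lambda>x. {par x, x}) ` (C - {v}) \<subseteq> A \<inter> Pow C" using par by blast
  ultimately have "card (C - {v}) \<le> card (A \<inter> Pow C)" using finA by (intro card_inj_on_le) auto
  then show ?thesis using v V component_subset[OF C] finite_subset by (auto simp: card_Diff_singleton)
qed

section \<open>Cycles and exceptional components\<close>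

lemma is_cycle_mono: "is_cycle E xs \<Longrightarrow> E \<subseteq> E' \<Longrightarrow> is_cycle E' xs"
  unfolding is_cycle_def by blast

text \<open>Deleting a vertex of degree at most 1 preserves the inequality. If there is none, all
  neighbours of the first vertex of a longest path lie on that path, and a chord to one of them
  closes a cycle.\<close>

lemma exists_cycle:
  assumes "finite V" "V \<noteq> {}" "\<forall>e\<in>E. e \<subseteq> V \<and> card e = 2" "card E \<ge> card V"
  shows "\<exists>xs. is_cycle E xs"
  using assms
proof (induction "card V" arbitrary: V E rule: less_induct)
  case less
  have "E \<subseteq> Pow V" using less.prems by auto
  then have finE: "finite E" using less.prems(1) by (meson finite_Pow_iff finite_subset)
  show ?case
  proof (cases "\<exists>v\<in>V. card {e \<in> E. v \<in> e} \<le> 1")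
    case True
    then obtain v where v: "v \<in> V" "card {e \<in> E. v \<in> e} \<le> 1" by blast
    let ?V = "V - {v}" and ?E = "{e \<in> E. v \<notin> e}"
    have "E = {e \<in> E. v \<in> e} \<union> ?E" by auto
    then have "card E \<le> card {e \<in> E. v \<in> e} + card ?E" by (metis card_Un_le)
    then have "card ?E \<ge> card ?V" using v less.prems by simp
    moreover have "?V \<noteq> {}"
    proof
      assume "?V = {}"
      then have "V = {v}" using v by auto
      moreover have "E \<noteq> {}" using less.prems by auto
      ultimately show False using less.prems(3) by (auto simp: subset_singleton_iff)
    qed
    moreover have "card ?V < card V" using v less.prems(1) by (intro psubset_card_mono) auto
    moreover have "\<forall>e\<in>?E. e \<subseteq> ?V \<and> card e = 2" using less.prems(3) by auto
    ultimately have "\<exists>xs. is_cycle ?E xs" using less.prems(1) by (intro less.hyps[of ?V ?E]) simp_all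
    then obtain xs where xs: "is_cycle ?E xs" by (rule exE)
    have "?E \<subseteq> E" by auto
    with xs have "is_cycle E xs" by (rule is_cycle_mono)
    then show ?thesis by (rule exI)
  next
    case False
    define path where "path xs \<longleftrightarrow> distinct xs \<and> xs \<noteq> [] \<and> set xs \<subseteq> V \<and>
       (\<forall>i. Suc i < length xs \<longrightarrow> {xs ! i, xs ! Suc i} \<in> E)" for xs
    obtain v where "v \<in> V" using less.prems(2) by auto
    then have "path [v]" by (auto simp: path_def)
    have bound: "length xs \<le> card V" if "path xs" for xs
      using that card_mono[OF less.prems(1), of "set xs"] distinct_card[of xs] by (simp add: path_def)
    obtain xs where xs: "path xs" and max: "\<And>ys. path ys \<Longrightarrow> length ys \<le> length xs"
    proof -
      have "\<exists>xs. path xs \<and> (\<forall>ys. path ys \<longrightarrow> length ys \<le> length xs)"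
        using \<open>path [v]\<close> bound by (intro ex_has_greatest_nat[of path "[v]" length "Suc (card V)"]) (auto simp: less_Suc_eq_le)
      then show thesis using that by blast
    qed
    define x where "x = hd xs"
    have xV: "x \<in> V" using xs by (auto simp: path_def x_def)
    have nb: "y \<in> set xs" if y: "{x, y} \<in> E" for y
    proof (rule ccontr)
      assume "y \<notin> set xs"
      moreover have "y \<in> V" using less.prems(3) y by auto
      moreover have "{(y # xs) ! i, (y # xs) ! Suc i} \<in> E" if "Suc i < length (y # xs)" for i
        using xs y that by (cases i) (auto simp: path_def x_def hd_conv_nth insert_commute)
      ultimately have "path (y # xs)" using xs by (auto simp: path_def)
      then show False using max[of "y # xs"] by simp
    qed
    have "card {e \<in> E. x \<in> e} \<ge> 2" using False xV by force
    then obtain e1 e2 where e: "e1 \<in> E" "e2 \<in> E" "x \<in> e1" "x \<in> e2" "e1 \<noteq> e2"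
      by (auto simp: numeral_2_eq_2 card_le_Suc_iff)
    then have "card e1 = 2" "card e2 = 2" using less.prems(3) by auto
    obtain y1 where y1: "e1 = {x, y1}" "x \<noteq> y1" using \<open>card e1 = 2\<close> e(3) by (rule card_2_other_end)
    obtain y2 where y2: "e2 = {x, y2}" "x \<noteq> y2" using \<open>card e2 = 2\<close> e(4) by (rule card_2_other_end)
    have "y1 \<noteq> y2" using e y1 y2 by auto
    have "y1 \<in> set xs" "y2 \<in> set xs" using nb e y1 y2 by auto
    then obtain i1 i2 where i: "i1 < length xs" "xs ! i1 = y1" "i2 < length xs" "xs ! i2 = y2"
      by (auto simp: in_set_conv_nth)
    have x0: "xs ! 0 = x" using xs by (auto simp: x_def path_def hd_conv_nth)
    have "i1 \<noteq> 0" "i2 \<noteq> 0" using i x0 y1(2) y2(2) by (auto intro!: gr0I)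
    moreover have "i1 \<noteq> i2" using i \<open>y1 \<noteq> y2\<close> by auto
    \<comment> \<open>Of two distinct positive positions one is at least 2, so the path cut there
      has at least three vertices.\<close>
    ultimately have "2 \<le> i1 \<or> 2 \<le> i2" by linarith
    moreover have "{x, xs ! i1} \<in> E" "{x, xs ! i2} \<in> E" using i e(1,2) y1(1) y2(1) by simp_all
    ultimately obtain k where k: "k < length xs" "2 \<le> k" "{x, xs ! k} \<in> E" using i(1,3) by blast
    let ?c = "take (Suc k) xs"
    have len: "length ?c = Suc k" using k by simp
    have "{?c ! i, ?c ! ((i + 1) mod length ?c)} \<in> E" if "i < length ?c" for i
    proof (cases "i = k")
      case True
      then show ?thesis using k x0 len by (simp add: insert_commute)
    next
      case F: False
      then have "i < k" using that len by simp
      then show ?thesis using xs k len by (simp add: path_def)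
    qed
    then have "is_cycle E ?c" unfolding is_cycle_def using xs k len by (auto simp: path_def)
    then show ?thesis by blast
  qed
qed

text \<open>A repetition-free path inside \<open>C\<close> has at most \<open>card C\<close>
  vertices, hence fewer than \<open>card C\<close> steps.\<close>

lemma component_in_nbhd:
  assumes V: "finite V" and A: "\<forall>e\<in>A. e \<subseteq> V \<and> card e = 2" and AE: "A \<subseteq> E" and C: "C \<in> components V A" and v: "v \<in> C" and L: "card C \<le> L"
  shows "C \<subseteq> nbhd V E L v"
proof
  fix y assume y: "y \<in> C"
  then have "(v, y) \<in> (adj A)\<^sup>*" using component_connected[OF C v] by auto
  from rtrancl_imp_distinct_path[OF this]
  obtain xs where xs: "distinct xs" "xs \<noteq> []" "hd xs = v" "last xs = y"
    and adj: "\<And>i. Suc i < length xs \<Longrightarrow> (xs ! i, xs ! Suc i) \<in> adj A"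
    by blast
  have step: "i < length xs \<Longrightarrow> (v, xs ! i) \<in> adj A ^^ i" for i
  proof (induction i)
    case 0
    then show ?case using xs by (simp add: hd_conv_nth)
  next
    case (Suc i)
    then show ?case using adj[of i] by (auto intro: relcompI)
  qed
  have "xs ! i \<in> C" if "i < length xs" for i
  proof -
    have "(v, xs ! i) \<in> (adj A)\<^sup>*" using step[OF that] by (rule relpow_imp_rtrancl)
    moreover have "xs ! i \<in> V"
    proof (cases "i = length xs - 1")
      case True
      then have "xs ! i = y" using xs(2,4) by (simp add: last_conv_nth)
      then show ?thesis using y component_subset[OF C] by auto
    next
      case False
      then have "(xs ! i, xs ! Suc i) \<in> adj A" using adj[of i] that by auto
      then show ?thesis using A by (auto simp: adj_def)
    qed
    ultimately show ?thesis using component_connected[OF C v] by auto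
  qed
  then have "set xs \<subseteq> C" by (auto simp: in_set_conv_nth)
  then have "length xs \<le> card C"
    using card_mono[OF finite_subset[OF component_subset[OF C] V], of "set xs"] distinct_card[OF xs(1)] by simp
  then have "length xs - 1 \<le> L" using L by simp
  moreover have "(v, y) \<in> adj A ^^ (length xs - 1)"
    using step[of "length xs - 1"] xs(2,4) by (simp add: last_conv_nth)
  moreover have "adj A ^^ (length xs - 1) \<subseteq> adj E ^^ (length xs - 1)"
    using AE by (intro relpow_subset) (auto simp: adj_def)
  ultimately show "y \<in> nbhd V E L v" using y component_subset[OF C] unfolding nbhd_def by blast
qed

text \<open>The components counted contain a cycle. Disjointness leaves at most
  \<open>card V / L\<close> of those with \<open>L\<close> or more vertices. A smaller one lies in
  the \<open>L\<close>-ball of each of its vertices, and these balls are not trees; choosing one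
  vertex from each small component bounds their number.\<close>

lemma card_bad_components:
  assumes E: "finite V" "\<forall>e\<in>E. e \<subseteq> V \<and> card e = 2" and V: "V \<noteq> {}" and L: "L \<ge> 1" and A: "A \<subseteq> E"
  shows "real (card {C \<in> components V A. card C \<le> card (A \<inter> Pow C)}) \<le>
    card V * (1 / L + (1 - tree_proportion V E L))"
proof -
  define Tr where "Tr = {v \<in> V. is_tree (nbhd V E L v) (induced_edges E (nbhd V E L v))}"
  define big where "big = {C \<in> components V A. L \<le> card C}"
  define small where "small = {C \<in> components V A. card C \<le> card (A \<inter> Pow C) \<and> card C \<le> L}"
  have A2: "\<forall>e\<in>A. e \<subseteq> V \<and> card e = 2" using A E by auto
  have fin: "finite (components V A)" using finite_components[OF E(1)] .
  have "real (card big) * L \<le> card V"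
  proof -
    have dis: "pairwise disjnt (components V A)"
      using components_disjoint[of _ V A] unfolding pairwise_def disjnt_def by blast
    have finC: "finite C" if "C \<in> components V A" for C
      using component_subset[OF that] E(1) finite_subset by blast
    have "card V = (\<Sum>C\<in>components V A. card C)"
      using card_Union_disjoint[OF dis finC] Union_components[of V A] by simp
    also have "\<dots> \<ge> (\<Sum>C\<in>big. card C)" using fin by (intro sum_mono2) (auto simp: big_def)
    finally have "(\<Sum>C\<in>big. card C) \<le> card V" .
    moreover have "(\<Sum>C\<in>big. L) \<le> (\<Sum>C\<in>big. card C)" by (intro sum_mono) (auto simp: big_def)
    ultimately have "card big * L \<le> card V" by simp
    then have "real (card big * L) \<le> real (card V)" by (simp only: of_nat_le_iff)
    then show ?thesis by simp
  qed
  then have 1: "real (card big) \<le> card V * (1 / L)" using L by (simp add: field_simps)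
  define r where "r C = (SOME v. v \<in> C)" for C :: "'a set"
  have r: "r C \<in> C" if "C \<in> components V A" for C
    unfolding r_def some_in_eq by (rule component_nonempty[OF that])
  have "inj_on r small"
  proof (rule inj_onI)
    fix C D assume CD: "C \<in> small" "D \<in> small" "r C = r D"
    then have comp: "C \<in> components V A" "D \<in> components V A" by (simp_all add: small_def)
    then have "r C \<in> C \<inter> D" using r[OF comp(1)] r[OF comp(2)] CD(3) by simp
    then show "C = D" using components_disjoint[OF comp] by blast
  qed
  moreover have "r ` small \<subseteq> V - Tr"
  proof
    fix v assume "v \<in> r ` small"
    then obtain C where C: "C \<in> components V A" "card C \<le> card (A \<inter> Pow C)" "card C \<le> L" "v = r C"
      by (auto simp: small_def)
    have sub: "C \<subseteq> nbhd V E L v" using component_in_nbhd[OF E(1) A2 A C(1) _ C(3)] r[OF C(1)] C(4) by simp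
    have "\<exists>xs. is_cycle (A \<inter> Pow C) xs"
    proof (rule exists_cycle)
      show "finite C" using component_subset[OF C(1)] E(1) finite_subset by blast
    qed (use C(2) component_nonempty[OF C(1)] A2 in auto)
    then obtain xs where "is_cycle (A \<inter> Pow C) xs" by blast
    moreover have "A \<inter> Pow C \<subseteq> induced_edges E (nbhd V E L v)" using A sub by (auto simp: induced_edges_def)
    ultimately have "is_cycle (induced_edges E (nbhd V E L v)) xs" by (rule is_cycle_mono)
    then have "v \<notin> Tr" unfolding Tr_def is_tree_def by blast
    then show "v \<in> V - Tr" using r[OF C(1)] C(4) component_subset[OF C(1)] by auto
  qed
  ultimately have "card small \<le> card (V - Tr)" using E(1) by (intro card_inj_on_le[of r]) simp_all
  moreover have "Tr \<subseteq> V" by (auto simp: Tr_def)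
  then have "card (V - Tr) = card V - card Tr" "card Tr \<le> card V"
    using E(1) finite_subset[OF \<open>Tr \<subseteq> V\<close> E(1)] by (simp_all add: card_Diff_subset card_mono)
  ultimately have "real (card small) \<le> real (card V) - card Tr" by linarith
  also have "\<dots> = card V * (1 - tree_proportion V E L)"
    using V E(1) by (simp add: tree_proportion_def Tr_def field_simps)
  finally have 2: "real (card small) \<le> card V * (1 - tree_proportion V E L)" .
  have "{C \<in> components V A. card C \<le> card (A \<inter> Pow C)} \<subseteq> big \<union> small" by (auto simp: big_def small_def)
  then have "card {C \<in> components V A. card C \<le> card (A \<inter> Pow C)} \<le> card (big \<union> small)"
    using fin by (intro card_mono) (auto simp: big_def small_def)
  also have "\<dots> \<le> card big + card small" by (rule card_Un_le)
  finally show ?thesis using 1 2 by (simp add: algebra_simps)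
qed

section \<open>The sandwich between \<open>Z_two\<close> and \<open>Z_rc\<close>\<close>

lemma Z_two_pos: "finite V \<Longrightarrow> a > 0 \<Longrightarrow> c > 0 \<Longrightarrow> l > 0 \<Longrightarrow> Z_two a c l V E > 0"
  unfolding Z_two_def by (intro sum_pos mult_pos_pos prod_pos) auto

text \<open>In \<open>Z_two\<close> a component is weighted by \<open>(q - 1) ^ card C\<close> over
  \<open>(q - 1)\<close> to the number of its edges. Since \<open>q - 1 > 1\<close> this never
  exceeds the true weight and agrees with it on trees. On the exceptional components the trivial
  bounds 1 and \<open>q\<close> on the two factors cost a factor \<open>q\<close> each.\<close>

lemma Z_rc_bounds:
  assumes E: "finite V" "\<forall>e\<in>E. e \<subseteq> V \<and> card e = 2" and V: "V \<noteq> {}" and L: "L \<ge> 1"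
    and q: "q > 2" and w: "w \<ge> 0" and B: "B \<ge> 0"
  defines "Z \<equiv> Z_two (1 + w) (1 + w / (q - 1)) ((q - 1) * exp (- B)) V E"
  shows "Z \<le> Z_rc V E q w B"
    and "Z_rc V E q w B \<le> q powr (card V * (1 / L + (1 - tree_proportion V E L))) * Z"
proof -
  define l where "l = (q - 1) * exp (- B)"
  define Q where "Q = q powr (card V * (1 / L + (1 - tree_proportion V E L)))"
  have "E \<subseteq> Pow V" using E by auto
  then have finE: "finite E" using E by (meson finite_Pow_iff finite_subset)
  define x where "x C = (q - 1) * exp (- B * real (card C))" for C :: "'a set"
  have Z: "Z = (\<Sum>A\<in>Pow E. w ^ card A * (\<Prod>C\<in>components V A. 1 + l ^ card C * (1 / (q - 1)) ^ card (A \<inter> Pow C)))"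
    unfolding Z_def l_def using q by (intro sum_rc_expansion[OF E(1) finE E(2), symmetric]) simp
  have l: "l ^ card C = (q - 1) ^ card C * exp (- B * real (card C))" for C :: "'a set"
    unfolding l_def power_mult_distrib by (simp add: exp_of_nat_mult[symmetric] mult.commute)
  have le: "l ^ card C * (1 / (q - 1)) ^ card (A \<inter> Pow C) \<le> x C"
    if "A \<subseteq> E" "C \<in> components V A" for A C
  proof -
    have "card C \<le> card (A \<inter> Pow C) + 1" using that E by (intro component_card_le[OF E(1)]) auto
    then have "(q - 1) ^ card C \<le> (q - 1) ^ (card (A \<inter> Pow C) + 1)" using q by (intro power_increasing) auto
    then have "(q - 1) ^ card C * (1 / (q - 1)) ^ card (A \<inter> Pow C) \<le> q - 1"
      using q by (simp add: power_divide divide_le_eq mult.commute)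
    from mult_right_mono[OF this, of "exp (- B * real (card C))"]
    show ?thesis unfolding l x_def by (simp add: algebra_simps)
  qed
  have eq: "x C \<le> l ^ card C * (1 / (q - 1)) ^ card (A \<inter> Pow C)" if "card (A \<inter> Pow C) < card C" for A C
  proof -
    have "(q - 1) ^ (card (A \<inter> Pow C) + 1) \<le> (q - 1) ^ card C" using q that by (intro power_increasing) auto
    then have "q - 1 \<le> (q - 1) ^ card C * (1 / (q - 1)) ^ card (A \<inter> Pow C)"
      using q by (simp add: power_divide le_divide_eq mult.commute)
    from mult_right_mono[OF this, of "exp (- B * real (card C))"]
    show ?thesis unfolding l x_def by (simp add: algebra_simps)
  qed
  have pos: "l ^ card C * (1 / (q - 1)) ^ k \<ge> 0" for C :: "'a set" and k using q by (simp add: l_def)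
  have rc: "Z_rc V E q w B = (\<Sum>A\<in>Pow E. w ^ card A * (\<Prod>C\<in>components V A. 1 + x C))"
    by (simp add: Z_rc_def x_def)
  show "Z \<le> Z_rc V E q w B"
    unfolding Z rc using le pos w by (intro sum_mono mult_left_mono prod_mono) (auto simp: add_nonneg_nonneg)
  show "Z_rc V E q w B \<le> q powr (card V * (1 / L + (1 - tree_proportion V E L))) * Z"
    unfolding Z rc Q_def[symmetric] sum_distrib_left
  proof (rule sum_mono)
    fix A assume "A \<in> Pow E"
    then have A: "A \<subseteq> E" by simp
    define bad where "bad = {C \<in> components V A. card C \<le> card (A \<inter> Pow C)}"
    have fin: "finite (components V A)" using finite_components[OF E(1)] .
    have "(\<Prod>C\<in>components V A. 1 + x C) \<le>
        (\<Prod>C\<in>components V A. (if C \<in> bad then q else 1) * (1 + l ^ card C * (1 / (q - 1)) ^ card (A \<inter> Pow C)))"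
    proof (rule prod_mono)
      fix C assume C: "C \<in> components V A"
      have x0: "0 \<le> x C" "x C \<le> q - 1"
        using q B by (auto simp: x_def mult_le_cancel_left1)
      show "0 \<le> 1 + x C \<and> 1 + x C \<le> (if C \<in> bad then q else 1) * (1 + l ^ card C * (1 / (q - 1)) ^ card (A \<inter> Pow C))"
      proof (cases "C \<in> bad")
        case True
        have "q * 1 \<le> q * (1 + l ^ card C * (1 / (q - 1)) ^ card (A \<inter> Pow C))"
          using pos[of C "card (A \<inter> Pow C)"] q by (intro mult_left_mono) auto
        then have "1 + x C \<le> q * (1 + l ^ card C * (1 / (q - 1)) ^ card (A \<inter> Pow C))" using x0 by linarith
        then show ?thesis using True x0 by simp
      next
        case False
        then have "card (A \<inter> Pow C) < card C" using C by (auto simp: bad_def)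
        then show ?thesis using False x0 eq by simp
      qed
    qed
    also have "\<dots> = q ^ card bad * (\<Prod>C\<in>components V A. 1 + l ^ card C * (1 / (q - 1)) ^ card (A \<inter> Pow C))"
    proof -
      have "components V A \<inter> {C. C \<in> bad} = bad" by (auto simp: bad_def)
      then show ?thesis unfolding prod.distrib using fin by (simp add: prod.If_cases)
    qed
    also have "\<dots> \<le> Q * (\<Prod>C\<in>components V A. 1 + l ^ card C * (1 / (q - 1)) ^ card (A \<inter> Pow C))"
    proof (rule mult_right_mono)
      have "q ^ card bad = q powr card bad" using q by (simp add: powr_realpow)
      also have "\<dots> \<le> Q" unfolding Q_def bad_def
        using q card_bad_components[OF E V L A] by (intro powr_mono) auto
      finally show "q ^ card bad \<le> Q" .
    qed (use pos in \<open>auto intro!: prod_nonneg simp: add_nonneg_nonneg\<close>)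
    finally have "(\<Prod>C\<in>components V A. 1 + x C) \<le>
        Q * (\<Prod>C\<in>components V A. 1 + l ^ card C * (1 / (q - 1)) ^ card (A \<inter> Pow C))" .
    from mult_left_mono[OF this, of "w ^ card A"] w
    show "w ^ card A * (\<Prod>C\<in>components V A. 1 + x C) \<le>
        Q * (w ^ card A * (\<Prod>C\<in>components V A. 1 + l ^ card C * (1 / (q - 1)) ^ card (A \<inter> Pow C)))"
      by (simp add: mult.left_commute)
  qed
qed


section \<open>Fixed points of the message recursion\<close>

text \<open>The logarithmic field \<open>ln \<mu>\<close> at which \<open>R\<close> solves the message equation
  \<open>R = \<mu> * msg \<kappa> R ^ (d - 1)\<close>.\<close>

definition field_at :: "nat \<Rightarrow> real \<Rightarrow> real \<Rightarrow> real" where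
  "field_at d \<kappa> R = ln R - real (d - 1) * (ln (R + \<kappa>) - ln (\<kappa> * R + 1))"

lemma field_at_1: "\<kappa> \<ge> 0 \<Longrightarrow> field_at d \<kappa> 1 = 0"
  by (simp add: field_at_def add.commute)

lemma field_at_inverse:
  assumes "R > 0" "\<kappa> > 0" shows "field_at d \<kappa> (1 / R) = - field_at d \<kappa> R"
proof -
  have "1 / R + \<kappa> = (\<kappa> * R + 1) / R" "\<kappa> * (1 / R) + 1 = (R + \<kappa>) / R" using assms by (simp_all add: field_simps)
  moreover have "\<kappa> * R + 1 > 0" "R + \<kappa> > 0" using assms by (simp_all add: add_pos_pos)
  ultimately have L: "ln (1 / R + \<kappa>) = ln (\<kappa> * R + 1) - ln R" "ln (\<kappa> * (1 / R) + 1) = ln (R + \<kappa>) - ln R"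
    using assms by (simp_all add: ln_div)
  show ?thesis unfolding field_at_def L using assms by (simp add: ln_div algebra_simps)
qed

lemma field_at_eq_iff:
  assumes "R > 0" "0 < \<kappa>" "\<mu> > 0"
  shows "field_at d \<kappa> R = ln \<mu> \<longleftrightarrow> \<mu> * (R + \<kappa>) ^ (d - 1) = R * (\<kappa> * R + 1) ^ (d - 1)"
proof -
  have p: "R + \<kappa> > 0" "\<kappa> * R + 1 > 0" using assms by (simp_all add: add_pos_pos)
  have "\<mu> * (R + \<kappa>) ^ (d - 1) = R * (\<kappa> * R + 1) ^ (d - 1) \<longleftrightarrow>
      ln (\<mu> * (R + \<kappa>) ^ (d - 1)) = ln (R * (\<kappa> * R + 1) ^ (d - 1))"
    using assms p by (subst ln_inj_iff) simp_all
  also have "\<dots> \<longleftrightarrow> ln \<mu> + real (d - 1) * ln (R + \<kappa>) = ln R + real (d - 1) * ln (\<kappa> * R + 1)"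
    using assms p by (simp add: ln_mult ln_realpow)
  also have "\<dots> \<longleftrightarrow> field_at d \<kappa> R = ln \<mu>" unfolding field_at_def by (auto simp: algebra_simps)
  finally show ?thesis by simp
qed

text \<open>The sign of the derivative of \<open>field_at\<close>; it is strictly increasing on \<open>[1, \<infinity>)\<close> and its value
  at \<open>1\<close> vanishes exactly at the critical coupling \<open>\<kappa> = (d - 2) / d\<close>.\<close>

definition slope_num :: "nat \<Rightarrow> real \<Rightarrow> real \<Rightarrow> real" where
  "slope_num d \<kappa> R = \<kappa> * (R - 1)\<^sup>2 / R + (1 + \<kappa>) * ((1 + \<kappa>) - real (d - 1) * (1 - \<kappa>))"

lemma field_at_deriv:
  assumes "R > 0" "0 < \<kappa>"
  shows "(field_at d \<kappa> has_real_derivative slope_num d \<kappa> R / ((R + \<kappa>) * (\<kappa> * R + 1))) (at R)"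
proof -
  have p: "R + \<kappa> > 0" "\<kappa> * R + 1 > 0" using assms by (simp_all add: add_pos_pos)
  have "(field_at d \<kappa> has_real_derivative 1 / R - real (d - 1) * (1 / (R + \<kappa>) - \<kappa> / (\<kappa> * R + 1))) (at R)"
    unfolding field_at_def[abs_def] using assms p by (auto intro!: derivative_eq_intros)
  moreover have "1 / R - real (d - 1) * (1 / (R + \<kappa>) - \<kappa> / (\<kappa> * R + 1)) =
      slope_num d \<kappa> R / ((R + \<kappa>) * (\<kappa> * R + 1))"
    using assms p by (simp add: slope_num_def divide_simps) (simp add: algebra_simps power2_eq_square)
  ultimately show ?thesis by simp
qed

lemma field_at_continuous_on: "0 < \<kappa> \<Longrightarrow> (\<And>x. x \<in> S \<Longrightarrow> x > 0) \<Longrightarrow> continuous_on S (field_at d \<kappa>)"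
  using field_at_deriv DERIV_isCont continuous_at_imp_continuous_on by metis

text \<open>The first term is \<open>\<kappa> * (R + 1 / R - 2)\<close>, and the second does not
  depend on \<open>R\<close>.\<close>

lemma slope_num_mono:
  assumes "0 < \<kappa>" "1 \<le> R" "R < R'" shows "slope_num d \<kappa> R < slope_num d \<kappa> R'"
proof -
  have "(R - 1)\<^sup>2 / R < (R' - 1)\<^sup>2 / R'"
  proof -
    have "(R - 1)\<^sup>2 * R' < (R' - 1)\<^sup>2 * R"
    proof -
      have "R * R' - 1 > 0" using assms mult_right_mono[of 1 R R'] by linarith
      then have "(R' - R) * (R * R' - 1) > 0" using assms by simp
      then show ?thesis by (simp add: algebra_simps power2_eq_square)
    qed
    then show ?thesis using assms by (simp add: field_simps)
  qed
  from mult_strict_left_mono[OF this assms(1)] show ?thesis unfolding slope_num_def by simp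
qed

text \<open>The slope is strictly increasing on \<open>[1, \<infinity>)\<close>. Were it nonpositive
  at \<open>R\<close>, then \<open>field_at\<close> would decrease all the way from its value 0 at 1
  and be negative at \<open>R\<close>.\<close>

lemma slope_num_pos:
  assumes \<kappa>: "0 < \<kappa>" and R: "1 < R" and nonneg: "field_at d \<kappa> R \<ge> 0"
  shows "slope_num d \<kappa> R > 0"
proof (rule ccontr)
  assume "\<not> slope_num d \<kappa> R > 0"
  then have neg: "slope_num d \<kappa> x < 0" if "1 < x" "x < R" for x
    using slope_num_mono[of \<kappa> x R d] that \<kappa> by linarith
  have "field_at d \<kappa> R < field_at d \<kappa> 1"
  proof (rule DERIV_neg_imp_decreasing_open[OF R])
    fix x assume x: "1 < x" "x < R"
    have "slope_num d \<kappa> x / ((x + \<kappa>) * (\<kappa> * x + 1)) < 0"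
      using neg[OF x] x \<kappa> by (intro divide_neg_pos mult_pos_pos add_pos_pos) simp_all
    then show "\<exists>y. (field_at d \<kappa> has_real_derivative y) (at x) \<and> y < 0"
      using field_at_deriv[of x \<kappa> d] x \<kappa> by force
  next
    show "continuous_on {1..R} (field_at d \<kappa>)" using \<kappa> by (intro field_at_continuous_on) auto
  qed
  then show False using field_at_1[of \<kappa> d] nonneg \<kappa> by simp
qed

lemma field_at_increasing:
  assumes \<kappa>: "0 < \<kappa>" and R: "1 \<le> R" "R < R'" and nonneg: "slope_num d \<kappa> R \<ge> 0"
  shows "field_at d \<kappa> R < field_at d \<kappa> R'"
proof (rule DERIV_pos_imp_increasing_open[OF R(2)])
  fix x assume x: "R < x" "x < R'"
  have "slope_num d \<kappa> x > 0" using slope_num_mono[of \<kappa> R x d] \<kappa> R x nonneg by linarith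
  then have "slope_num d \<kappa> x / ((x + \<kappa>) * (\<kappa> * x + 1)) > 0"
    using x \<kappa> R by (intro divide_pos_pos mult_pos_pos add_pos_pos) simp_all
  then show "\<exists>y. (field_at d \<kappa> has_real_derivative y) (at x) \<and> 0 < y"
    using field_at_deriv[of x \<kappa> d] x \<kappa> R by force
next
  show "continuous_on {R..R'} (field_at d \<kappa>)" using \<kappa> R by (intro field_at_continuous_on) auto
qed

lemma field_at_increasing':
  assumes "0 < \<kappa>" "1 < R" "R < R'" "field_at d \<kappa> R \<ge> 0"
  shows "field_at d \<kappa> R < field_at d \<kappa> R'"
  using field_at_increasing[of \<kappa> R R' d] slope_num_pos[of \<kappa> R d] assms by simp

text \<open>Asking for the last solution singles out the nontrivial one at zero field, where
  \<open>R = 1\<close> is always a solution.\<close>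

definition is_top_root :: "nat \<Rightarrow> real \<Rightarrow> real \<Rightarrow> real \<Rightarrow> bool" where
  "is_top_root d \<kappa> s R \<longleftrightarrow> R \<ge> 1 \<and> field_at d \<kappa> R = s \<and> (\<forall>R'>R. s < field_at d \<kappa> R')"

lemma is_top_root_below:
  assumes "0 < \<kappa>" "s \<ge> 0" "is_top_root d \<kappa> s R" "1 < R'" "R' < R"
  shows "field_at d \<kappa> R' < s"
  using field_at_increasing'[of \<kappa> R' R d] assms unfolding is_top_root_def by force

lemma is_top_root_unique: "is_top_root d \<kappa> s R \<Longrightarrow> is_top_root d \<kappa> s R' \<Longrightarrow> R = R'"
  unfolding is_top_root_def by (metis linorder_neqE_linordered_idom order_less_irrefl)

lemma is_top_rootI:
  assumes "0 < \<kappa>" "R > 1" "field_at d \<kappa> R = s" "s \<ge> 0"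
  shows "is_top_root d \<kappa> s R"
  using field_at_increasing'[of \<kappa> R _ d] assms unfolding is_top_root_def by auto

lemma field_at_ge_ln:
  assumes "0 < \<kappa>" "\<kappa> \<le> 1" "R \<ge> 1"
  shows "field_at d \<kappa> R \<ge> ln R + real (d - 1) * ln \<kappa>"
proof -
  have "\<kappa> * (R + \<kappa>) \<le> \<kappa> * R + 1" using assms by (simp add: algebra_simps mult_le_one)
  moreover have "R + \<kappa> > 0" using assms by simp
  ultimately have "ln (\<kappa> * (R + \<kappa>)) \<le> ln (\<kappa> * R + 1)" using assms by (subst ln_le_cancel_iff) (auto simp: add_pos_pos)
  then have "ln \<kappa> \<le> ln (\<kappa> * R + 1) - ln (R + \<kappa>)" using assms \<open>R + \<kappa> > 0\<close> by (simp add: ln_mult)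
  then have "real (d - 1) * ln \<kappa> \<le> real (d - 1) * (ln (\<kappa> * R + 1) - ln (R + \<kappa>))" by (intro mult_left_mono) auto
  then show ?thesis unfolding field_at_def by (simp add: algebra_simps)
qed

lemma is_top_root_exists:
  assumes \<kappa>: "0 < \<kappa>" "\<kappa> \<le> 1" and s: "s \<ge> 0"
  shows "\<exists>R. is_top_root d \<kappa> s R"
proof -
  \<comment> \<open>Beyond \<open>M\<close> the lower bound of \<open>field_at_ge_ln\<close> exceeds
    \<open>s\<close>, so the set of points with \<open>field_at\<close> at most \<open>s\<close> is
    compact and its maximum is the root.\<close>
  define M where "M = exp (s + 1 - real (d - 1) * ln \<kappa>)"
  have "real (d - 1) * ln \<kappa> \<le> 0" using \<kappa> by (intro mult_nonneg_nonpos) simp_all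
  then have "s + 1 - real (d - 1) * ln \<kappa> \<ge> 0" using s by linarith
  then have M1: "M \<ge> 1" by (simp add: M_def)
  have large: "field_at d \<kappa> R > s" if "R > M" for R
  proof -
    have "ln R > s + 1 - real (d - 1) * ln \<kappa>" using that M1 by (metis M_def exp_gt_zero ln_exp ln_less_cancel_iff order_less_trans)
    then show ?thesis using field_at_ge_ln[of \<kappa> R d] \<kappa> that M1 by simp
  qed
  define S where "S = {R\<in>{1..M}. field_at d \<kappa> R \<le> s}"
  have "closed S"
    unfolding S_def using \<kappa> by (intro continuous_closed_preimage_constant continuous_on_closed_Collect_le field_at_continuous_on) auto
  moreover have "bounded S" by (rule bounded_subset[of "{1..M}"]) (auto simp: S_def)
  ultimately have "compact S" by (simp add: compact_eq_bounded_closed)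
  moreover have "1 \<in> S" using M1 s field_at_1[of \<kappa> d] \<kappa> by (simp add: S_def)
  ultimately obtain R where R: "R \<in> S" and max: "\<And>x. x \<in> S \<Longrightarrow> x \<le> R"
    using compact_attains_sup[of S] by blast
  have R1: "1 \<le> R" "field_at d \<kappa> R \<le> s" using R by (auto simp: S_def)
  have above: "field_at d \<kappa> x > s" if "x > R" for x
  proof (cases "x > M")
    case False
    then have "x \<notin> S" using max that by force
    then show ?thesis using False that R1 by (auto simp: S_def)
  qed (rule large)
  have "field_at d \<kappa> R \<ge> s"
  proof (rule ccontr)
    assume "\<not> field_at d \<kappa> R \<ge> s"
    then have "field_at d \<kappa> R \<le> s" "s \<le> field_at d \<kappa> (R + 1)" using above[of "R + 1"] by auto
    moreover have "continuous_on {R..R + 1} (field_at d \<kappa>)" using \<kappa> R1 by (intro field_at_continuous_on) auto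
    ultimately obtain x where x: "R \<le> x" "x \<le> R + 1" "field_at d \<kappa> x = s"
      using IVT'[of "field_at d \<kappa>" R s "R + 1"] by auto
    then show False using above[of x] \<open>\<not> field_at d \<kappa> R \<ge> s\<close> by (cases "x = R") auto
  qed
  then show ?thesis using R1 above by (auto simp: is_top_root_def)
qed

section \<open>The top root as a function of coupling and field\<close>

definition top_root :: "nat \<Rightarrow> real \<Rightarrow> real \<Rightarrow> real" where
  "top_root d \<kappa> s = (SOME R. is_top_root d \<kappa> s R)"

lemma top_root: "0 < \<kappa> \<Longrightarrow> \<kappa> \<le> 1 \<Longrightarrow> s \<ge> 0 \<Longrightarrow> is_top_root d \<kappa> s (top_root d \<kappa> s)"
  unfolding top_root_def using is_top_root_exists by (rule someI_ex)

lemma top_root_eq: "0 < \<kappa> \<Longrightarrow> \<kappa> \<le> 1 \<Longrightarrow> s \<ge> 0 \<Longrightarrow> is_top_root d \<kappa> s R \<Longrightarrow> top_root d \<kappa> s = R"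
  using top_root is_top_root_unique by blast

text \<open>The root is located by strict inequalities at fixed test points: \<open>field_at\<close>
  is below \<open>s\<close> strictly between 1 and the root and above \<open>s\<close> beyond it.
  Strict inequalities survive small changes of coupling and field.\<close>

lemma top_root_tendsto:
  assumes k: "(k \<longlongrightarrow> \<kappa>) F" and \<sigma>: "(\<sigma> \<longlongrightarrow> s) F" and \<kappa>: "0 < \<kappa>" "\<kappa> \<le> 1" and s: "s \<ge> 0"
    and ev: "\<forall>\<^sub>F x in F. 0 < k x \<and> k x \<le> 1 \<and> \<sigma> x \<ge> 0"
  shows "((\<lambda>x. top_root d (k x) (\<sigma> x)) \<longlongrightarrow> top_root d \<kappa> s) F"
proof (rule order_tendstoI)
  let ?R = "top_root d \<kappa> s"
  have lim: "((\<lambda>x. field_at d (k x) R) \<longlongrightarrow> field_at d \<kappa> R) F" if "R > 0" for R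
  proof -
    have "\<kappa> * R + 1 > 0" "R + \<kappa> > 0" using that \<kappa> by (simp_all add: add_pos_pos)
    then show ?thesis unfolding field_at_def using that by (intro tendsto_intros k) simp_all
  qed
  {
    fix a assume a: "a < ?R"
    show "\<forall>\<^sub>F x in F. a < top_root d (k x) (\<sigma> x)"
    proof (cases "a < 1")
      case True
      show ?thesis using ev
      proof eventually_elim
        case (elim x)
        then show ?case using top_root[of "k x" "\<sigma> x" d] True by (simp add: is_top_root_def)
      qed
    next
      case False
      \<comment> \<open>\<open>a\<close> may be 1, where strictness fails at zero field; a point
        strictly between \<open>a\<close> and the root is safe.\<close>
      define m where "m = (a + ?R) / 2"
      have m: "1 < m" "a < m" "m < ?R" using a False by (auto simp: m_def)
      have "field_at d \<kappa> m < s" using is_top_root_below[OF \<kappa>(1) s top_root[OF \<kappa> s]] m by blast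
      moreover have "((\<lambda>x. \<sigma> x - field_at d (k x) m) \<longlongrightarrow> s - field_at d \<kappa> m) F"
        using m by (intro tendsto_diff \<sigma> lim) simp
      ultimately have "\<forall>\<^sub>F x in F. \<sigma> x - field_at d (k x) m > 0" by (intro order_tendstoD(1)) (assumption, linarith)
      with ev show ?thesis
      proof eventually_elim
        case (elim x)
        then have t: "is_top_root d (k x) (\<sigma> x) (top_root d (k x) (\<sigma> x))" by (intro top_root) auto
        have "m \<noteq> top_root d (k x) (\<sigma> x)" using t elim unfolding is_top_root_def by auto
        moreover have "\<not> top_root d (k x) (\<sigma> x) < m" using t elim unfolding is_top_root_def by auto
        ultimately show ?case using m by linarith
      qed
    qed
  next
    fix b assume b: "?R < b"
    have b1: "b > 1" using b top_root[OF \<kappa> s, of d] by (simp add: is_top_root_def)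
    have "s < field_at d \<kappa> b" using b top_root[OF \<kappa> s, of d] by (simp add: is_top_root_def)
    moreover have "((\<lambda>x. field_at d (k x) b - \<sigma> x) \<longlongrightarrow> field_at d \<kappa> b - s) F"
      using b1 by (intro tendsto_diff \<sigma> lim) simp
    ultimately have "\<forall>\<^sub>F x in F. field_at d (k x) b - \<sigma> x > 0" by (intro order_tendstoD(1)) (assumption, linarith)
    with ev show "\<forall>\<^sub>F x in F. top_root d (k x) (\<sigma> x) < b"
    proof eventually_elim
      case (elim x)
      then have t: "is_top_root d (k x) (\<sigma> x) (top_root d (k x) (\<sigma> x))" by (intro top_root) auto
      have "b \<noteq> top_root d (k x) (\<sigma> x)" using t elim unfolding is_top_root_def by auto
      moreover have "\<not> b < top_root d (k x) (\<sigma> x)" using is_top_root_below[OF _ _ t b1] elim by auto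
      ultimately show ?case by linarith
    qed
  }
qed

text \<open>The iterates increase from 1 and are bounded because \<open>msg \<kappa>\<close> is at
  most \<open>1 / \<kappa>\<close>, so they converge to a solution. Positive field rules out the
  limit 1, and any solution above 1 is the top root. At \<open>s = 0\<close> the iterates would all
  be 1.\<close>

lemma tree_ratio_tendsto:
  assumes \<kappa>: "0 < \<kappa>" "\<kappa> \<le> 1" and s: "s > 0"
  shows "tree_ratio d \<kappa> (exp s) \<longlonglongrightarrow> top_root d \<kappa> s"
proof -
  let ?r = "tree_ratio d \<kappa> (exp s)"
  have \<mu>: "exp s \<ge> 1" "exp s > 0" using s by simp_all
  have ge1: "?r j \<ge> 1" for j using tree_ratio_ge_1[OF \<kappa> \<mu>(1)] .
  have msg_mono: "msg \<kappa> x \<le> msg \<kappa> y" if "1 \<le> x" "x \<le> y" for x y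
  proof -
    have "\<kappa> * x + 1 > 0" "\<kappa> * y + 1 > 0" using \<kappa> that by (simp_all add: add_pos_pos)
    moreover have "(1 - \<kappa>) * (1 + \<kappa>) * (y - x) \<ge> 0" using \<kappa> that by simp
    ultimately show ?thesis unfolding msg_def by (simp add: frac_le_eq divide_le_0_iff) (simp add: algebra_simps)
  qed
  have inc: "?r j \<le> ?r (Suc j)" for j
  proof (induction j)
    case 0
    then show ?case using ge1[of "Suc 0"] by simp
  next
    case (Suc j)
    have "msg \<kappa> (?r j) ^ (d - 1) \<le> msg \<kappa> (?r (Suc j)) ^ (d - 1)"
      using msg_mono[OF ge1 Suc] msg_ge_1[OF \<kappa> ge1, of j] by (intro power_mono) linarith+
    then show ?case using \<mu> by (subst (1 2) tree_ratio.simps) simp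
  qed
  have bound: "?r j \<le> exp s * (1 / \<kappa>) ^ (d - 1)" for j
  proof (cases j)
    case 0
    have "1 \<le> exp s * (1 / \<kappa>) ^ (d - 1)" using \<mu> \<kappa> one_le_power[of "1 / \<kappa>" "d - 1"]
      by (intro mult_ge1_I) auto
    then show ?thesis using 0 by simp
  next
    case (Suc i)
    have "msg \<kappa> (?r i) \<le> 1 / \<kappa>"
    proof -
      have "\<kappa> * ?r i + 1 > 0" using \<kappa> ge1[of i] by (simp add: add_pos_pos)
      moreover have "\<kappa> * \<kappa> \<le> 1" using \<kappa> by (simp add: mult_le_one)
      ultimately show ?thesis unfolding msg_def using \<kappa> by (simp add: field_simps)
    qed
    then have "msg \<kappa> (?r i) ^ (d - 1) \<le> (1 / \<kappa>) ^ (d - 1)"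
      using msg_ge_1[OF \<kappa> ge1, of i] by (intro power_mono) linarith+
    then show ?thesis using Suc by simp
  qed
  have "incseq ?r" by (rule incseq_SucI) (rule inc)
  then obtain l where l: "?r \<longlonglongrightarrow> l" using incseq_convergent[of ?r "exp s * (1 / \<kappa>) ^ (d - 1)"] bound by blast
  have l1: "l \<ge> 1" using l ge1 by (intro LIMSEQ_le_const) auto
  have pos: "\<kappa> * l + 1 > 0" using \<kappa> l1 by (simp add: add_pos_pos)
  have "(\<lambda>j. ?r (Suc j)) \<longlonglongrightarrow> exp s * msg \<kappa> l ^ (d - 1)"
    unfolding tree_ratio.simps msg_def using pos by (intro tendsto_intros l) auto
  moreover have "(\<lambda>j. ?r (Suc j)) \<longlonglongrightarrow> l" using l by (rule LIMSEQ_Suc)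
  ultimately have "l = exp s * msg \<kappa> l ^ (d - 1)" using LIMSEQ_unique by blast
  then have "exp s * (l + \<kappa>) ^ (d - 1) = l * (\<kappa> * l + 1) ^ (d - 1)"
    unfolding msg_def power_divide using pos by (simp add: field_simps)
  then have fl: "field_at d \<kappa> l = s" using field_at_eq_iff[of l \<kappa> "exp s" d] \<kappa> l1 by simp
  have "l \<noteq> 1" using fl s field_at_1[of \<kappa> d] \<kappa> by auto
  then have "is_top_root d \<kappa> s l" using fl l1 s \<kappa> by (intro is_top_rootI) auto
  then show ?thesis using l top_root_eq[OF \<kappa>, of s d l] s by simp
qed


section \<open>The Bethe free energy\<close>

text \<open>One vertex term minus \<open>d / 2\<close> edge terms, \<open>d / 2\<close> being the
  number of edges per vertex, with the message vector \<open>(R, 1)\<close> on every edge.\<close>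

definition bethe :: "nat \<Rightarrow> real \<Rightarrow> real \<Rightarrow> real \<Rightarrow> real" where
  "bethe d \<kappa> s R = ln (exp s * (R + \<kappa>) ^ d + (\<kappa> * R + 1) ^ d) - real d / 2 * ln (R\<^sup>2 + 2 * \<kappa> * R + 1)"

lemma edge_sum_pos: "R > 0 \<Longrightarrow> \<kappa> > 0 \<Longrightarrow> R\<^sup>2 + 2 * \<kappa> * R + 1 > (0::real)"
  by (simp add: add_pos_pos)

lemma vertex_sum_pos: "R > 0 \<Longrightarrow> \<kappa> > 0 \<Longrightarrow> exp s * (R + \<kappa>) ^ d + (\<kappa> * R + 1) ^ d > (0::real)"
  by (simp add: add_pos_pos)

text \<open>The numerator is the message equation, so the stationary points are the fixed points of
  the recursion; by \<open>stationarity_sign\<close>, \<open>bethe\<close> grows where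
  \<open>field_at\<close> is below \<open>s\<close> and falls where it is above.\<close>

lemma bethe_deriv:
  assumes R: "R > 0" and \<kappa>: "\<kappa> > 0" and d: "d \<ge> 1"
  shows "(bethe d \<kappa> s has_real_derivative
     real d * (1 - \<kappa>\<^sup>2) * (exp s * (R + \<kappa>) ^ (d - 1) - R * (\<kappa> * R + 1) ^ (d - 1)) /
     ((exp s * (R + \<kappa>) ^ d + (\<kappa> * R + 1) ^ d) * (R\<^sup>2 + 2 * \<kappa> * R + 1))) (at R)"
proof -
  define A C where "A = R + \<kappa>" and "C = \<kappa> * R + 1"
  define a c where "a = A ^ (d - 1)" and "c = C ^ (d - 1)"
  have dd: "A ^ d = A * a" "C ^ d = C * c" using d by (simp_all add: a_def c_def power_eq_if)
  have e: "R\<^sup>2 + 2 * \<kappa> * R + 1 = R * A + C" by (simp add: A_def C_def power2_eq_square algebra_simps)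
  have v: "exp s * A ^ d + C ^ d > 0" using vertex_sum_pos[OF R \<kappa>] by (simp add: A_def C_def)
  have ep: "R * A + C > 0" using edge_sum_pos[OF R \<kappa>] e by simp
  have "(bethe d \<kappa> s has_real_derivative
      (exp s * (real d * a) + real d * c * \<kappa>) / (exp s * A ^ d + C ^ d)
      - real d / 2 * ((2 * R + 2 * \<kappa>) / (R * A + C))) (at R)"
  proof -
    have f1: "((\<lambda>R. exp s * (R + \<kappa>) ^ d + (\<kappa> * R + 1) ^ d) has_real_derivative
        exp s * (real d * a) + real d * c * \<kappa>) (at R)"
      unfolding a_def c_def A_def C_def by (auto intro!: derivative_eq_intros)
    have f2: "((\<lambda>R. R\<^sup>2 + 2 * \<kappa> * R + 1) has_real_derivative 2 * R + 2 * \<kappa>) (at R)"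
      by (auto intro!: derivative_eq_intros)
    show ?thesis unfolding bethe_def[abs_def] e[symmetric]
      using DERIV_diff[OF DERIV_chain2[OF DERIV_ln_divide f1] DERIV_cmult[OF DERIV_chain2[OF DERIV_ln_divide f2], of "real d / 2"]]
        vertex_sum_pos[OF R \<kappa>] edge_sum_pos[OF R \<kappa>]
      by (simp add: A_def C_def)
  qed
  moreover have "(exp s * (real d * a) + real d * c * \<kappa>) / (exp s * A ^ d + C ^ d)
      - real d / 2 * ((2 * R + 2 * \<kappa>) / (R * A + C)) =
      real d * (1 - \<kappa>\<^sup>2) * (exp s * a - R * c) / ((exp s * A ^ d + C ^ d) * (R * A + C))"
  proof -
    have h: "real d / 2 * ((2 * R + 2 * \<kappa>) / (R * A + C)) = real d * A / (R * A + C)"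
    proof -
      have "2 * R + 2 * \<kappa> = 2 * A" by (simp add: A_def)
      then show ?thesis by simp
    qed
    have "(exp s * (real d * a) + real d * c * \<kappa>) * (R * A + C) - real d * A * (exp s * A ^ d + C ^ d) =
        real d * (1 - \<kappa>\<^sup>2) * (exp s * a - R * c)"
    proof -
      have 1: "R * A + C - A * A = 1 - \<kappa>\<^sup>2" by (simp add: A_def C_def power2_eq_square algebra_simps)
      have 2: "\<kappa> * (R * A + C) - A * C = - R * (1 - \<kappa>\<^sup>2)" by (simp add: A_def C_def power2_eq_square algebra_simps)
      have "(exp s * (real d * a) + real d * c * \<kappa>) * (R * A + C) - real d * A * (exp s * A ^ d + C ^ d) =
        real d * (exp s * a * (R * A + C - A * A) + c * (\<kappa> * (R * A + C) - A * C))"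
        unfolding dd by (simp add: algebra_simps)
      then show ?thesis unfolding 1 2 by (simp add: algebra_simps)
    qed
    then show ?thesis unfolding h using v ep by (simp add: diff_frac_eq)
  qed
  ultimately show ?thesis unfolding e[unfolded A_def C_def] A_def C_def a_def c_def by simp
qed

lemma stationarity_sign:
  assumes R: "R > 0" and \<kappa>: "\<kappa> > 0"
  shows "field_at d \<kappa> R \<le> s \<Longrightarrow> exp s * (R + \<kappa>) ^ (d - 1) - R * (\<kappa> * R + 1) ^ (d - 1) \<ge> 0"
    and "field_at d \<kappa> R \<ge> s \<Longrightarrow> exp s * (R + \<kappa>) ^ (d - 1) - R * (\<kappa> * R + 1) ^ (d - 1) \<le> 0"
proof -
  have p: "R + \<kappa> > 0" "\<kappa> * R + 1 > 0" using R \<kappa> by (simp_all add: add_pos_pos)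
  have "exp (field_at d \<kappa> R) * (R + \<kappa>) ^ (d - 1) = R * (\<kappa> * R + 1) ^ (d - 1)"
    using field_at_eq_iff[of R \<kappa> "exp (field_at d \<kappa> R)" d] R \<kappa> by simp
  moreover have "exp (field_at d \<kappa> R) * (R + \<kappa>) ^ (d - 1) \<le> exp s * (R + \<kappa>) ^ (d - 1)" if "field_at d \<kappa> R \<le> s"
    using that p by simp
  moreover have "exp (field_at d \<kappa> R) * (R + \<kappa>) ^ (d - 1) \<ge> exp s * (R + \<kappa>) ^ (d - 1)" if "field_at d \<kappa> R \<ge> s"
    using that p by simp
  ultimately show "field_at d \<kappa> R \<le> s \<Longrightarrow> exp s * (R + \<kappa>) ^ (d - 1) - R * (\<kappa> * R + 1) ^ (d - 1) \<ge> 0"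
    and "field_at d \<kappa> R \<ge> s \<Longrightarrow> exp s * (R + \<kappa>) ^ (d - 1) - R * (\<kappa> * R + 1) ^ (d - 1) \<le> 0"
    by linarith+
qed

lemma exp_mult_exp_minus: "exp s * (exp (- s) * x) = (x::real)"
  by (simp add: mult.assoc[symmetric] flip: exp_add)

lemma bethe_flip:
  assumes R: "R > 0" and \<kappa>: "\<kappa> > 0"
  shows "bethe d \<kappa> s (1 / R) = s + bethe d \<kappa> (- s) R"
proof -
  have 1: "exp s * (1 / R + \<kappa>) ^ d + (\<kappa> * (1 / R) + 1) ^ d =
      exp s * (exp (- s) * (R + \<kappa>) ^ d + (\<kappa> * R + 1) ^ d) / R ^ d"
  proof -
    have e: "1 / R + \<kappa> = (\<kappa> * R + 1) / R" "\<kappa> * (1 / R) + 1 = (R + \<kappa>) / R" using R by (simp_all add: field_simps)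
    show ?thesis unfolding e power_divide distrib_left exp_mult_exp_minus by (simp add: add_divide_distrib)
  qed
  have 2: "(1 / R)\<^sup>2 + 2 * \<kappa> * (1 / R) + 1 = (R\<^sup>2 + 2 * \<kappa> * R + 1) / R\<^sup>2"
    using R by (simp add: field_simps power2_eq_square)
  have 3: "ln (exp s * v / R ^ d) = s + ln v - real d * ln R" "ln (v / R\<^sup>2) = ln v - 2 * ln R" if "v > 0" for v
    using that R by (simp_all add: ln_div ln_mult ln_realpow)
  show ?thesis
    unfolding bethe_def 1 2 3(1)[OF vertex_sum_pos[OF R \<kappa>]] 3(2)[OF edge_sum_pos[OF R \<kappa>]]
    by (simp add: algebra_simps)
qed

text \<open>A nonnegative field prefers the message favouring plus, so the maximum need only be
  sought among \<open>R \<ge> 1\<close>.\<close>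

lemma bethe_le_flip:
  assumes R: "0 < R" "R \<le> 1" and \<kappa>: "0 < \<kappa>" "\<kappa> \<le> 1" and s: "s \<ge> 0"
  shows "bethe d \<kappa> s R \<le> bethe d \<kappa> s (1 / R)"
proof -
  have "(1 - \<kappa>) * (1 - R) \<ge> 0" using R \<kappa> by simp
  then have "R + \<kappa> \<le> \<kappa> * R + 1" by (simp add: algebra_simps)
  then have le: "(R + \<kappa>) ^ d \<le> (\<kappa> * R + 1) ^ d" using R \<kappa> by (intro power_mono) auto
  have "(exp s - 1) * (R + \<kappa>) ^ d \<le> (exp s - 1) * (\<kappa> * R + 1) ^ d"
    using s by (intro mult_left_mono le) simp
  then have "exp s * (R + \<kappa>) ^ d + (\<kappa> * R + 1) ^ d \<le> exp s * (exp (- s) * (R + \<kappa>) ^ d + (\<kappa> * R + 1) ^ d)"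
    by (simp add: distrib_left exp_mult_exp_minus left_diff_distrib)
  then have "ln (exp s * (R + \<kappa>) ^ d + (\<kappa> * R + 1) ^ d) \<le> s + ln (exp (- s) * (R + \<kappa>) ^ d + (\<kappa> * R + 1) ^ d)"
    using vertex_sum_pos[OF R(1) \<kappa>(1), of s d] vertex_sum_pos[OF R(1) \<kappa>(1), of "- s" d]
    by (subst (asm) ln_le_cancel_iff[symmetric]) (simp_all add: ln_mult)
  then show ?thesis unfolding bethe_flip[OF R(1) \<kappa>(1)] by (simp add: bethe_def)
qed

lemma bethe_le_top_root:
  assumes R: "R > 0" and \<kappa>: "0 < \<kappa>" "\<kappa> \<le> 1" and s: "s \<ge> 0" and d: "d \<ge> 1"
  shows "bethe d \<kappa> s R \<le> bethe d \<kappa> s (top_root d \<kappa> s)"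
proof -
  let ?T = "top_root d \<kappa> s"
  note T = top_root[OF \<kappa> s, of d]
  have T1: "?T \<ge> 1" using T by (simp add: is_top_root_def)
  have sq: "1 - \<kappa>\<^sup>2 \<ge> 0" using \<kappa> by (simp add: power_le_one)
  have main: "bethe d \<kappa> s R \<le> bethe d \<kappa> s ?T" if R1: "R \<ge> 1" for R
  proof (cases "R \<le> ?T")
    case True
    show ?thesis
    proof (rule DERIV_nonneg_imp_nondecreasing[OF True])
      fix x assume x: "R \<le> x" "x \<le> ?T"
      have "field_at d \<kappa> x \<le> s"
      proof (cases "x = 1 \<or> x = ?T")
        case True
        then show ?thesis using field_at_1[of \<kappa> d] \<kappa> s T by (auto simp: is_top_root_def)
      next
        case False
        then show ?thesis using is_top_root_below[OF \<kappa>(1) s T, of x] R1 x by simp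
      qed
      then show "\<exists>y. (bethe d \<kappa> s has_real_derivative y) (at x) \<and> 0 \<le> y"
        using bethe_deriv[of x \<kappa> d s] stationarity_sign(1)[of x \<kappa> d s] x R1 \<kappa> d sq
          vertex_sum_pos[of x \<kappa> s d] edge_sum_pos[of x \<kappa>]
        by (intro exI conjI) (auto intro!: divide_nonneg_pos mult_nonneg_nonneg mult_pos_pos)
    qed
  next
    case False
    then have le: "?T \<le> R" by simp
    show ?thesis
    proof (rule DERIV_nonpos_imp_nonincreasing[OF le])
      fix x assume x: "?T \<le> x" "x \<le> R"
      then have "field_at d \<kappa> x \<ge> s" using T unfolding is_top_root_def by (metis less_eq_real_def order_refl)
      then show "\<exists>y. (bethe d \<kappa> s has_real_derivative y) (at x) \<and> y \<le> 0"
        using bethe_deriv[of x \<kappa> d s] stationarity_sign(2)[of x \<kappa> s d] x T1 \<kappa> d sq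
          vertex_sum_pos[of x \<kappa> s d] edge_sum_pos[of x \<kappa>]
        by (intro exI conjI) (auto intro!: divide_nonpos_pos mult_nonneg_nonpos mult_pos_pos)
    qed
  qed
  show ?thesis
  proof (cases "R \<ge> 1")
    case False
    then have "bethe d \<kappa> s R \<le> bethe d \<kappa> s (1 / R)" using R by (intro bethe_le_flip \<kappa> s) auto
    also have "\<dots> \<le> bethe d \<kappa> s ?T" using False R by (intro main) simp
    finally show ?thesis .
  qed (rule main)
qed

section \<open>The maximum of the Bethe free energy as a function of the field\<close>

definition bethe_max :: "nat \<Rightarrow> real \<Rightarrow> real \<Rightarrow> real" where
  "bethe_max d \<kappa> s = bethe d \<kappa> s (top_root d \<kappa> s)"

text \<open>The probability of a plus spin at a vertex receiving \<open>d\<close> messages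
  \<open>R\<close>. It is also the partial derivative of \<open>bethe\<close> in \<open>s\<close>,
  as \<open>bethe_density_eq\<close> makes visible.\<close>

definition bethe_density :: "nat \<Rightarrow> real \<Rightarrow> real \<Rightarrow> real \<Rightarrow> real" where
  "bethe_density d \<kappa> s R = exp s * msg \<kappa> R ^ d / (1 + exp s * msg \<kappa> R ^ d)"

lemma bethe_density_eq:
  assumes "R > 0" "\<kappa> > 0"
  shows "bethe_density d \<kappa> s R = exp s * (R + \<kappa>) ^ d / (exp s * (R + \<kappa>) ^ d + (\<kappa> * R + 1) ^ d)"
proof -
  have p: "\<kappa> * R + 1 > 0" "R + \<kappa> > 0" using assms by (simp_all add: add_pos_pos)
  have "(N / M) / (1 + N / M) = N / (N + M)" if "M > 0" "N > 0" for N M :: real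
    using that by (simp add: field_simps)
  moreover have "exp s * msg \<kappa> R ^ d = exp s * (R + \<kappa>) ^ d / (\<kappa> * R + 1) ^ d"
    by (simp add: msg_def power_divide)
  ultimately show ?thesis unfolding bethe_density_def using p by simp
qed

lemma bethe_density_bounds:
  assumes "R > 0" "\<kappa> > 0" shows "0 \<le> bethe_density d \<kappa> s R" "bethe_density d \<kappa> s R \<le> 1"
  unfolding bethe_density_eq[OF assms] using assms
  by (auto simp: divide_le_eq_1 zero_le_divide_iff add_nonneg_nonneg add_pos_pos)

text \<open>A convex function of \<open>s\<close>: its secant slope is at most the derivative at the
  right end. Convexity of \<open>exp\<close> with weights \<open>p\<close> and \<open>1 - p\<close>
  gives this directly.\<close>

lemma ln_affine_exp_le:
  fixes u v s s' :: real
  assumes u: "u > 0" and v: "v > 0" and s: "s \<le> s'"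
  shows "ln (exp s' * u + v) - ln (exp s * u + v) \<le> (s' - s) * (exp s' * u / (exp s' * u + v))"
proof -
  define p where "p = exp s' * u / (exp s' * u + v)"
  have D: "exp s' * u + v > 0" by (rule add_pos_pos[OF mult_pos_pos[OF exp_gt_zero u] v])
  have D2: "exp s * u + v > 0" by (rule add_pos_pos[OF mult_pos_pos[OF exp_gt_zero u] v])
  have p: "0 \<le> p" "p \<le> 1" "1 - p = v / (exp s' * u + v)" using u v D by (auto simp: p_def field_simps)
  have "(exp s * u + v) / (exp s' * u + v) = p * exp (- (s' - s)) + (1 - p) * exp 0"
  proof -
    have "p * exp (- (s' - s)) = exp s * u / (exp s' * u + v)" by (simp add: p_def exp_diff)
    then show ?thesis unfolding p(3) by (simp add: add_divide_distrib)
  qed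
  also have "\<dots> \<ge> exp (- (s' - s) * p)"
    using convex_onD[OF exp_convex, of p 0 "- (s' - s)"] p by (simp add: algebra_simps)
  finally have "ln (exp (- (s' - s) * p)) \<le> ln ((exp s * u + v) / (exp s' * u + v))"
    by (subst ln_le_cancel_iff) (use D D2 in auto)
  then show ?thesis using D D2 unfolding p_def[symmetric] by (simp add: ln_div algebra_simps)
qed

text \<open>Evaluating both fields at the maximizer for \<open>s'\<close> leaves only the explicit
  dependence on the field, so the root need not be differentiated.\<close>

lemma bethe_max_increment:
  assumes \<kappa>: "0 < \<kappa>" "\<kappa> \<le> 1" and s: "0 \<le> s" "s \<le> s'" and d: "d \<ge> 1"
  shows "bethe_max d \<kappa> s' - bethe_max d \<kappa> s \<le> (s' - s) * bethe_density d \<kappa> s' (top_root d \<kappa> s')"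
    and "bethe_max d \<kappa> s \<le> bethe_max d \<kappa> s'"
proof -
  let ?T = "top_root d \<kappa> s" and ?T' = "top_root d \<kappa> s'"
  have T: "?T > 0" "?T' > 0" using top_root[OF \<kappa>, of s d] top_root[OF \<kappa>, of s' d] s by (auto simp: is_top_root_def)
  have "bethe_max d \<kappa> s' - bethe_max d \<kappa> s \<le> bethe d \<kappa> s' ?T' - bethe d \<kappa> s ?T'"
    unfolding bethe_max_def using bethe_le_top_root[OF T(2) \<kappa> s(1) d] by simp
  also have "\<dots> \<le> (s' - s) * bethe_density d \<kappa> s' ?T'"
  proof -
    have "(?T' + \<kappa>) ^ d > 0" "(\<kappa> * ?T' + 1) ^ d > 0" using T \<kappa> by (simp_all add: add_pos_pos)
    from ln_affine_exp_le[OF this s(2)] show ?thesis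
      unfolding bethe_density_eq[OF T(2) \<kappa>(1)] by (simp add: bethe_def)
  qed
  finally show "bethe_max d \<kappa> s' - bethe_max d \<kappa> s \<le> (s' - s) * bethe_density d \<kappa> s' ?T'" .
  have "bethe d \<kappa> s ?T \<le> bethe d \<kappa> s' ?T"
    using s T \<kappa> vertex_sum_pos[OF T(1) \<kappa>(1), of s d] vertex_sum_pos[OF T(1) \<kappa>(1), of s' d]
    by (simp add: bethe_def)
  also have "\<dots> \<le> bethe d \<kappa> s' ?T'" using s by (intro bethe_le_top_root T \<kappa> d) simp
  finally show "bethe_max d \<kappa> s \<le> bethe_max d \<kappa> s'" unfolding bethe_max_def .
qed

text \<open>The trial message \<open>R = exp s\<close>, the ratio of an isolated vertex, is accurate
  enough at large field: the error decays like \<open>exp (- s)\<close>.\<close>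

lemma bethe_max_lower:
  assumes \<kappa>: "0 < \<kappa>" "\<kappa> \<le> 1" and s: "0 \<le> s" and d: "d \<ge> 1"
  shows "s - real d / 2 * exp (- s) \<le> bethe_max d \<kappa> s"
proof -
  define R where "R = exp s"
  have R: "R \<ge> 1" "R > 0" using s by (simp_all add: R_def)
  have pos: "R + \<kappa> > 0" using R \<kappa> by simp
  have "s + real d * ln (R + \<kappa>) = ln (exp s * (R + \<kappa>) ^ d)" using pos by (simp add: ln_mult ln_realpow)
  also have "\<dots> \<le> ln (exp s * (R + \<kappa>) ^ d + (\<kappa> * R + 1) ^ d)"
    using pos R \<kappa> by (subst ln_le_cancel_iff) (auto simp: add_pos_pos add_pos_nonneg)
  finally have 1: "s + real d * ln (R + \<kappa>) \<le> ln (exp s * (R + \<kappa>) ^ d + (\<kappa> * R + 1) ^ d)" .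
  have "ln (R\<^sup>2 + 2 * \<kappa> * R + 1) \<le> ln ((R + \<kappa>)\<^sup>2 * (1 + exp (- s)))"
  proof (subst ln_le_cancel_iff)
    have "(R + \<kappa>)\<^sup>2 * exp (- s) \<ge> R\<^sup>2 * exp (- s)" using R \<kappa> by (intro mult_right_mono power_mono) auto
    moreover have "R\<^sup>2 * exp (- s) = R" by (simp add: R_def power2_eq_square exp_minus)
    moreover have "(R + \<kappa>)\<^sup>2 = R\<^sup>2 + 2 * \<kappa> * R + \<kappa>\<^sup>2" by (simp add: power2_eq_square algebra_simps)
    moreover have "\<kappa>\<^sup>2 \<ge> 0" by simp
    ultimately show "R\<^sup>2 + 2 * \<kappa> * R + 1 \<le> (R + \<kappa>)\<^sup>2 * (1 + exp (- s))"
      using R unfolding distrib_left by linarith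
  qed (use edge_sum_pos[OF R(2) \<kappa>(1)] pos in \<open>auto intro!: mult_pos_pos add_pos_pos\<close>)
  also have "\<dots> = 2 * ln (R + \<kappa>) + ln (1 + exp (- s))"
  proof -
    have "1 + exp (- s) > 0" by (simp add: add_pos_pos)
    then show ?thesis using pos by (subst ln_mult) (auto simp: ln_realpow)
  qed
  also have "ln (1 + exp (- s)) \<le> exp (- s)" by (rule ln_add_one_self_le_self) simp
  finally have "real d / 2 * ln (R\<^sup>2 + 2 * \<kappa> * R + 1) \<le> real d / 2 * (2 * ln (R + \<kappa>) + exp (- s))"
    by (intro mult_left_mono) auto
  then have "s - real d / 2 * exp (- s) \<le> bethe d \<kappa> s R" using 1 unfolding bethe_def by (simp add: algebra_simps)
  also have "\<dots> \<le> bethe_max d \<kappa> s" unfolding bethe_max_def by (rule bethe_le_top_root[OF R(2) \<kappa> s d])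
  finally show ?thesis .
qed

text \<open>The slopes telescope over a uniform partition, so neither continuity nor monotonicity of
  the density \<open>\<rho>\<close> is needed.\<close>

lemma increment_comparison:
  fixes \<psi> P \<rho> :: "real \<Rightarrow> real"
  assumes \<psi>: "\<And>s s'. a \<le> s \<Longrightarrow> s < s' \<Longrightarrow> (s' - s) * \<rho> s \<le> \<psi> s' - \<psi> s"
    and P: "\<And>s s'. a \<le> s \<Longrightarrow> s < s' \<Longrightarrow> P s' - P s \<le> (s' - s) * \<rho> s'"
    and \<rho>: "\<And>s. a \<le> s \<Longrightarrow> 0 \<le> \<rho> s \<and> \<rho> s \<le> 1"
    and s: "a < s'"
  shows "\<psi> a - P a \<le> \<psi> s' - P s'"
proof (rule ccontr)
  define g where "g s = \<psi> s - P s" for s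
  assume "\<not> \<psi> a - P a \<le> \<psi> s' - P s'"
  then have neg: "g a - g s' > 0" by (simp add: g_def)
  \<comment> \<open>After telescoping only the two end slopes remain, an error of at most one mesh
    width; the mesh is taken smaller than the supposed gap.\<close>
  then obtain n :: nat where n: "(s' - a) / (g a - g s') < real n" using reals_Archimedean2 by blast
  have n0: "real n > 0" using n neg s by (smt (verit) divide_pos_pos)
  define h where "h = (s' - a) / n"
  have h: "h > 0" using n0 s by (simp add: h_def)
  define t where "t i = a + real i * h" for i :: nat
  have t: "a \<le> t i" "t i < t (Suc i)" "t (Suc i) - t i = h" for i using h by (auto simp: t_def algebra_simps)
  have "g (t (Suc i)) - g (t i) \<ge> h * \<rho> (t i) - h * \<rho> (t (Suc i))" for i
    using \<psi>[OF t(1,2), of i] P[OF t(1,2), of i] t(3)[of i] by (simp add: g_def)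
  then have "(\<Sum>i<n. g (t (Suc i)) - g (t i)) \<ge> (\<Sum>i<n. h * \<rho> (t i) - h * \<rho> (t (Suc i)))"
    by (intro sum_mono) auto
  moreover have "(\<Sum>i<n. g (t (Suc i)) - g (t i)) = g (t n) - g (t 0)" by (rule sum_lessThan_telescope)
  moreover have "(\<Sum>i<n. h * \<rho> (t i) - h * \<rho> (t (Suc i))) = h * \<rho> (t 0) - h * \<rho> (t n)"
    by (rule sum_lessThan_telescope')
  moreover have "t n = s'" "t 0 = a" using n0 by (auto simp: t_def h_def)
  ultimately have "h * \<rho> a - h * \<rho> s' \<le> g s' - g a" by simp
  moreover have "h * \<rho> a \<ge> 0" "h * \<rho> s' \<le> h" using h \<rho>[of a] \<rho>[of s'] s by (auto simp: mult_left_le)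
  ultimately have "g a - g s' \<le> h" by linarith
  moreover have "h < g a - g s'" using n n0 neg by (simp add: h_def field_simps)
  ultimately show False by simp
qed


section \<open>Estimates in finite volume\<close>

lemma ising_weight_exp:
  assumes "finite V" "T \<subseteq> V"
  shows "ising_weight \<kappa> (exp s') V E T = exp ((s' - s) * card (V - T)) * ising_weight \<kappa> (exp s) V E T"
proof -
  have "(\<Prod>v\<in>V. if v \<in> T then 1 else exp t) = exp (t * card (V - T))" for t :: real
  proof -
    have "V \<inter> - {v. v \<in> T} = V - T" by auto
    then show ?thesis using assms by (simp add: prod.If_cases exp_of_nat2_mult)
  qed
  then show ?thesis unfolding ising_weight_def by (simp add: algebra_simps flip: exp_add)
qed

lemma sum_Z_plus:
  assumes "finite V"
  shows "(\<Sum>v\<in>V. Z_plus \<kappa> \<mu> V E v) = (\<Sum>T\<in>Pow V. card (V - T) * ising_weight \<kappa> \<mu> V E T)"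
  unfolding Z_plus_def
proof (subst sum.swap, rule sum.cong[OF refl])
  fix T
  have "V \<inter> - {v. v \<in> T} = V - T" by auto
  then show "(\<Sum>v\<in>V. if v \<in> T then 0 else ising_weight \<kappa> \<mu> V E T) = card (V - T) * ising_weight \<kappa> \<mu> V E T"
    using assms by (simp add: sum.If_cases)
qed

text \<open>Jensen's inequality: the tangent to \<open>exp\<close> at the mean \<open>m\<close> of
  \<open>(s' - s) * card (V - T)\<close> is used term by term, and the linear deviations from the
  mean cancel.\<close>

lemma ln_Z_ising_increment:
  assumes V: "finite V" and \<kappa>: "\<kappa> > 0"
  shows "(s' - s) * (\<Sum>v\<in>V. Z_plus \<kappa> (exp s) V E v / Z_ising \<kappa> (exp s) V E)
    \<le> ln (Z_ising \<kappa> (exp s') V E) - ln (Z_ising \<kappa> (exp s) V E)"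
proof -
  let ?w = "ising_weight \<kappa> (exp s) V E" and ?Z = "Z_ising \<kappa> (exp s) V E"
  have Z: "?Z > 0" "Z_ising \<kappa> (exp s') V E > 0" using V \<kappa> by (auto intro: Z_ising_pos)
  define m where "m = (s' - s) * (\<Sum>v\<in>V. Z_plus \<kappa> (exp s) V E v / ?Z)"
  have m: "m * ?Z = (\<Sum>T\<in>Pow V. (s' - s) * card (V - T) * ?w T)"
    using Z unfolding m_def sum_divide_distrib[symmetric] sum_Z_plus[OF V]
    by (simp add: sum_distrib_left mult.assoc)
  have "exp m * ?Z = (\<Sum>T\<in>Pow V. exp m * (1 - m) * ?w T) + exp m * (m * ?Z)"
  proof -
    have "(\<Sum>T\<in>Pow V. exp m * (1 - m) * ?w T) = exp m * (1 - m) * ?Z"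
      unfolding Z_ising_def by (rule sum_distrib_left[symmetric])
    then show ?thesis by (simp add: algebra_simps)
  qed
  also have "\<dots> = (\<Sum>T\<in>Pow V. exp m * (1 + ((s' - s) * card (V - T) - m)) * ?w T)"
    unfolding m sum_distrib_left sum.distrib[symmetric] by (intro sum.cong) (auto simp: algebra_simps)
  also have "\<dots> \<le> (\<Sum>T\<in>Pow V. exp ((s' - s) * card (V - T)) * ?w T)"
  proof (rule sum_mono)
    fix T
    have "exp m * (1 + ((s' - s) * card (V - T) - m)) \<le> exp m * exp ((s' - s) * card (V - T) - m)"
      by (intro mult_left_mono exp_ge_add_one_self) simp
    also have "\<dots> = exp ((s' - s) * card (V - T))" by (simp flip: exp_add)
    finally show "exp m * (1 + ((s' - s) * card (V - T) - m)) * ?w T \<le> exp ((s' - s) * card (V - T)) * ?w T"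
      using \<kappa> by (intro mult_right_mono less_imp_le[OF ising_weight_pos]) auto
  qed
  also have "\<dots> = Z_ising \<kappa> (exp s') V E"
    unfolding Z_ising_def by (intro sum.cong) (auto simp: ising_weight_exp[OF V, of _ \<kappa> s' E s])
  finally have "ln (exp m * ?Z) \<le> ln (Z_ising \<kappa> (exp s') V E)" using Z by (subst ln_le_cancel_iff) auto
  then show ?thesis using Z unfolding m_def[symmetric] by (simp add: ln_mult)
qed

lemma ln_Z_ising_lipschitz:
  assumes V: "finite V" and \<kappa>: "\<kappa> > 0" and s: "s \<le> s'"
  shows "ln (Z_ising \<kappa> (exp s) V E) \<le> ln (Z_ising \<kappa> (exp s') V E)"
    and "ln (Z_ising \<kappa> (exp s') V E) \<le> ln (Z_ising \<kappa> (exp s) V E) + (s' - s) * card V"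
proof -
  have Z: "Z_ising \<kappa> (exp t) V E > 0" for t using V \<kappa> by (auto intro: Z_ising_pos)
  have w: "ising_weight \<kappa> (exp s') V E T = exp ((s' - s) * card (V - T)) * ising_weight \<kappa> (exp s) V E T"
    "ising_weight \<kappa> (exp s) V E T > 0" "real (card (V - T)) \<le> card V" if "T \<in> Pow V" for T
    using that V \<kappa> ising_weight_exp[OF V, of T \<kappa> s' E s] ising_weight_pos[of \<kappa> "exp s" V E T] card_mono[of V "V - T"] by auto
  have "Z_ising \<kappa> (exp s) V E \<le> Z_ising \<kappa> (exp s') V E"
    unfolding Z_ising_def
  proof (rule sum_mono)
    fix T assume T: "T \<in> Pow V"
    have "1 * ising_weight \<kappa> (exp s) V E T \<le> exp ((s' - s) * card (V - T)) * ising_weight \<kappa> (exp s) V E T"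
      using w(2)[OF T] s by (intro mult_right_mono) auto
    then show "ising_weight \<kappa> (exp s) V E T \<le> ising_weight \<kappa> (exp s') V E T" unfolding w(1)[OF T] by simp
  qed
  then show "ln (Z_ising \<kappa> (exp s) V E) \<le> ln (Z_ising \<kappa> (exp s') V E)" using Z by simp
  have "Z_ising \<kappa> (exp s') V E \<le> exp ((s' - s) * card V) * Z_ising \<kappa> (exp s) V E"
    unfolding Z_ising_def sum_distrib_left
  proof (rule sum_mono)
    fix T assume T: "T \<in> Pow V"
    have "(s' - s) * card (V - T) \<le> (s' - s) * card V" using w(3)[OF T] s by (intro mult_left_mono) auto
    then show "ising_weight \<kappa> (exp s') V E T \<le> exp ((s' - s) * card V) * ising_weight \<kappa> (exp s) V E T"
      unfolding w(1)[OF T] using w(2)[OF T] by (intro mult_right_mono) auto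
  qed
  then have "ln (Z_ising \<kappa> (exp s') V E) \<le> ln (exp ((s' - s) * card V) * Z_ising \<kappa> (exp s) V E)"
    using Z by (subst ln_le_cancel_iff) auto
  then show "ln (Z_ising \<kappa> (exp s') V E) \<le> ln (Z_ising \<kappa> (exp s) V E) + (s' - s) * card V"
    using Z[of s] by (simp add: ln_mult)
qed

text \<open>Vertices with a tree-like ball have plus probability at least \<open>x / (1 + x)\<close>
  by \<open>root_ratio\<close>; for all others the trivial bound 0 is used.\<close>

lemma density_lower_bound:
  assumes reg: "regular_graph d V E" and V: "V \<noteq> {}" and \<kappa>: "0 < \<kappa>" "\<kappa> \<le> 1" and s: "s \<ge> 0"
  shows "card V * tree_proportion V E (Suc j) * bethe_density d \<kappa> s (tree_ratio d \<kappa> (exp s) j)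
     \<le> (\<Sum>v\<in>V. Z_plus \<kappa> (exp s) V E v / Z_ising \<kappa> (exp s) V E)"
proof -
  have fin: "finite V" using reg by (simp add: regular_graph_def simple_graph_def)
  define Tr where "Tr = {v \<in> V. is_tree (nbhd V E (Suc j) v) (induced_edges E (nbhd V E (Suc j) v))}"
  define x where "x = exp s * msg \<kappa> (tree_ratio d \<kappa> (exp s) j) ^ d"
  have "exp s \<ge> 1" using s by simp
  have r1: "tree_ratio d \<kappa> (exp s) j \<ge> 1" by (rule tree_ratio_ge_1[OF \<kappa> \<open>exp s \<ge> 1\<close>])
  have x: "x > 0" using msg_ge_1[OF \<kappa> r1] by (simp add: x_def)
  have Z: "Z_ising \<kappa> (exp s) V E > 0" using fin \<kappa> by (auto intro: Z_ising_pos)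
  have "card V * tree_proportion V E (Suc j) = card Tr" using V fin by (simp add: tree_proportion_def Tr_def)
  then have "card V * tree_proportion V E (Suc j) * (x / (1 + x)) = (\<Sum>v\<in>Tr. x / (1 + x))" by simp
  also have "\<dots> \<le> (\<Sum>v\<in>Tr. Z_plus \<kappa> (exp s) V E v / Z_ising \<kappa> (exp s) V E)"
  proof (rule sum_mono)
    fix v assume v: "v \<in> Tr"
    have "x * Z_minus \<kappa> (exp s) V E v \<le> Z_plus \<kappa> (exp s) V E v"
      unfolding x_def using v by (intro root_ratio[OF reg _ _ \<kappa> \<open>exp s \<ge> 1\<close>]) (auto simp: Tr_def)
    moreover have "Z_minus \<kappa> (exp s) V E v = Z_ising \<kappa> (exp s) V E - Z_plus \<kappa> (exp s) V E v"
      using Z_plus_minus[of \<kappa> "exp s" V E v] by linarith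
    ultimately have "x * (Z_ising \<kappa> (exp s) V E - Z_plus \<kappa> (exp s) V E v) \<le> Z_plus \<kappa> (exp s) V E v"
      by simp
    then show "x / (1 + x) \<le> Z_plus \<kappa> (exp s) V E v / Z_ising \<kappa> (exp s) V E"
      using x Z by (simp add: field_simps)
  qed
  also have "\<dots> \<le> (\<Sum>v\<in>V. Z_plus \<kappa> (exp s) V E v / Z_ising \<kappa> (exp s) V E)"
    using fin Z \<kappa> by (intro sum_mono2) (auto simp: Tr_def intro!: divide_nonneg_pos Z_plus_nonneg)
  finally show ?thesis by (simp add: bethe_density_def x_def)
qed

lemma ln_Z_ising_upper:
  assumes V: "finite V" and \<kappa>: "0 < \<kappa>" "\<kappa> \<le> 1"
  shows "ln (Z_ising \<kappa> (exp s) V E) \<le> card V * ln (1 + exp s)"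
proof -
  have Z: "Z_ising \<kappa> (exp s) V E > 0" using V \<kappa> by (auto intro: Z_ising_pos)
  have "Z_ising \<kappa> (exp s) V E \<le> (\<Sum>T\<in>Pow V. (\<Prod>v\<in>T. 1) * (\<Prod>v\<in>V - T. exp s))"
    unfolding Z_ising_def ising_weight_def
  proof (rule sum_mono)
    fix T assume "T \<in> Pow V"
    then have "V \<inter> - {v. v \<in> T} = V - T" "T \<subseteq> V" by auto
    then have "(\<Prod>v\<in>V. if v \<in> T then 1 else exp s) = (\<Prod>v\<in>T. 1) * (\<Prod>v\<in>V - T. exp s)"
      using V by (simp add: prod.If_cases)
    moreover have "(\<Prod>e\<in>E. if e \<subseteq> T \<or> e \<inter> T = {} then 1 else \<kappa>) \<le> 1"
      using \<kappa> by (intro prod_le_1) auto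
    ultimately show "(\<Prod>v\<in>V. if v \<in> T then 1 else exp s) * (\<Prod>e\<in>E. if e \<subseteq> T \<or> e \<inter> T = {} then 1 else \<kappa>)
        \<le> (\<Prod>v\<in>T. 1) * (\<Prod>v\<in>V - T. exp s)"
      using mult_left_le[of "\<Prod>e\<in>E. if e \<subseteq> T \<or> e \<inter> T = {} then 1 else \<kappa>" "(\<Prod>v\<in>T. 1) * (\<Prod>v\<in>V - T. exp s)"]
      by simp
  qed
  also have "\<dots> = (1 + exp s) ^ card V" by (subst prod_add[OF V, symmetric]) simp
  finally have "ln (Z_ising \<kappa> (exp s) V E) \<le> ln ((1 + exp s) ^ card V)" using Z by (subst ln_le_cancel_iff) (auto simp: add_pos_pos)
  then show ?thesis by (simp add: ln_realpow add_pos_pos)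
qed

lemma ln_Z_ising_lower:
  assumes reg: "regular_graph d V E" and d: "d \<ge> 1" and \<kappa>: "0 < \<kappa>" "\<kappa> \<le> 1" and s: "s \<ge> 0"
  shows "card V * bethe_max d \<kappa> s \<le> ln (Z_ising \<kappa> (exp s) V E)"
proof -
  have fin: "finite V" using reg by (simp add: regular_graph_def simple_graph_def)
  let ?R = "top_root d \<kappa> s"
  have R: "?R > 0" "field_at d \<kappa> ?R = s" using top_root[OF \<kappa> s, of d] by (auto simp: is_top_root_def)
  note vp = vertex_sum_pos[OF R(1) \<kappa>(1), of s d] and ep = edge_sum_pos[OF R(1) \<kappa>(1)]
  let ?b = "(exp s * (?R + \<kappa>) ^ d + (\<kappa> * ?R + 1) ^ d) / sqrt (?R\<^sup>2 + 2 * \<kappa> * ?R + 1) ^ d"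
  have b: "?b > 0" using vp ep by simp
  have "?b ^ card V \<le> Z_ising \<kappa> (exp s) V E"
    using field_at_eq_iff[of ?R \<kappa> "exp s" d] R \<kappa> by (intro Z_ising_ge[OF reg d \<kappa>]) auto
  then have "ln (?b ^ card V) \<le> ln (Z_ising \<kappa> (exp s) V E)"
    using b by (subst ln_le_cancel_iff) (auto intro: less_le_trans[OF zero_less_power])
  moreover have "ln ?b = bethe_max d \<kappa> s"
    using vp ep unfolding bethe_max_def bethe_def by (simp add: ln_div ln_realpow ln_sqrt)
  ultimately show ?thesis using b by (simp add: ln_realpow)
qed

section \<open>Events of asymptotically full probability\<close>

definition whp :: "(nat \<Rightarrow> 'a pmf) \<Rightarrow> (nat \<Rightarrow> 'a \<Rightarrow> bool) \<Rightarrow> bool" where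
  "whp G A \<longleftrightarrow> (\<lambda>k. measure_pmf.prob (G k) {x. \<not> A k x}) \<longlonglongrightarrow> 0"

lemma whp_mono:
  assumes "whp G A" and "\<forall>\<^sub>F k in sequentially. \<forall>x\<in>set_pmf (G k). A k x \<longrightarrow> A' k x"
  shows "whp G A'"
  unfolding whp_def
proof (rule tendsto_sandwich[OF _ _ tendsto_const assms(1)[unfolded whp_def]])
  show "\<forall>\<^sub>F k in sequentially. measure_pmf.prob (G k) {x. \<not> A' k x} \<le> measure_pmf.prob (G k) {x. \<not> A k x}"
    using assms(2)
  proof eventually_elim
    case (elim k)
    have "measure_pmf.prob (G k) {x. \<not> A' k x} = measure_pmf.prob (G k) ({x. \<not> A' k x} \<inter> set_pmf (G k))"
      by (rule measure_Int_set_pmf[symmetric])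
    also have "\<dots> \<le> measure_pmf.prob (G k) {x. \<not> A k x}"
      using elim by (intro measure_pmf.finite_measure_mono) auto
    finally show ?case .
  qed
qed simp

lemma whp_conj:
  assumes "whp G A" "whp G A'" shows "whp G (\<lambda>k x. A k x \<and> A' k x)"
  unfolding whp_def
proof (rule tendsto_sandwich[OF _ _ tendsto_const])
  show "(\<lambda>k. measure_pmf.prob (G k) {x. \<not> A k x} + measure_pmf.prob (G k) {x. \<not> A' k x}) \<longlonglongrightarrow> 0"
    using tendsto_add[OF assms[unfolded whp_def]] by simp
  show "\<forall>\<^sub>F k in sequentially. measure_pmf.prob (G k) {x. \<not> (A k x \<and> A' k x)}
      \<le> measure_pmf.prob (G k) {x. \<not> A k x} + measure_pmf.prob (G k) {x. \<not> A' k x}"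
  proof (intro always_eventually allI)
    fix k
    have "{x. \<not> (A k x \<and> A' k x)} = {x. \<not> A k x} \<union> {x. \<not> A' k x}" by auto
    then show "measure_pmf.prob (G k) {x. \<not> (A k x \<and> A' k x)}
      \<le> measure_pmf.prob (G k) {x. \<not> A k x} + measure_pmf.prob (G k) {x. \<not> A' k x}"
      using measure_Un_le[of "{x. \<not> A k x}" "measure_pmf (G k)" "{x. \<not> A' k x}"] by simp
  qed
qed simp

lemma whp_const: "whp G (\<lambda>k x. P) \<Longrightarrow> P"
  unfolding whp_def by (cases P) (auto simp: LIMSEQ_const_iff)

lemma tendsto_in_prob_whp: "tendsto_in_prob G X c \<Longrightarrow> \<epsilon> > 0 \<Longrightarrow> whp G (\<lambda>k x. \<bar>X k x - c\<bar> \<le> \<epsilon>)"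
  unfolding tendsto_in_prob_def whp_def by (simp add: not_le)

lemma whp_tendsto_in_prob: "(\<And>\<epsilon>. \<epsilon> > 0 \<Longrightarrow> whp G (\<lambda>k x. \<bar>X k x - c\<bar> \<le> \<epsilon>)) \<Longrightarrow> tendsto_in_prob G X c"
  unfolding tendsto_in_prob_def whp_def by (simp add: not_le)

text \<open>Three events with slack \<open>e / 3\<close> together give \<open>x \<le> y + e\<close>,
  which no longer mentions the graph; a fixed statement whose failure probability tends to 0 is
  true.\<close>

lemma tendsto_in_prob_le:
  assumes X: "tendsto_in_prob G X x" and Y: "tendsto_in_prob G Y y"
    and le: "\<And>\<epsilon>. \<epsilon> > 0 \<Longrightarrow> whp G (\<lambda>k E. X k E \<le> Y k E + \<epsilon>)"
  shows "x \<le> y"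
proof (rule field_le_epsilon)
  fix e :: real assume "e > 0"
  then have e: "e / 3 > 0" by simp
  have "whp G (\<lambda>k E. (\<bar>X k E - x\<bar> \<le> e / 3 \<and> \<bar>Y k E - y\<bar> \<le> e / 3) \<and> X k E \<le> Y k E + e / 3)"
    by (intro whp_conj tendsto_in_prob_whp[OF X e] tendsto_in_prob_whp[OF Y e] le[OF e])
  then have "whp G (\<lambda>k E. x \<le> y + e)" by (rule whp_mono) (intro always_eventually allI ballI impI, linarith)
  then show "x \<le> y + e" by (rule whp_const)
qed


section \<open>The pressure\<close>

lemma tendsto_in_prob_const: "tendsto_in_prob G (\<lambda>k x. c) c"
  by (simp add: tendsto_in_prob_def)

lemma tendsto_in_prob_add_const:
  "tendsto_in_prob G X x \<Longrightarrow> tendsto_in_prob G (\<lambda>k E. c + X k E) (c + x)"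
  by (simp add: tendsto_in_prob_def)

locale tree_like_sequence =
  fixes d :: nat and N :: "nat \<Rightarrow> nat" and G :: "nat \<Rightarrow> nat set set pmf"
  assumes d3: "d \<ge> 3"
    and N_top: "filterlim N at_top sequentially"
    and regular: "\<forall>k. \<forall>E\<in>set_pmf (G k). regular_graph d {..<N k} E"
    and tree_like: "locally_tree_like N G"
begin

lemma d1: "d \<ge> 1"
  using d3 by simp

lemma whp_graph:
  assumes "whp G A"
    and "\<And>k E. N k > 0 \<Longrightarrow> regular_graph d {..<N k} E \<Longrightarrow> A k E \<Longrightarrow> A' k E"
  shows "whp G A'"
proof (rule whp_mono[OF assms(1)])
  have "\<forall>\<^sub>F k in sequentially. N k > 0"
    using N_top[unfolded filterlim_at_top, rule_format, of 1] by (simp add: Suc_le_eq)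
  then show "\<forall>\<^sub>F k in sequentially. \<forall>E\<in>set_pmf (G k). A k E \<longrightarrow> A' k E"
    by eventually_elim (use assms(2) regular in blast)
qed

lemma whp_tree_proportion:
  assumes "\<delta> > 0" shows "whp G (\<lambda>k E. tree_proportion {..<N k} E r \<ge> 1 - \<delta>)"
proof (rule whp_graph)
  show "whp G (\<lambda>k E. \<bar>tree_proportion {..<N k} E r - 1\<bar> \<le> \<delta>)"
    using tree_like assms unfolding locally_tree_like_def by (intro tendsto_in_prob_whp) auto
qed auto

lemma whp_graph_always:
  assumes "\<And>k E. N k > 0 \<Longrightarrow> regular_graph d {..<N k} E \<Longrightarrow> A' k E"
  shows "whp G A'"
  by (rule whp_graph[of "\<lambda>k E. True"]) (use assms in \<open>auto simp: whp_def\<close>)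

section \<open>The Ising free energy along the graph sequence\<close>

definition free_energy :: "real \<Rightarrow> real \<Rightarrow> nat \<Rightarrow> nat set set \<Rightarrow> real" where
  "free_energy \<kappa> s k E = ln (Z_ising \<kappa> (exp s) {..<N k} E) / N k"

text \<open>The order of limits matters: the graphs grow at fixed depth \<open>j\<close>, where
  local tree-likeness gives the slope bound with \<open>tree_ratio\<close>, and only then does
  \<open>j\<close> tend to infinity.\<close>

lemma free_energy_slope:
  assumes \<kappa>: "0 < \<kappa>" "\<kappa> \<le> 1" and s: "0 < s" "s < s'"
    and x: "tendsto_in_prob G (free_energy \<kappa> s) x" and x': "tendsto_in_prob G (free_energy \<kappa> s') x'"
  shows "(s' - s) * bethe_density d \<kappa> s (top_root d \<kappa> s) \<le> x' - x"
proof -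
  have "(s' - s) * bethe_density d \<kappa> s (tree_ratio d \<kappa> (exp s) j) + x \<le> x'" for j
  proof (rule tendsto_in_prob_le[OF tendsto_in_prob_add_const[OF x] x'])
    let ?\<rho> = "bethe_density d \<kappa> s (tree_ratio d \<kappa> (exp s) j)"
    fix \<epsilon> :: real assume "\<epsilon> > 0"
    then have \<delta>: "\<epsilon> / (s' - s) > 0" using s by simp
    show "whp G (\<lambda>k E. (s' - s) * ?\<rho> + free_energy \<kappa> s k E \<le> free_energy \<kappa> s' k E + \<epsilon>)"
    proof (rule whp_graph[OF whp_tree_proportion[OF \<delta>, of "Suc j"]])
      fix k E assume N: "N k > 0" and reg: "regular_graph d {..<N k} E"
        and tp: "tree_proportion {..<N k} E (Suc j) \<ge> 1 - \<epsilon> / (s' - s)"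
      have "{..<N k} \<noteq> {}" using N by auto
      have r1: "tree_ratio d \<kappa> (exp s) j \<ge> 1" using s by (intro tree_ratio_ge_1 \<kappa>) simp
      then have \<rho>: "0 \<le> ?\<rho>" "?\<rho> \<le> 1" using bethe_density_bounds[of "tree_ratio d \<kappa> (exp s) j" \<kappa> d s] \<kappa> by auto
      have "(1 - \<epsilon> / (s' - s)) * ?\<rho> \<le> tree_proportion {..<N k} E (Suc j) * ?\<rho>"
        using tp \<rho> by (intro mult_right_mono) auto
      moreover have "\<epsilon> / (s' - s) * ?\<rho> \<le> \<epsilon> / (s' - s)" using \<delta> \<rho> by (intro mult_left_le) auto
      ultimately have "?\<rho> - \<epsilon> / (s' - s) \<le> tree_proportion {..<N k} E (Suc j) * ?\<rho>" by (simp add: algebra_simps)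
      then have "(s' - s) * (?\<rho> - \<epsilon> / (s' - s)) \<le> (s' - s) * (tree_proportion {..<N k} E (Suc j) * ?\<rho>)"
        using s by (intro mult_left_mono) auto
      then have "(s' - s) * ?\<rho> - \<epsilon> \<le> (s' - s) * (tree_proportion {..<N k} E (Suc j) * ?\<rho>)"
        using s by (simp add: right_diff_distrib)
      then have "N k * ((s' - s) * ?\<rho> - \<epsilon>) \<le> N k * ((s' - s) * (tree_proportion {..<N k} E (Suc j) * ?\<rho>))"
        by (intro mult_left_mono) auto
      also have "\<dots> = (s' - s) * (card {..<N k} * tree_proportion {..<N k} E (Suc j) * ?\<rho>)" by simp
      also have "\<dots> \<le> (s' - s) * (\<Sum>v<N k. Z_plus \<kappa> (exp s) {..<N k} E v / Z_ising \<kappa> (exp s) {..<N k} E)"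
        using s \<open>{..<N k} \<noteq> {}\<close> by (intro mult_left_mono density_lower_bound[OF reg _ \<kappa>]) auto
      also have "\<dots> \<le> ln (Z_ising \<kappa> (exp s') {..<N k} E) - ln (Z_ising \<kappa> (exp s) {..<N k} E)"
        by (rule ln_Z_ising_increment) (use \<kappa> in auto)
      also have "\<dots> = N k * (free_energy \<kappa> s' k E - free_energy \<kappa> s k E)"
        using N by (simp add: free_energy_def field_simps)
      finally have "(s' - s) * ?\<rho> - \<epsilon> \<le> free_energy \<kappa> s' k E - free_energy \<kappa> s k E"
        using N by simp
      then show "(s' - s) * ?\<rho> + free_energy \<kappa> s k E \<le> free_energy \<kappa> s' k E + \<epsilon>" by simp
    qed
  qed
  then have le: "(s' - s) * bethe_density d \<kappa> s (tree_ratio d \<kappa> (exp s) j) \<le> x' - x" for j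
    by (simp add: le_diff_eq)
  have "top_root d \<kappa> s \<ge> 1" using top_root[OF \<kappa>, of s d] s by (simp add: is_top_root_def)
  then have p: "\<kappa> * top_root d \<kappa> s + 1 > 0" "msg \<kappa> (top_root d \<kappa> s) \<ge> 1"
    using \<kappa> msg_ge_1[OF \<kappa>] by (simp_all add: add_pos_pos)
  then have "1 + exp s * msg \<kappa> (top_root d \<kappa> s) ^ d > 0" by (intro add_pos_pos mult_pos_pos zero_less_power) auto
  then have "(\<lambda>j. (s' - s) * bethe_density d \<kappa> s (tree_ratio d \<kappa> (exp s) j))
      \<longlonglongrightarrow> (s' - s) * bethe_density d \<kappa> s (top_root d \<kappa> s)"
    unfolding bethe_density_def using p(1) unfolding msg_def
    by (intro tendsto_intros tree_ratio_tendsto \<kappa> s) auto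
  then show ?thesis by (rule LIMSEQ_le_const2) (use le in auto)
qed

lemma free_energy_lipschitz:
  assumes \<kappa>: "0 < \<kappa>" "\<kappa> \<le> 1" and s: "s \<le> s'"
    and x: "tendsto_in_prob G (free_energy \<kappa> s) x" and x': "tendsto_in_prob G (free_energy \<kappa> s') x'"
  shows "x \<le> x'" "x' \<le> (s' - s) + x"
proof -
  show "x \<le> x'"
  proof (rule tendsto_in_prob_le[OF x x'], rule whp_graph_always)
    fix \<epsilon> :: real and k E assume "\<epsilon> > 0" "N k > 0"
    then show "free_energy \<kappa> s k E \<le> free_energy \<kappa> s' k E + \<epsilon>"
      unfolding free_energy_def
      using ln_Z_ising_lipschitz(1)[of "{..<N k}" \<kappa> s s' E] \<kappa> s divide_right_mono[of _ _ "real (N k)"]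
      by (smt (verit) finite_lessThan of_nat_0_le_iff)
  qed
  show "x' \<le> (s' - s) + x"
  proof (rule tendsto_in_prob_le[OF x' tendsto_in_prob_add_const[OF x]], rule whp_graph_always)
    fix \<epsilon> :: real and k E assume "\<epsilon> > 0" "N k > 0"
    have "ln (Z_ising \<kappa> (exp s') {..<N k} E) / N k \<le> (ln (Z_ising \<kappa> (exp s) {..<N k} E) + (s' - s) * N k) / N k"
      using ln_Z_ising_lipschitz(2)[of "{..<N k}" \<kappa> s s' E] \<kappa> s by (intro divide_right_mono) auto
    then show "free_energy \<kappa> s' k E \<le> (s' - s) + free_energy \<kappa> s k E + \<epsilon>"
      unfolding free_energy_def using \<open>N k > 0\<close> \<open>\<epsilon> > 0\<close> by (simp add: add_divide_distrib)
  qed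
qed

lemma free_energy_bounds:
  assumes \<kappa>: "0 < \<kappa>" "\<kappa> \<le> 1" and x: "tendsto_in_prob G (free_energy \<kappa> s) x"
  shows "x \<le> ln (1 + exp s)" and "s \<ge> 0 \<Longrightarrow> bethe_max d \<kappa> s \<le> x"
proof -
  show "x \<le> ln (1 + exp s)"
  proof (rule tendsto_in_prob_le[OF x tendsto_in_prob_const], rule whp_graph_always)
    fix \<epsilon> :: real and k E assume "\<epsilon> > 0" "N k > 0"
    then have "free_energy \<kappa> s k E \<le> ln (1 + exp s)"
      using ln_Z_ising_upper[of "{..<N k}" \<kappa> s E] \<kappa> unfolding free_energy_def
      by (simp add: divide_le_eq mult.commute)
    then show "free_energy \<kappa> s k E \<le> ln (1 + exp s) + \<epsilon>" using \<open>\<epsilon> > 0\<close> by simp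
  qed
  assume s: "s \<ge> 0"
  show "bethe_max d \<kappa> s \<le> x"
  proof (rule tendsto_in_prob_le[OF tendsto_in_prob_const x], rule whp_graph_always)
    fix \<epsilon> :: real and k E assume a: "\<epsilon> > 0" "N k > 0" "regular_graph d {..<N k} E"
    have "bethe_max d \<kappa> s \<le> free_energy \<kappa> s k E"
      using ln_Z_ising_lower[OF a(3) d1 \<kappa> s] a(2) unfolding free_energy_def by (simp add: le_divide_eq mult.commute)
    then show "bethe_max d \<kappa> s \<le> free_energy \<kappa> s k E + \<epsilon>" using a by simp
  qed
qed

text \<open>The slope of \<open>\<psi>\<close> dominates that of \<open>bethe_max\<close>, so the
  gap between them at \<open>a\<close> is at most the gap at any larger field, and the latter
  vanishes at infinity.\<close>

theorem ising_pressure_pos: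
  assumes \<kappa>: "0 < \<kappa>" "\<kappa> \<le> 1" and a: "a > 0"
    and \<psi>: "\<And>s. a \<le> s \<Longrightarrow> tendsto_in_prob G (free_energy \<kappa> s) (\<psi> s)"
  shows "\<psi> a = bethe_max d \<kappa> a"
proof (rule antisym)
  show "bethe_max d \<kappa> a \<le> \<psi> a" using free_energy_bounds(2)[OF \<kappa> \<psi>] a by simp
  \<comment> \<open>The 1 comes from \<open>ln (1 + exp s) \<le> s + exp (- s)\<close>, the
    \<open>d / 2\<close> from \<open>bethe_max_lower\<close>.\<close>
  have "\<psi> a - bethe_max d \<kappa> a \<le> (1 + d / 2) * exp (- s)" if s: "a < s" for s
  proof -
    have "\<psi> a - bethe_max d \<kappa> a \<le> \<psi> s - bethe_max d \<kappa> s"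
    proof (rule increment_comparison[where \<rho> = "\<lambda>s. bethe_density d \<kappa> s (top_root d \<kappa> s)", OF _ _ _ s])
      fix s s' assume ss: "a \<le> s" "s < s'"
      show "(s' - s) * bethe_density d \<kappa> s (top_root d \<kappa> s) \<le> \<psi> s' - \<psi> s"
        using ss a by (intro free_energy_slope[OF \<kappa>] \<psi>) auto
      show "bethe_max d \<kappa> s' - bethe_max d \<kappa> s \<le> (s' - s) * bethe_density d \<kappa> s' (top_root d \<kappa> s')"
        using ss a by (intro bethe_max_increment \<kappa> d1) auto
    next
      fix s assume "a \<le> s"
      then have "top_root d \<kappa> s > 0" using top_root[OF \<kappa>, of s d] a by (simp add: is_top_root_def)
      then show "0 \<le> bethe_density d \<kappa> s (top_root d \<kappa> s) \<and> bethe_density d \<kappa> s (top_root d \<kappa> s) \<le> 1"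
        using bethe_density_bounds \<kappa> by blast
    qed
    moreover have "\<psi> s \<le> ln (1 + exp s)" using s by (intro free_energy_bounds(1)[OF \<kappa> \<psi>]) auto
    moreover have "ln (1 + exp s) \<le> s + exp (- s)"
    proof -
      have "1 + exp s = exp s * (1 + exp (- s))" by (simp add: distrib_left flip: exp_add)
      moreover have "1 + exp (- s) > 0" by (simp add: add_pos_pos)
      ultimately have "ln (1 + exp s) = s + ln (1 + exp (- s))" by (simp add: ln_mult)
      then show ?thesis using ln_add_one_self_le_self[of "exp (- s)"] by simp
    qed
    moreover have "s - d / 2 * exp (- s) \<le> bethe_max d \<kappa> s" using s a by (intro bethe_max_lower \<kappa> d1) auto
    ultimately show ?thesis by (simp add: algebra_simps)
  qed
  then have "\<forall>\<^sub>F s in at_top. \<psi> a - bethe_max d \<kappa> a \<le> (1 + d / 2) * exp (- s)"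
    by (auto intro: eventually_mono[OF eventually_gt_at_top[of a]])
  moreover have "((\<lambda>s. (1 + d / 2) * exp (- s)) \<longlongrightarrow> 0) at_top" by real_asymp
  ultimately have "\<psi> a - bethe_max d \<kappa> a \<le> 0" by (intro tendsto_lowerbound[of _ 0 at_top]) auto
  then show "\<psi> a \<le> bethe_max d \<kappa> a" by simp
qed

text \<open>At zero field both sides are limits from positive fields: each is nondecreasing and
  1-Lipschitz on the right of 0.\<close>

theorem ising_pressure:
  assumes \<kappa>: "0 < \<kappa>" "\<kappa> \<le> 1" and a: "a \<ge> 0"
    and \<psi>: "\<And>s. a \<le> s \<Longrightarrow> tendsto_in_prob G (free_energy \<kappa> s) (\<psi> s)"
  shows "\<psi> a = bethe_max d \<kappa> a"
proof (cases "a = 0")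
  case True
  have pos: "\<psi> s = bethe_max d \<kappa> s" if "s > 0" for s
    using that True by (intro ising_pressure_pos[OF \<kappa>] \<psi>) auto
  have \<psi>0: "\<psi> 0 \<le> \<psi> s" "\<psi> s \<le> s + \<psi> 0" if "s > 0" for s
    using free_energy_lipschitz[OF \<kappa>, of 0 s "\<psi> 0" "\<psi> s"] \<psi> True that by auto
  have P0: "bethe_max d \<kappa> 0 \<le> bethe_max d \<kappa> s" "bethe_max d \<kappa> s \<le> bethe_max d \<kappa> 0 + s" if "s > 0" for s
  proof -
    have "top_root d \<kappa> s > 0" using top_root[OF \<kappa>, of s d] that by (simp add: is_top_root_def)
    then have "s * bethe_density d \<kappa> s (top_root d \<kappa> s) \<le> s"
      using bethe_density_bounds(2)[of "top_root d \<kappa> s" \<kappa> d s] that \<kappa> by (intro mult_left_le) auto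
    moreover have "bethe_max d \<kappa> s - bethe_max d \<kappa> 0 \<le> s * bethe_density d \<kappa> s (top_root d \<kappa> s)"
      using bethe_max_increment(1)[OF \<kappa> order_refl less_imp_le[OF that] d1] by simp
    ultimately show "bethe_max d \<kappa> s \<le> bethe_max d \<kappa> 0 + s" by linarith
    show "bethe_max d \<kappa> 0 \<le> bethe_max d \<kappa> s"
      by (rule bethe_max_increment(2)[OF \<kappa> order_refl less_imp_le[OF that] d1])
  qed
  have "\<psi> 0 = bethe_max d \<kappa> 0"
  proof (rule antisym; rule field_le_epsilon)
    fix e :: real assume "e > 0"
    then show "\<psi> 0 \<le> bethe_max d \<kappa> 0 + e" "bethe_max d \<kappa> 0 \<le> \<psi> 0 + e"
      using pos[of e] \<psi>0[of e] P0[of e] by auto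
  qed
  then show ?thesis using True by simp
next
  case False
  then show ?thesis using a by (intro ising_pressure_pos[OF \<kappa>] \<psi>) auto
qed

lemma free_energy_flip:
  assumes \<kappa>: "0 < \<kappa>" "\<kappa> \<le> 1"
    and x: "tendsto_in_prob G (free_energy \<kappa> s) x" and x': "tendsto_in_prob G (free_energy \<kappa> (- s)) x'"
  shows "x = s + x'"
proof -
  have eq: "free_energy \<kappa> s k E = s + free_energy \<kappa> (- s) k E"
    if N: "N k > 0" and reg: "regular_graph d {..<N k} E" for k E
  proof -
    have "Z_ising \<kappa> (exp s) {..<N k} E = exp s ^ card {..<N k} * Z_ising \<kappa> (1 / exp s) {..<N k} E"
      using reg by (intro Z_ising_flip) (auto simp: regular_graph_def simple_graph_def)
    moreover have "1 / exp s = exp (- s)" by (simp add: exp_minus divide_inverse)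
    moreover have "Z_ising \<kappa> (exp (- s)) {..<N k} E > 0" using \<kappa> by (intro Z_ising_pos) auto
    ultimately have "ln (Z_ising \<kappa> (exp s) {..<N k} E) = N k * s + ln (Z_ising \<kappa> (exp (- s)) {..<N k} E)"
      by (simp add: ln_mult ln_realpow)
    then show ?thesis using N by (simp add: free_energy_def add_divide_distrib)
  qed
  show ?thesis
    by (rule antisym; rule tendsto_in_prob_le[OF x tendsto_in_prob_add_const[OF x']]
        tendsto_in_prob_le[OF tendsto_in_prob_add_const[OF x'] x]; rule whp_graph_always)
      (use eq in auto)
qed

end

text \<open>The Ising parameters \<open>\<kappa> = exp (- 2 \<beta>\<^sup>*)\<close> and \<open>ln \<mu> = 2 B\<^sup>*\<close> of the rank two approximation.\<close>

definition rc_coupling :: "real \<Rightarrow> real \<Rightarrow> real" where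
  "rc_coupling q w = 1 / (sqrt (1 + w) * sqrt (1 + w / (q - 1)))"

definition rc_field :: "real \<Rightarrow> nat \<Rightarrow> real \<Rightarrow> real \<Rightarrow> real" where
  "rc_field q d w B = d / 2 * (ln (1 + w) - ln (1 + w / (q - 1))) - ln (q - 1) + B"

section \<open>Transfer to the random cluster model\<close>

lemma rc_coupling_bounds:
  assumes "q > 2" "w \<ge> 0" shows "0 < rc_coupling q w" "rc_coupling q w \<le> 1"
proof -
  have "sqrt (1 + w) \<ge> 1" "sqrt (1 + w / (q - 1)) \<ge> 1" using assms by simp_all
  then have "sqrt (1 + w) * sqrt (1 + w / (q - 1)) \<ge> 1 * 1" by (intro mult_mono) auto
  then show "0 < rc_coupling q w" "rc_coupling q w \<le> 1" by (simp_all add: rc_coupling_def)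
qed

lemma exp_half_ln: "x > 0 \<Longrightarrow> exp (real n / 2 * ln x) = sqrt x ^ n"
proof -
  assume x: "x > 0"
  have "exp (real n / 2 * ln x) = exp (real n * ln (sqrt x))" using x by (simp add: ln_sqrt)
  also have "\<dots> = exp (ln (sqrt x)) ^ n" by (rule exp_of_nat_mult)
  finally show ?thesis using x by (simp only: exp_ln real_sqrt_gt_zero)
qed

context tree_like_sequence
begin

lemma rc_to_ising:
  assumes q: "q > 2" and w: "w \<ge> 0" and B: "B \<ge> 0"
    and \<phi>: "tendsto_in_prob G (\<lambda>k E. ln (Z_rc {..<N k} E q w B) / real (N k)) x"
  shows "tendsto_in_prob G (free_energy (rc_coupling q w) (rc_field q d w B))
    (x - (d / 2 * ln (1 + w / (q - 1)) + ln (q - 1) - B))"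
proof (rule whp_tendsto_in_prob)
  define b where "b = d / 2 * ln (1 + w / (q - 1)) + ln (q - 1) - B"
  fix \<epsilon> :: real assume \<epsilon>: "\<epsilon> > 0"
  have lq: "ln q > 0" using q by simp
  \<comment> \<open>The comparison error per vertex is \<open>(1 / L + (1 - ?t)) * ln q\<close>;
    \<open>L\<close> and \<open>\<delta>\<close> give each of its parts one third of
    \<open>\<epsilon>\<close>, the last third going to the convergence of the pressure.\<close>
  obtain L :: nat where L: "3 * ln q / \<epsilon> < real L" using reals_Archimedean2 by blast
  moreover have "3 * ln q / \<epsilon> > 0" using lq \<epsilon> by simp
  ultimately have L0: "L > 0" by (cases L) auto
  then have L1: "ln q * (1 / L) \<le> \<epsilon> / 3" using L \<epsilon> by (simp add: field_simps)
  have \<delta>: "\<epsilon> / (3 * ln q) > 0" using \<epsilon> lq by simp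
  have \<epsilon>3: "\<epsilon> / 3 > 0" using \<epsilon> by simp
  show "whp G (\<lambda>k E. \<bar>free_energy (rc_coupling q w) (rc_field q d w B) k E - (x - b)\<bar> \<le> \<epsilon>)"
  proof (rule whp_graph[OF whp_conj[OF tendsto_in_prob_whp[OF \<phi> \<epsilon>3] whp_tree_proportion[OF \<delta>, of L]]])
    fix k E
    assume N: "N k > 0" and reg: "regular_graph d {..<N k} E"
      and a: "\<bar>ln (Z_rc {..<N k} E q w B) / real (N k) - x\<bar> \<le> \<epsilon> / 3 \<and>
        tree_proportion {..<N k} E L \<ge> 1 - \<epsilon> / (3 * ln q)"
    have E: "\<forall>e\<in>E. e \<subseteq> {..<N k} \<and> card e = 2" using reg by (auto simp: regular_graph_def simple_graph_def)
    let ?Z = "Z_two (1 + w) (1 + w / (q - 1)) ((q - 1) * exp (- B)) {..<N k} E"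
    let ?t = "tree_proportion {..<N k} E L"
    have c: "1 + w / (q - 1) > 0" "1 + w > 0" using q w by (auto simp: add_pos_nonneg)
    have Zpos: "?Z > 0" using q c by (intro Z_two_pos) auto
    have bounds: "?Z \<le> Z_rc {..<N k} E q w B" "Z_rc {..<N k} E q w B \<le> q powr (N k * (1 / L + (1 - ?t))) * ?Z"
      using Z_rc_bounds[of "{..<N k}" E L q w B] E N L0 q w B by (auto simp: lessThan_empty_iff)
    have qB: "(q - 1) * exp (- B) = exp (ln (q - 1) - B)" using q by (simp add: exp_diff exp_minus divide_inverse)
    have "sqrt (1 + w) ^ d / (sqrt (1 + w / (q - 1)) ^ d * ((q - 1) * exp (- B))) =
        exp (d / 2 * ln (1 + w) - (d / 2 * ln (1 + w / (q - 1)) + (ln (q - 1) - B)))"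
      unfolding qB exp_half_ln[OF c(1), symmetric] exp_half_ln[OF c(2), symmetric] by (simp only: exp_diff exp_add)
    also have "d / 2 * ln (1 + w) - (d / 2 * ln (1 + w / (q - 1)) + (ln (q - 1) - B)) = rc_field q d w B"
      by (simp add: rc_field_def right_diff_distrib)
    finally have "sqrt (1 + w) ^ d / (sqrt (1 + w / (q - 1)) ^ d * ((q - 1) * exp (- B))) = exp (rc_field q d w B)" .
    then have "?Z = (sqrt (1 + w / (q - 1)) ^ d * ((q - 1) * exp (- B))) ^ N k *
        Z_ising (rc_coupling q w) (exp (rc_field q d w B)) {..<N k} E"
      using Z_two_eq_ising[OF reg c(2,1), of "(q - 1) * exp (- B)"] q by (simp add: rc_coupling_def)
    moreover have "sqrt (1 + w / (q - 1)) ^ d * ((q - 1) * exp (- B)) = exp b"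
      unfolding qB b_def exp_half_ln[OF c(1), symmetric] exp_add[symmetric] by simp
    moreover have "Z_ising (rc_coupling q w) (exp (rc_field q d w B)) {..<N k} E > 0"
      using rc_coupling_bounds[OF q w] by (intro Z_ising_pos) auto
    ultimately have lnZ: "ln ?Z / N k = b + free_energy (rc_coupling q w) (rc_field q d w B) k E"
      using N by (simp add: ln_mult ln_realpow free_energy_def add_divide_distrib)
    have "ln ?Z / N k \<le> ln (Z_rc {..<N k} E q w B) / N k"
      using bounds Zpos by (intro divide_right_mono) (auto simp: ln_le_cancel_iff)
    moreover have "ln (Z_rc {..<N k} E q w B) \<le> ln (q powr (N k * (1 / L + (1 - ?t))) * ?Z)"
      using bounds Zpos q by (subst ln_le_cancel_iff) auto
    then have "ln (Z_rc {..<N k} E q w B) / N k \<le> (N k * (1 / L + (1 - ?t)) * ln q + ln ?Z) / N k"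
      using Zpos q by (intro divide_right_mono) (simp_all add: ln_mult ln_powr)
    then have "ln (Z_rc {..<N k} E q w B) / N k \<le> (1 / L + (1 - ?t)) * ln q + ln ?Z / N k"
      using N by (simp add: add_divide_distrib)
    moreover have "(1 - ?t) * ln q \<le> \<epsilon> / (3 * ln q) * ln q" using a lq by (intro mult_right_mono) auto
    then have "(1 - ?t) * ln q \<le> \<epsilon> / 3" using lq by simp
    then have "(1 / L + (1 - ?t)) * ln q \<le> \<epsilon> / 3 + \<epsilon> / 3" using L1 by (simp add: algebra_simps)
    ultimately show "\<bar>free_energy (rc_coupling q w) (rc_field q d w B) k E - (x - b)\<bar> \<le> \<epsilon>"
      using a unfolding lnZ by linarith
  qed
qed

theorem rc_pressure:
  assumes q: "q > 2" and \<phi>: "is_pressure N G q \<phi>" and w: "w \<ge> 0" and B: "B \<ge> 0"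
  defines "\<kappa> \<equiv> rc_coupling q w" and "s \<equiv> rc_field q d w B"
  shows "\<phi> w B = d / 2 * ln (1 + w / (q - 1)) + ln (q - 1) - B +
     (if s \<ge> 0 then bethe_max d \<kappa> s else s + bethe_max d \<kappa> (- s))"
proof -
  note \<kappa> = rc_coupling_bounds[OF q w, folded \<kappa>_def]
  define b where "b = d / 2 * ln (1 + w / (q - 1)) + ln (q - 1)"
  \<comment> \<open>\<open>t - s + B\<close> is the value of \<open>B\<close> at which the field
    equals \<open>t\<close>; it stays nonnegative for \<open>t \<ge> s\<close>. When
    \<open>s < 0\<close> this range still contains \<open>- s\<close>, where the flipped system is
    evaluated.\<close>
  define \<psi> where "\<psi> t = \<phi> w (t - s + B) - (b - (t - s + B))" for t
  have \<psi>: "tendsto_in_prob G (free_energy \<kappa> t) (\<psi> t)" if "t \<ge> s" for t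
  proof -
    have "t - s + B \<ge> 0" using that B by simp
    moreover have "rc_field q d w (t - s + B) = t" by (simp add: s_def rc_field_def)
    ultimately show ?thesis
      using rc_to_ising[OF q w, of "t - s + B" "\<phi> w (t - s + B)"] \<phi> w
      unfolding is_pressure_def \<kappa>_def \<psi>_def b_def by simp
  qed
  have \<psi>s: "\<psi> s = \<phi> w B - (b - B)" by (simp add: \<psi>_def)
  show ?thesis
  proof (cases "s \<ge> 0")
    case True
    then have "\<psi> s = bethe_max d \<kappa> s" by (intro ising_pressure[OF \<kappa>] \<psi>) auto
    then show ?thesis using True \<psi>s by (simp add: b_def)
  next
    case False
    have "\<psi> (- s) = bethe_max d \<kappa> (- s)" using False by (intro ising_pressure[OF \<kappa>] \<psi>) auto
    moreover have "\<psi> s = s + \<psi> (- s)" using False by (intro free_energy_flip[OF \<kappa>] \<psi>) auto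
    ultimately show ?thesis using False \<psi>s by (simp add: b_def)
  qed
qed

end


section \<open>Analytic tools\<close>

text \<open>The Newton map with frozen derivative \<open>x - F w x / c\<close> contracts by one
  half. Its iterates from \<open>x0\<close> are holomorphic in \<open>w\<close> and converge
  uniformly to the fixed point. Uniqueness in a fixed ball is the part that later identifies
  \<open>h\<close> with the real root.\<close>

lemma holomorphic_implicit_function:
  fixes F F' :: "complex \<Rightarrow> complex \<Rightarrow> complex"
  assumes zero: "F w0 x0 = 0"
    and deriv: "\<And>w x. (F w has_field_derivative F' w x) (at x)"
    and cont': "continuous (at (w0, x0)) (\<lambda>(w, x). F' w x)"
    and cont: "continuous (at w0) (\<lambda>w. F w x0)"
    and nz: "F' w0 x0 \<noteq> 0"
    and hol: "\<And>S h. open S \<Longrightarrow> h holomorphic_on S \<Longrightarrow> (\<lambda>w. F w (h w)) holomorphic_on S"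
  shows "\<exists>r>0. \<exists>\<rho>>0. \<exists>h. h holomorphic_on ball w0 r \<and>
    (\<forall>w\<in>ball w0 r. \<forall>x\<in>cball x0 \<rho>. F w x = 0 \<longrightarrow> x = h w)"
proof -
  define c where "c = F' w0 x0"
  have c: "norm c > 0" using nz by (simp add: c_def)
  obtain \<delta> where \<delta>: "\<delta> > 0" and close: "\<And>w x. dist (w, x) (w0, x0) < \<delta> \<Longrightarrow> norm (F' w x - c) < norm c / 2"
    using cont'[unfolded continuous_at_eps_delta, rule_format, of "norm c / 2"] c
    by (auto simp: c_def dist_norm)
  \<comment> \<open>Both radii are at most \<open>\<delta> / 3\<close>, so their sum stays below
    \<open>\<delta>\<close>.\<close>
  define \<rho> where "\<rho> = \<delta> / 3"
  have \<rho>: "\<rho> > 0" using \<delta> by (simp add: \<rho>_def)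
  \<comment> \<open>The bound moves \<open>x0\<close> by at most \<open>\<rho> / 2\<close> under the
    Newton map; contraction adds another \<open>\<rho> / 2\<close>, so the ball is mapped into
    itself.\<close>
  obtain r' where r': "r' > 0" and small: "\<And>w. dist w w0 < r' \<Longrightarrow> norm (F w x0) < \<rho> * norm c / 2"
    using cont[unfolded continuous_at_eps_delta, rule_format, of "\<rho> * norm c / 2"] c \<rho> zero
    by (auto simp: dist_norm)
  define r where "r = min r' (\<delta> / 3)"
  have r: "r > 0" using r' \<delta> by (simp add: r_def)
  define T where "T w x = x - F w x / c" for w x
  have contr: "dist (T w x) (T w y) \<le> 1 / 2 * dist x y"
    if "w \<in> ball w0 r" "x \<in> cball x0 \<rho>" "y \<in> cball x0 \<rho>" for w x y
  proof -
    have "norm (T w x - T w y) \<le> 1 / 2 * norm (x - y)"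
    proof (rule field_differentiable_bound[of "cball x0 \<rho>" "T w" "\<lambda>z. 1 - F' w z / c"])
      fix z assume z: "z \<in> cball x0 \<rho>"
      show "(T w has_field_derivative 1 - F' w z / c) (at z within cball x0 \<rho>)"
        unfolding T_def[abs_def] using deriv[of w z, THEN has_field_derivative_at_within] nz
        by (auto intro!: derivative_eq_intros simp: c_def)
      have "dist (w, z) (w0, x0) \<le> dist w w0 + dist z x0" unfolding dist_Pair_Pair by (rule sqrt_sum_squares_le_sum) auto
      also have "\<dots> < \<delta>" using that(1) z \<delta> by (auto simp: r_def \<rho>_def dist_commute)
      finally have "norm (F' w z - c) < norm c / 2" by (rule close)
      then have "norm ((c - F' w z) / c) \<le> 1 / 2" using c by (simp add: norm_divide norm_minus_commute field_simps)
      then show "norm (1 - F' w z / c) \<le> 1 / 2" using nz by (simp add: c_def diff_divide_distrib)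
    qed (use that in auto)
    then show ?thesis by (simp add: dist_norm)
  qed
  have maps: "T w ` cball x0 \<rho> \<subseteq> cball x0 \<rho>" if w: "w \<in> ball w0 r" for w
  proof
    fix y assume "y \<in> T w ` cball x0 \<rho>"
    then obtain x where x: "x \<in> cball x0 \<rho>" "y = T w x" by auto
    have "norm (F w x0) < \<rho> * norm c / 2" using w by (intro small) (auto simp: r_def dist_commute)
    then have "dist (T w x0) x0 \<le> \<rho> / 2" using c by (simp add: T_def dist_norm norm_divide field_simps)
    moreover have "dist (T w x) (T w x0) \<le> 1 / 2 * dist x x0" using \<rho> x by (intro contr w) auto
    moreover have "dist x x0 \<le> \<rho>" using x by (simp add: dist_commute)
    ultimately have "dist (T w x) x0 \<le> \<rho>" using dist_triangle[of "T w x" x0 "T w x0"] by linarith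
    then show "y \<in> cball x0 \<rho>" using x by (simp add: dist_commute)
  qed
  have "\<exists>!x\<in>cball x0 \<rho>. T w x = x" if w: "w \<in> ball w0 r" for w
    using \<rho> contr[OF w] maps[OF w] by (intro Banach_fix[where c = "1 / 2"]) (auto simp: complete_eq_closed)
  then obtain h where h: "\<And>w. w \<in> ball w0 r \<Longrightarrow> h w \<in> cball x0 \<rho> \<and> T w (h w) = h w"
    and uniq: "\<And>w x. w \<in> ball w0 r \<Longrightarrow> x \<in> cball x0 \<rho> \<Longrightarrow> T w x = x \<Longrightarrow> x = h w"
    by metis
  define H where "H n w = (T w ^^ n) x0" for n w
  have H_hol: "H n holomorphic_on ball w0 r" for n
  proof (induction n)
    case (Suc n)
    have "H (Suc n) = (\<lambda>w. H n w - F w (H n w) / c)" by (auto simp: H_def T_def)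
    then show ?case using Suc nz by (auto intro!: holomorphic_intros hol simp: c_def)
  qed (simp add: H_def)
  have H_mem: "H n w \<in> cball x0 \<rho>" if "w \<in> ball w0 r" for n w
  proof (induction n)
    case (Suc n)
    then have "T w (H n w) \<in> cball x0 \<rho>" using maps[OF that] by blast
    then show ?case by (simp add: H_def)
  qed (use \<rho> in \<open>simp add: H_def\<close>)
  have H_lim: "dist (H n w) (h w) \<le> \<rho> * (1 / 2) ^ n" if w: "w \<in> ball w0 r" for n w
  proof (induction n)
    case 0
    then show ?case using h[OF w] by (simp add: H_def)
  next
    case (Suc n)
    have "dist (H (Suc n) w) (h w) = dist (T w (H n w)) (T w (h w))" using h[OF w] by (simp add: H_def)
    also have "\<dots> \<le> 1 / 2 * dist (H n w) (h w)" using H_mem[OF w] h[OF w] by (intro contr w) auto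
    finally show ?case using Suc by simp
  qed
  have unif: "uniform_limit (ball w0 r) H h sequentially"
  proof (rule uniform_limitI)
    fix e :: real assume e: "e > 0"
    have "(\<lambda>n. \<rho> * (1 / 2) ^ n) \<longlonglongrightarrow> \<rho> * 0" by (intro tendsto_intros LIMSEQ_power_zero) simp
    then have "\<forall>\<^sub>F n in sequentially. \<rho> * (1 / 2) ^ n < e" using e by (intro order_tendstoD(2)) auto
    then show "\<forall>\<^sub>F n in sequentially. \<forall>w\<in>ball w0 r. dist (H n w) (h w) < e"
    proof eventually_elim
      case (elim n)
      then show ?case using H_lim[of _ n] le_less_trans by blast
    qed
  qed
  have "h holomorphic_on ball w0 r"
  proof (rule holomorphic_uniform_sequence[OF open_ball H_hol])
    fix x assume "x \<in> ball w0 r"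
    then obtain e where "e > 0" "cball x e \<subseteq> ball w0 r" using open_contains_cball[of "ball w0 r"] by blast
    then show "\<exists>d>0. cball x d \<subseteq> ball w0 r \<and> uniform_limit (cball x d) H h sequentially"
      using uniform_limit_on_subset[OF unif] by blast
  qed
  moreover have "x = h w" if "w \<in> ball w0 r" "x \<in> cball x0 \<rho>" "F w x = 0" for w x
    using uniq[OF that(1,2)] that(3) by (simp add: T_def)
  ultimately show ?thesis using r \<rho> by blast
qed

text \<open>For real \<open>x\<close> the powers of \<open>x - w\<close> are real, so the real parts
  of the Taylor coefficients serve as coefficients.\<close>

lemma analytic_at_nonneg_of_holomorphic:
  assumes hol: "\<Phi> holomorphic_on ball (of_real w) r" and r: "r > 0"
    and eq: "\<And>x. x \<ge> 0 \<Longrightarrow> \<bar>x - w\<bar> < r \<Longrightarrow> \<Phi> (of_real x) = of_real (f x)"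
  shows "analytic_at_nonneg f w"
  unfolding analytic_at_nonneg_def
proof (intro exI conjI allI impI)
  fix x assume x: "x \<ge> 0" "\<bar>x - w\<bar> < r"
  have "of_real x \<in> ball (of_real w :: complex) r" using x by (simp add: dist_norm norm_minus_commute flip: of_real_diff)
  from holomorphic_power_series[OF hol this]
  have "(\<lambda>n. (deriv ^^ n) \<Phi> (of_real w) / fact n * (of_real x - of_real w) ^ n) sums of_real (f x)"
    by (simp add: eq[OF x])
  then have "(\<lambda>n. Re ((deriv ^^ n) \<Phi> (of_real w) / fact n * (of_real x - of_real w) ^ n)) sums Re (of_real (f x))"
    by (rule sums_Re)
  moreover have "Re ((deriv ^^ n) \<Phi> (of_real w) / fact n * (of_real x - of_real w) ^ n) =
      Re ((deriv ^^ n) \<Phi> (of_real w) / fact n) * (x - w) ^ n" for n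
  proof -
    have "(of_real x - of_real w) ^ n = (of_real ((x - w) ^ n) :: complex)" by simp
    then show ?thesis by (simp only: times_complex.sel Re_complex_of_real Im_complex_of_real)
  qed
  ultimately show "(\<lambda>n. Re ((deriv ^^ n) \<Phi> (of_real w) / fact n) * (x - w) ^ n) sums f x" by simp
qed (rule r)

text \<open>The envelope theorem: bounding the increment of a maximum from both sides by increments at
  a fixed maximizer needs no differentiability of the maximizer.\<close>

lemma envelope_derivative:
  fixes \<Psi> \<Psi>' :: "real \<Rightarrow> real \<Rightarrow> real" and f X :: "real \<Rightarrow> real"
  assumes S: "is_interval S" "w0 \<in> S"
    and f: "\<And>w. w \<in> S \<Longrightarrow> f w = \<Psi> w (X w)" and pos: "\<And>w. w \<in> S \<Longrightarrow> X w > 0"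
    and max: "\<And>w x. w \<in> S \<Longrightarrow> x > 0 \<Longrightarrow> \<Psi> w x \<le> f w"
    and X: "(X \<longlongrightarrow> X w0) (at w0 within S)"
    and deriv: "\<And>w x. w \<in> S \<Longrightarrow> x > 0 \<Longrightarrow> ((\<lambda>w. \<Psi> w x) has_real_derivative \<Psi>' w x) (at w)"
    and cont: "continuous (at (w0, X w0)) (\<lambda>(w, x). \<Psi>' w x)"
  shows "(f has_real_derivative \<Psi>' w0 (X w0)) (at w0 within S)"
  unfolding has_field_derivative_iff
proof (rule tendstoI)
  fix e :: real assume e: "e > 0"
  let ?D = "\<Psi>' w0 (X w0)"
  obtain \<delta> where \<delta>: "\<delta> > 0"
    and close: "\<And>w x. dist (w, x) (w0, X w0) < \<delta> \<Longrightarrow> \<bar>\<Psi>' w x - ?D\<bar> < e"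
    using cont[unfolded continuous_at_eps_delta, rule_format, OF e] by (auto simp: dist_real_def)
  have mv: "\<exists>z. \<bar>z - w0\<bar> \<le> \<bar>w - w0\<bar> \<and> \<Psi> w x - \<Psi> w0 x = \<Psi>' z x * (w - w0)"
    if w: "w \<in> S" and x: "x > 0" for w x
  proof -
    have sub: "z \<in> S" if "min w w0 \<le> z" "z \<le> max w w0" for z
      using mem_is_interval_1_I[OF S(1), of "min w w0" "max w w0" z] S(2) w that by (simp add: min_def max_def)
    consider "w = w0" | "w < w0" | "w0 < w" by linarith
    then show ?thesis
    proof cases
      case 2
      obtain z where "w < z" "z < w0" "\<Psi> w0 x - \<Psi> w x = (w0 - w) * \<Psi>' z x"
        using MVT2[OF 2, of "\<lambda>w. \<Psi> w x" "\<lambda>z. \<Psi>' z x"] deriv[OF sub x] 2 by auto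
      then show ?thesis using 2 by (intro exI[of _ z]) (auto simp: algebra_simps)
    next
      case 3
      obtain z where "w0 < z" "z < w" "\<Psi> w x - \<Psi> w0 x = (w - w0) * \<Psi>' z x"
        using MVT2[OF 3, of "\<lambda>w. \<Psi> w x" "\<lambda>z. \<Psi>' z x"] deriv[OF sub x] 3 by auto
      then show ?thesis using 3 by (intro exI[of _ z]) (auto simp: algebra_simps)
    qed auto
  qed
  have "\<forall>\<^sub>F w in at w0 within S. dist (X w) (X w0) < \<delta> / 2" using X \<delta> by (intro tendstoD) auto
  moreover have "\<forall>\<^sub>F w in at w0 within S. dist w w0 < \<delta> / 2" using \<delta> by (intro tendstoD[OF tendsto_ident_at]) auto
  moreover have "\<forall>\<^sub>F w in at w0 within S. w \<in> S \<and> w \<noteq> w0" by (auto simp: eventually_at_filter)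
  ultimately show "\<forall>\<^sub>F w in at w0 within S. dist ((f w - f w0) / (w - w0)) ?D < e"
  proof eventually_elim
    case (elim w)
    have w: "w \<in> S" "w \<noteq> w0" using elim by auto
    have near: "\<bar>\<Psi>' z x - ?D\<bar> < e" if "\<bar>z - w0\<bar> \<le> \<bar>w - w0\<bar>" "dist x (X w0) < \<delta> / 2" for z x
    proof (rule close)
      have "dist (z, x) (w0, X w0) \<le> dist z w0 + dist x (X w0)"
        unfolding dist_Pair_Pair by (rule sqrt_sum_squares_le_sum) auto
      then show "dist (z, x) (w0, X w0) < \<delta>" using that elim by (simp add: dist_real_def)
    qed
    obtain z1 where z1: "\<bar>z1 - w0\<bar> \<le> \<bar>w - w0\<bar>" "\<Psi> w (X w0) - \<Psi> w0 (X w0) = \<Psi>' z1 (X w0) * (w - w0)"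
      using mv[OF w(1) pos[OF S(2)]] by blast
    obtain z2 where z2: "\<bar>z2 - w0\<bar> \<le> \<bar>w - w0\<bar>" "\<Psi> w (X w) - \<Psi> w0 (X w) = \<Psi>' z2 (X w) * (w - w0)"
      using mv[OF w(1) pos[OF w(1)]] by blast
    have lo: "\<Psi>' z1 (X w0) * (w - w0) \<le> f w - f w0"
      using max[OF w(1) pos[OF S(2)]] f[OF S(2)] z1(2) by simp
    have hi: "f w - f w0 \<le> \<Psi>' z2 (X w) * (w - w0)"
      using max[OF S(2) pos[OF w(1)]] f[OF w(1)] z2(2) by simp
    have n: "\<bar>\<Psi>' z1 (X w0) - ?D\<bar> < e" "\<bar>\<Psi>' z2 (X w) - ?D\<bar> < e"
      using near[OF z1(1), of "X w0"] near[OF z2(1), of "X w"] elim \<delta> by auto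
    show ?case
    proof (cases "w0 < w")
      case True
      then have "\<Psi>' z1 (X w0) \<le> (f w - f w0) / (w - w0)" "(f w - f w0) / (w - w0) \<le> \<Psi>' z2 (X w)"
        using lo hi by (auto simp: le_divide_eq divide_le_eq)
      then show ?thesis using n by (simp add: dist_real_def abs_less_iff)
    next
      case False
      then have "w - w0 < 0" using w by simp
      then have "(f w - f w0) / (w - w0) \<le> \<Psi>' z1 (X w0)" "\<Psi>' z2 (X w) \<le> (f w - f w0) / (w - w0)"
        using lo hi by (auto simp: neg_le_divide_eq neg_divide_le_eq)
      then show ?thesis using n by (simp add: dist_real_def abs_less_iff)
    qed
  qed
qed


section \<open>The pressure as a function of \<open>w\<close>\<close>

text \<open>The Bethe free energy of \<open>Z_two\<close> before its reduction to the Ising sum: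
  edge weights \<open>1 + w\<close>, 1 and \<open>1 + w / (q - 1)\<close>, vertex weight
  \<open>(q - 1) * exp (- B)\<close> for the second colour, message vector
  \<open>(X, 1)\<close>.\<close>

definition rc_bethe :: "real \<Rightarrow> nat \<Rightarrow> real \<Rightarrow> real \<Rightarrow> real \<Rightarrow> real" where
  "rc_bethe q d B w X =
     ln (((1 + w) * X + 1) ^ d + (q - 1) * exp (- B) * (X + (1 + w / (q - 1))) ^ d)
     - d / 2 * ln ((1 + w) * X\<^sup>2 + 2 * X + (1 + w / (q - 1)))"

text \<open>The messages of the random cluster model are \<open>X = rc_scale q w * R\<close>; in \<open>X\<close> no fractional
  powers of \<open>w\<close> occur.\<close>

definition rc_scale :: "real \<Rightarrow> real \<Rightarrow> real" where
  "rc_scale q w = sqrt (1 + w / (q - 1)) / sqrt (1 + w)"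

text \<open>A negative field is reflected. At zero field the choice is the maximizer
  \<open>\<ge> 1\<close>, the other one being its reciprocal.\<close>

definition signed_root :: "nat \<Rightarrow> real \<Rightarrow> real \<Rightarrow> real" where
  "signed_root d \<kappa> s = (if s \<ge> 0 then top_root d \<kappa> s else 1 / top_root d \<kappa> (- s))"

definition rc_root :: "real \<Rightarrow> nat \<Rightarrow> real \<Rightarrow> real \<Rightarrow> real" where
  "rc_root q d B w = rc_scale q w * signed_root d (rc_coupling q w) (rc_field q d w B)"

lemma signed_root:
  assumes \<kappa>: "0 < \<kappa>" "\<kappa> \<le> 1"
  shows "signed_root d \<kappa> s > 0" and "field_at d \<kappa> (signed_root d \<kappa> s) = s"
proof -
  have "top_root d \<kappa> t > 0 \<and> field_at d \<kappa> (top_root d \<kappa> t) = t" if "t \<ge> 0" for t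
    using top_root[OF \<kappa> that, of d] by (auto simp: is_top_root_def)
  then show "signed_root d \<kappa> s > 0" "field_at d \<kappa> (signed_root d \<kappa> s) = s"
    using field_at_inverse[of "top_root d \<kappa> (- s)" \<kappa> d] \<kappa> by (auto simp: signed_root_def)
qed

lemma bethe_signed_root:
  assumes \<kappa>: "0 < \<kappa>" "\<kappa> \<le> 1"
  shows "bethe d \<kappa> s (signed_root d \<kappa> s) =
    (if s \<ge> 0 then bethe_max d \<kappa> s else s + bethe_max d \<kappa> (- s))"
proof -
  have "top_root d \<kappa> (- s) > 0" if "s < 0"
    using top_root[OF \<kappa>, of "- s" d] that by (auto simp: is_top_root_def)
  then show ?thesis using bethe_flip[of "top_root d \<kappa> (- s)" \<kappa> d s] \<kappa>
    by (auto simp: signed_root_def bethe_max_def)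
qed

lemma bethe_le_signed_root:
  assumes \<kappa>: "0 < \<kappa>" "\<kappa> \<le> 1" and R: "R > 0" and d: "d \<ge> 1"
  shows "bethe d \<kappa> s R \<le> bethe d \<kappa> s (signed_root d \<kappa> s)"
proof (cases "s \<ge> 0")
  case True
  then show ?thesis using bethe_le_top_root[OF R \<kappa> True d] by (simp add: signed_root_def)
next
  case False
  have "bethe d \<kappa> s R = s + bethe d \<kappa> (- s) (1 / R)" using bethe_flip[of "1 / R" \<kappa> d s] R \<kappa> by simp
  also have "\<dots> \<le> s + bethe_max d \<kappa> (- s)"
    unfolding bethe_max_def using False R by (intro add_left_mono bethe_le_top_root \<kappa> d) auto
  finally show ?thesis unfolding bethe_signed_root[OF \<kappa>] using False by simp
qed

context
  fixes q w :: real assumes q: "q > 2" and w: "w \<ge> 0"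
begin

lemma rc_weights_pos: "1 + w > 0" "1 + w / (q - 1) > 0"
  using q w by (auto simp: add_pos_nonneg)

lemma rc_scale_pos: "rc_scale q w > 0"
  using rc_weights_pos by (simp add: rc_scale_def)

lemma rc_scale_identities:
  defines "\<tau> \<equiv> rc_scale q w" and "\<kappa> \<equiv> rc_coupling q w"
  shows "(1 + w) * (\<tau> * R) + 1 = (R + \<kappa>) / \<kappa>"
    and "\<tau> * R + (1 + w / (q - 1)) = (1 + w / (q - 1)) * (\<kappa> * R + 1)"
    and "(1 + w) * (\<tau> * R)\<^sup>2 + 2 * (\<tau> * R) + (1 + w / (q - 1)) = (1 + w / (q - 1)) * (R\<^sup>2 + 2 * \<kappa> * R + 1)"
proof -
  define \<alpha> \<gamma> where "\<alpha> = sqrt (1 + w)" and "\<gamma> = sqrt (1 + w / (q - 1))"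
  have p: "\<alpha> > 0" "\<gamma> > 0" using rc_weights_pos by (auto simp: \<alpha>_def \<gamma>_def)
  have sq: "1 + w = \<alpha>\<^sup>2" "1 + w / (q - 1) = \<gamma>\<^sup>2" using rc_weights_pos by (auto simp: \<alpha>_def \<gamma>_def)
  have k: "\<kappa> = 1 / (\<alpha> * \<gamma>)" "\<tau> = \<gamma> / \<alpha>" by (simp_all add: \<kappa>_def \<tau>_def rc_coupling_def rc_scale_def \<alpha>_def \<gamma>_def)
  show "(1 + w) * (\<tau> * R) + 1 = (R + \<kappa>) / \<kappa>"
    "\<tau> * R + (1 + w / (q - 1)) = (1 + w / (q - 1)) * (\<kappa> * R + 1)"
    "(1 + w) * (\<tau> * R)\<^sup>2 + 2 * (\<tau> * R) + (1 + w / (q - 1)) = (1 + w / (q - 1)) * (R\<^sup>2 + 2 * \<kappa> * R + 1)"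
    unfolding sq k using p by (simp_all add: field_simps power2_eq_square)
qed

text \<open>Stated as a product equal to 1 so that it can be inserted as a factor when passing
  between the two parametrizations.\<close>

lemma exp_rc_field:
  "exp (rc_field q d w B) * ((1 + w / (q - 1)) ^ d * ((q - 1) * exp (- B))) * rc_coupling q w ^ d = 1"
proof -
  note p = rc_weights_pos
  have "rc_field q d w B + (d * ln (1 + w / (q - 1)) + (ln (q - 1) - B)) = d / 2 * (ln (1 + w) + ln (1 + w / (q - 1)))"
    by (simp add: rc_field_def algebra_simps)
  moreover have "(1 + w / (q - 1)) ^ d = exp (d * ln (1 + w / (q - 1)))" using p by (simp add: exp_of_nat_mult)
  moreover have "(q - 1) * exp (- B) = exp (ln (q - 1) - B)" using q by (simp add: exp_diff exp_minus divide_inverse)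
  ultimately have "exp (rc_field q d w B) * ((1 + w / (q - 1)) ^ d * ((q - 1) * exp (- B))) =
      exp (d / 2 * (ln (1 + w) + ln (1 + w / (q - 1))))"
    by (simp only: exp_add[symmetric])
  also have "\<dots> = (sqrt (1 + w) * sqrt (1 + w / (q - 1))) ^ d"
    using p by (simp add: distrib_left exp_add exp_half_ln power_mult_distrib flip: exp_half_ln)
  finally show ?thesis unfolding rc_coupling_def using p by (simp add: power_divide power_mult_distrib)
qed

lemma rc_bethe_scale:
  assumes R: "R > 0"
  shows "rc_bethe q d B w (rc_scale q w * R) =
    d / 2 * ln (1 + w / (q - 1)) + ln (q - 1) - B + bethe d (rc_coupling q w) (rc_field q d w B) R"
proof -
  let ?c = "1 + w / (q - 1)" and ?\<kappa> = "rc_coupling q w" and ?s = "rc_field q d w B"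
  note \<kappa> = rc_coupling_bounds[OF q w]
  have c: "?c > 0" by (rule rc_weights_pos)
  have l: "(q - 1) * exp (- B) > 0" using q by simp
  have v: "exp ?s * (R + ?\<kappa>) ^ d + (?\<kappa> * R + 1) ^ d > 0" by (rule vertex_sum_pos[OF R \<kappa>(1)])
  have e: "R\<^sup>2 + 2 * ?\<kappa> * R + 1 > 0" by (rule edge_sum_pos[OF R \<kappa>(1)])
  have "((R + ?\<kappa>) / ?\<kappa>) ^ d + (q - 1) * exp (- B) * (?c * (?\<kappa> * R + 1)) ^ d =
      ?c ^ d * ((q - 1) * exp (- B)) * (exp ?s * (R + ?\<kappa>) ^ d + (?\<kappa> * R + 1) ^ d)"
  proof -
    have "((R + ?\<kappa>) / ?\<kappa>) ^ d = exp ?s * (?c ^ d * ((q - 1) * exp (- B))) * ?\<kappa> ^ d * ((R + ?\<kappa>) / ?\<kappa>) ^ d"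
      unfolding exp_rc_field by simp
    also have "\<dots> = ?c ^ d * ((q - 1) * exp (- B)) * (exp ?s * (R + ?\<kappa>) ^ d)"
      using \<kappa> by (simp add: power_divide)
    finally have e: "((R + ?\<kappa>) / ?\<kappa>) ^ d = ?c ^ d * ((q - 1) * exp (- B)) * (exp ?s * (R + ?\<kappa>) ^ d)" .
    show ?thesis unfolding e power_mult_distrib[of ?c] by (simp only: distrib_left mult_ac)
  qed
  then have "rc_bethe q d B w (rc_scale q w * R) =
      ln (?c ^ d * ((q - 1) * exp (- B)) * (exp ?s * (R + ?\<kappa>) ^ d + (?\<kappa> * R + 1) ^ d))
      - d / 2 * ln (?c * (R\<^sup>2 + 2 * ?\<kappa> * R + 1))"
    unfolding rc_bethe_def rc_scale_identities by simp
  also have "ln (?c ^ d * ((q - 1) * exp (- B)) * (exp ?s * (R + ?\<kappa>) ^ d + (?\<kappa> * R + 1) ^ d)) =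
      d * ln ?c + (ln (q - 1) - B) + ln (exp ?s * (R + ?\<kappa>) ^ d + (?\<kappa> * R + 1) ^ d)"
  proof -
    have "ln (?c ^ d * ((q - 1) * exp (- B))) = d * ln ?c + (ln (q - 1) - B)"
      using c q by (simp only: ln_mult ln_realpow) (simp add: ln_mult ln_realpow)
    moreover have "?c ^ d * ((q - 1) * exp (- B)) > 0" using c l by simp
    ultimately show ?thesis using v by (simp only: ln_mult_pos)
  qed
  also have "ln (?c * (R\<^sup>2 + 2 * ?\<kappa> * R + 1)) = ln ?c + ln (R\<^sup>2 + 2 * ?\<kappa> * R + 1)"
    using c e by (simp only: ln_mult_pos)
  finally show ?thesis by (simp add: bethe_def algebra_simps)
qed

lemma rc_root_pos: "rc_root q d B w > 0"
  unfolding rc_root_def using rc_scale_pos signed_root(1)[OF rc_coupling_bounds[OF q w]] by simp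

lemma rc_bethe_le_root:
  assumes X: "X > 0" and d: "d \<ge> 1"
  shows "rc_bethe q d B w X \<le> rc_bethe q d B w (rc_root q d B w)"
proof -
  define R where "R = X / rc_scale q w"
  have R: "R > 0" "X = rc_scale q w * R" using X rc_scale_pos by (auto simp: R_def)
  note \<kappa> = rc_coupling_bounds[OF q w]
  show ?thesis
    unfolding R(2) rc_root_def rc_bethe_scale[OF R(1)] rc_bethe_scale[OF signed_root(1)[OF \<kappa>]]
    using bethe_le_signed_root[OF \<kappa> R(1) d] by simp
qed

text \<open>The message equation in the variable \<open>X\<close>: the square roots hidden in
  coupling, field and scale cancel.\<close>

lemma rc_stationary:
  fixes B R :: real
  assumes d: "d \<ge> 1" and R: "R > 0" "field_at d (rc_coupling q w) R = rc_field q d w B"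
  defines "X \<equiv> rc_scale q w * R"
  shows "((1 + w) * X + 1) ^ (d - 1) = (q - 1) * exp (- B) * X * (X + (1 + w / (q - 1))) ^ (d - 1)"
proof -
  let ?c = "1 + w / (q - 1)" and ?\<kappa> = "rc_coupling q w" and ?s = "rc_field q d w B"
  note \<kappa> = rc_coupling_bounds[OF q w]
  have st: "exp ?s * (R + ?\<kappa>) ^ (d - 1) = R * (?\<kappa> * R + 1) ^ (d - 1)"
    using field_at_eq_iff[of R ?\<kappa> "exp ?s" d] \<kappa> R by simp
  note X = X_def
  have \<tau>: "rc_scale q w = ?c * ?\<kappa>"
    using rc_weights_pos by (simp add: rc_scale_def rc_coupling_def field_simps)
  have pw: "x ^ d = x * x ^ (d - 1)" for x :: real using d by (simp add: power_eq_if)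
  have "((1 + w) * X + 1) ^ (d - 1) = ((R + ?\<kappa>) / ?\<kappa>) ^ (d - 1)"
    unfolding X rc_scale_identities ..
  also have "\<dots> = exp ?s * (?c ^ d * ((q - 1) * exp (- B))) * ?\<kappa> ^ d * ((R + ?\<kappa>) / ?\<kappa>) ^ (d - 1)"
    unfolding exp_rc_field by simp
  also have "\<dots> = (q - 1) * exp (- B) * (?c * ?\<kappa>) * ?c ^ (d - 1) * (exp ?s * (R + ?\<kappa>) ^ (d - 1))"
    unfolding pw[of ?c] pw[of ?\<kappa>] using \<kappa> by (simp add: power_divide)
  also have "\<dots> = (q - 1) * exp (- B) * X * (X + ?c) ^ (d - 1)"
    unfolding st X rc_scale_identities(2) unfolding \<tau> power_mult_distrib[of ?c] by (simp only: mult_ac)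
  finally show ?thesis .
qed

end

text \<open>Up to a nonzero factor the expression is the \<open>X\<close>-derivative of the
  stationarity equation at a solution. It equals
  \<open>c / \<kappa> * R * slope_num d \<kappa> R\<close>, so zeros are simple where
  \<open>field_at\<close> has nonzero slope.\<close>

lemma rc_simple_zero:
  assumes q: "q > 2" and w: "w \<ge> 0" and R: "R > 0" and sl: "slope_num d (rc_coupling q w) R \<noteq> 0"
  defines "X \<equiv> rc_scale q w * R"
  shows "((1 + w) * X + 1) * (X + (1 + w / (q - 1))) - (d - 1) * (((1 + w) * (1 + w / (q - 1)) - 1) * X) \<noteq> 0"
proof -
  define c \<kappa> where "c = 1 + w / (q - 1)" and "\<kappa> = rc_coupling q w"
  have \<kappa>: "\<kappa> > 0" and c: "c > 0" "1 + w > 0"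
    using rc_coupling_bounds[OF q w] rc_weights_pos[OF q w] by (auto simp: \<kappa>_def c_def)
  have k2: "(1 + w) * c = 1 / \<kappa>\<^sup>2"
    using c by (simp add: \<kappa>_def rc_coupling_def c_def power_divide power_mult_distrib)
  have \<tau>: "rc_scale q w = c * \<kappa>"
    using c by (simp add: rc_scale_def rc_coupling_def \<kappa>_def c_def field_simps)
  have "((1 + w) * X + 1) * (X + c) - (d - 1) * (((1 + w) * c - 1) * X) =
     (R + \<kappa>) / \<kappa> * (c * (\<kappa> * R + 1)) - (d - 1) * ((1 / \<kappa>\<^sup>2 - 1) * (c * \<kappa> * R))"
    using rc_scale_identities(1,2)[OF q w, of R] k2 \<tau> by (simp add: X_def c_def \<kappa>_def)
  also have "\<dots> = c / \<kappa> * R * slope_num d \<kappa> R"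
    using \<kappa> R by (simp add: slope_num_def field_simps power2_eq_square)
  finally show ?thesis using sl c \<kappa> R by (simp add: c_def \<kappa>_def)
qed

section \<open>The partial derivative in \<open>w\<close> at a fixed message\<close>

definition rc_bethe_dw :: "real \<Rightarrow> nat \<Rightarrow> real \<Rightarrow> real \<Rightarrow> real \<Rightarrow> real" where
  "rc_bethe_dw q d B w X =
     d * (((1 + w) * X + 1) ^ (d - 1) * X + (q - 1) * exp (- B) * (X + (1 + w / (q - 1))) ^ (d - 1) / (q - 1)) /
       (((1 + w) * X + 1) ^ d + (q - 1) * exp (- B) * (X + (1 + w / (q - 1))) ^ d)
     - d / 2 * ((X\<^sup>2 + 1 / (q - 1)) / ((1 + w) * X\<^sup>2 + 2 * X + (1 + w / (q - 1))))"

lemma rc_sums_pos: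
  fixes q w X B :: real
  assumes q: "q > 2" and w: "w \<ge> 0" and X: "X > 0"
  shows "((1 + w) * X + 1) ^ d + (q - 1) * exp (- B) * (X + (1 + w / (q - 1))) ^ d > 0"
    and "(1 + w) * X\<^sup>2 + 2 * X + (1 + w / (q - 1)) > 0"
proof -
  have p: "1 + w > 0" "1 + w / (q - 1) > 0" using rc_weights_pos[OF q w] by auto
  then have "(1 + w) * X + 1 > 0" "X + (1 + w / (q - 1)) > 0" "(1 + w) * X\<^sup>2 > 0" using X
    by (simp_all add: add_pos_pos)
  then show "((1 + w) * X + 1) ^ d + (q - 1) * exp (- B) * (X + (1 + w / (q - 1))) ^ d > 0"
    "(1 + w) * X\<^sup>2 + 2 * X + (1 + w / (q - 1)) > 0"
    using q X p by (auto intro!: add_pos_pos mult_pos_pos)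
qed

lemma rc_bethe_deriv_w:
  assumes q: "q > 2" and w: "w \<ge> 0" and X: "X > 0"
  shows "((\<lambda>w. rc_bethe q d B w X) has_real_derivative rc_bethe_dw q d B w X) (at w)"
proof -
  have f1: "((\<lambda>w. ((1 + w) * X + 1) ^ d + (q - 1) * exp (- B) * (X + (1 + w / (q - 1))) ^ d) has_real_derivative
      d * (((1 + w) * X + 1) ^ (d - 1) * X + (q - 1) * exp (- B) * (X + (1 + w / (q - 1))) ^ (d - 1) / (q - 1))) (at w)"
  proof -
    have "((\<lambda>w. ((1 + w) * X + 1) ^ d) has_real_derivative d * ((1 + w) * X + 1) ^ (d - 1) * X) (at w)"
      "((\<lambda>w. (X + (1 + w / (q - 1))) ^ d) has_real_derivative
        d * (X + (1 + w / (q - 1))) ^ (d - 1) * (1 / (q - 1))) (at w)"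
      using q by (auto intro!: derivative_eq_intros)
    from DERIV_add[OF this(1) DERIV_cmult[OF this(2), of "(q - 1) * exp (- B)"]]
    show ?thesis by (rule DERIV_cong) (simp only: distrib_left divide_inverse mult_1_left mult_ac)
  qed
  have f2: "((\<lambda>w. (1 + w) * X\<^sup>2 + 2 * X + (1 + w / (q - 1))) has_real_derivative X\<^sup>2 + 1 / (q - 1)) (at w)"
    using q by (auto intro!: derivative_eq_intros)
  show ?thesis unfolding rc_bethe_def rc_bethe_dw_def
    using DERIV_diff[OF DERIV_chain2[OF DERIV_ln_divide f1] DERIV_cmult[OF DERIV_chain2[OF DERIV_ln_divide f2], of "real d / 2"]]
      rc_sums_pos[OF assms] by simp
qed

lemma rc_bethe_dw_continuous:
  assumes q: "q > 2" and w: "w \<ge> 0" and X: "X > 0"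
  shows "continuous (at (w, X)) (\<lambda>(w, x). rc_bethe_dw q d B w x)"
  unfolding rc_bethe_dw_def case_prod_unfold
  using rc_sums_pos(1)[OF assms, of d B] rc_sums_pos(2)[OF assms] q
  by (intro continuous_intros) auto

text \<open>By stationarity the vertex sum is a multiple of the edge sum \<open>A * X + C\<close>,
  so the vertex term contributes \<open>d\<close> times the same quotient of which the edge term
  removes \<open>d / 2\<close>.\<close>

lemma rc_bethe_dw_stationary:
  assumes q: "q > 2" and w: "w \<ge> 0" and X: "X > 0" and d: "d \<ge> 1"
    and st: "((1 + w) * X + 1) ^ (d - 1) = (q - 1) * exp (- B) * X * (X + (1 + w / (q - 1))) ^ (d - 1)"
  shows "rc_bethe_dw q d B w X =
    d / 2 * ((X\<^sup>2 + 1 / (q - 1)) / ((1 + w) * X\<^sup>2 + 2 * X + (1 + w / (q - 1))))"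
proof -
  define A C l e where "A = (1 + w) * X + 1" and "C = X + (1 + w / (q - 1))"
    and "l = (q - 1) * exp (- B)" and "e = 1 / (q - 1)"
  have p: "C > 0" "l > 0" using q w X by (auto simp: C_def l_def add_pos_pos add_pos_nonneg)
  have pw: "x ^ d = x * x ^ (d - 1)" for x :: real using d by (simp add: power_eq_if)
  have st': "A ^ (d - 1) = l * X * C ^ (d - 1)" using st by (simp add: A_def C_def l_def)
  have E: "(1 + w) * X\<^sup>2 + 2 * X + (1 + w / (q - 1)) = A * X + C"
    by (simp add: A_def C_def power2_eq_square algebra_simps)
  have "A * X + C > 0" using rc_sums_pos(2)[OF q w X] unfolding E .
  have "A ^ d + l * C ^ d = l * C ^ (d - 1) * (A * X + C)"
    unfolding pw[of A] pw[of C] st' by (simp add: algebra_simps)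
  moreover have "A ^ (d - 1) * X + l * C ^ (d - 1) / (q - 1) = l * C ^ (d - 1) * (X\<^sup>2 + e)"
    unfolding st' e_def by (simp add: algebra_simps power2_eq_square)
  ultimately have "rc_bethe_dw q d B w X = d * (l * C ^ (d - 1) * (X\<^sup>2 + e)) / (l * C ^ (d - 1) * (A * X + C))
      - d / 2 * ((X\<^sup>2 + e) / (A * X + C))"
    unfolding rc_bethe_dw_def E by (simp add: A_def C_def l_def e_def)
  also have "d * (l * C ^ (d - 1) * (X\<^sup>2 + e)) / (l * C ^ (d - 1) * (A * X + C)) = d * ((X\<^sup>2 + e) / (A * X + C))"
    using p by simp
  also have "d * ((X\<^sup>2 + e) / (A * X + C)) - d / 2 * ((X\<^sup>2 + e) / (A * X + C)) = d / 2 * ((X\<^sup>2 + e) / (A * X + C))"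
    unfolding left_diff_distrib[symmetric] by simp
  finally show ?thesis unfolding E e_def .
qed

section \<open>Continuity of the maximizing message\<close>

lemma rc_coupling_tendsto:
  assumes "q > 2" "w \<ge> 0"
  shows "(rc_coupling q \<longlongrightarrow> rc_coupling q w) (at w within S)"
    and "((\<lambda>w. rc_field q d w B) \<longlongrightarrow> rc_field q d w B) (at w within S)"
    and "(rc_scale q \<longlongrightarrow> rc_scale q w) (at w within S)"
proof -
  have p: "1 + w > 0" "1 + w / (q - 1) > 0" using rc_weights_pos[OF assms] by auto
  show "(rc_coupling q \<longlongrightarrow> rc_coupling q w) (at w within S)"
    "(rc_scale q \<longlongrightarrow> rc_scale q w) (at w within S)"
    unfolding rc_coupling_def[abs_def] rc_scale_def[abs_def] using p assms by (auto intro!: tendsto_eq_intros)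
  show "((\<lambda>w. rc_field q d w B) \<longlongrightarrow> rc_field q d w B) (at w within S)"
    unfolding rc_field_def using p assms by (auto intro!: tendsto_intros)
qed

text \<open>At zero field this is the maximizer that \<open>rc_root\<close> does not choose, unless
  the two coincide; it is the limit of the maximizers from the left of the critical weight.\<close>

definition rc_left_root :: "real \<Rightarrow> nat \<Rightarrow> real \<Rightarrow> real \<Rightarrow> real" where
  "rc_left_root q d B w = rc_scale q w / top_root d (rc_coupling q w) (- rc_field q d w B)"

lemma rc_root_eq_left_root: "rc_field q d w B < 0 \<Longrightarrow> rc_root q d B w = rc_left_root q d B w"
  by (simp add: rc_root_def rc_left_root_def signed_root_def)

lemma rc_root_tendsto_pos:
  assumes q: "q > 2" and w: "w \<ge> 0" and s: "rc_field q d w B \<ge> 0"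
    and ev: "\<forall>\<^sub>F x in at w within S. x \<ge> 0 \<and> rc_field q d x B \<ge> 0"
  shows "(rc_root q d B \<longlongrightarrow> rc_root q d B w) (at w within S)"
proof -
  have "((\<lambda>x. rc_scale q x * top_root d (rc_coupling q x) (rc_field q d x B)) \<longlongrightarrow>
      rc_scale q w * top_root d (rc_coupling q w) (rc_field q d w B)) (at w within S)"
    by (intro tendsto_mult top_root_tendsto rc_coupling_tendsto q w s rc_coupling_bounds
        eventually_mono[OF ev]) (use rc_coupling_bounds[OF q] in auto)
  then have "(rc_root q d B \<longlongrightarrow> rc_scale q w * top_root d (rc_coupling q w) (rc_field q d w B)) (at w within S)"
    by (rule Lim_transform_eventually)
      (rule eventually_mono[OF ev], auto simp: rc_root_def signed_root_def)
  then show ?thesis using s by (simp add: rc_root_def signed_root_def)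
qed

lemma rc_left_root_tendsto:
  assumes q: "q > 2" and w: "w \<ge> 0" and s: "rc_field q d w B \<le> 0"
    and ev: "\<forall>\<^sub>F x in at w within S. x \<ge> 0 \<and> rc_field q d x B \<le> 0"
  shows "(rc_left_root q d B \<longlongrightarrow> rc_left_root q d B w) (at w within S)"
proof -
  note \<kappa> = rc_coupling_bounds[OF q w]
  have "top_root d (rc_coupling q w) (- rc_field q d w B) \<noteq> 0"
    using top_root[OF \<kappa>, of "- rc_field q d w B" d] s by (auto simp: is_top_root_def)
  moreover have "((\<lambda>x. top_root d (rc_coupling q x) (- rc_field q d x B)) \<longlongrightarrow>
      top_root d (rc_coupling q w) (- rc_field q d w B)) (at w within S)"
    by (intro top_root_tendsto tendsto_minus rc_coupling_tendsto q w \<kappa> eventually_mono[OF ev])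
      (use s rc_coupling_bounds[OF q] in auto)
  ultimately show ?thesis unfolding rc_left_root_def[abs_def]
    by (intro tendsto_divide rc_coupling_tendsto q w)
qed

text \<open>At zero field the limits from the two signs of the field are glued; they agree because
  top root 1 is its own reciprocal.\<close>

lemma rc_root_tendsto:
  assumes q: "q > 2" and w: "w \<ge> 0"
    and reg: "rc_field q d w B = 0 \<Longrightarrow> top_root d (rc_coupling q w) 0 = 1"
  shows "(rc_root q d B \<longlongrightarrow> rc_root q d B w) (at w within {0..})"
proof -
  let ?s = "\<lambda>x. rc_field q d x B"
  have ev0: "\<forall>\<^sub>F x in at w within {0..}. x \<ge> (0::real)" by (auto simp: eventually_at_filter)
  have lim: "(?s \<longlongrightarrow> ?s w) (at w within {0..})" by (rule rc_coupling_tendsto[OF q w])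
  consider "?s w > 0" | "?s w < 0" | "?s w = 0" by linarith
  then show ?thesis
  proof cases
    case 1
    have "\<forall>\<^sub>F x in at w within {0..}. x \<ge> 0 \<and> ?s x \<ge> 0"
      using ev0 order_tendstoD(1)[OF lim 1] by eventually_elim simp
    then show ?thesis using 1 by (intro rc_root_tendsto_pos[OF q w]) auto
  next
    case 2
    have ev: "\<forall>\<^sub>F x in at w within {0..}. x \<ge> 0 \<and> ?s x < 0"
      using ev0 order_tendstoD(2)[OF lim 2] by eventually_elim simp
    have "(rc_left_root q d B \<longlongrightarrow> rc_left_root q d B w) (at w within {0..})"
      using 2 by (intro rc_left_root_tendsto[OF q w] eventually_mono[OF ev]) auto
    then have "(rc_root q d B \<longlongrightarrow> rc_left_root q d B w) (at w within {0..})"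
      by (rule Lim_transform_eventually) (rule eventually_mono[OF ev], simp add: rc_root_eq_left_root)
    then show ?thesis using 2 by (simp add: rc_root_eq_left_root)
  next
    case 3
    let ?P = "{x. x \<ge> 0 \<and> ?s x \<ge> 0}" and ?N = "{x. x \<ge> 0 \<and> ?s x < 0}"
    have P: "(rc_root q d B \<longlongrightarrow> rc_root q d B w) (at w within ?P)"
      using 3 by (intro rc_root_tendsto_pos[OF q w]) (auto simp: eventually_at_filter)
    have "(rc_left_root q d B \<longlongrightarrow> rc_left_root q d B w) (at w within ?N)"
      using 3 by (intro rc_left_root_tendsto[OF q w]) (auto simp: eventually_at_filter)
    then have "(rc_root q d B \<longlongrightarrow> rc_left_root q d B w) (at w within ?N)"
      by (rule Lim_transform_eventually) (auto simp: eventually_at_filter rc_root_eq_left_root)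
    moreover have "rc_left_root q d B w = rc_root q d B w"
      using 3 reg by (simp add: rc_root_def rc_left_root_def signed_root_def)
    ultimately have N: "(rc_root q d B \<longlongrightarrow> rc_root q d B w) (at w within ?N)" by simp
    have "{0..} = ?P \<union> ?N" by auto
    then show ?thesis using Lim_Un[OF P N] by simp
  qed
qed


section \<open>The critical curve\<close>

text \<open>At \<open>w = w_c q d B\<close> this is the quotient of \<open>1 + w\<close> by
  \<open>1 + w / (q - 1)\<close>, and the denominator is \<open>crit_weight\<close>; see
  \<open>w_c_weights\<close>.\<close>

definition crit_ratio :: "real \<Rightarrow> nat \<Rightarrow> real \<Rightarrow> real" where
  "crit_ratio q d B = ((q - 1) * exp (- B)) powr (2 / d)"

definition crit_weight :: "real \<Rightarrow> real \<Rightarrow> real" where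
  "crit_weight q l = (1 - 1 / (q - 1)) / (1 - l / (q - 1))"

definition crit_product :: "real \<Rightarrow> nat \<Rightarrow> real \<Rightarrow> real" where
  "crit_product q d B = (1 + w_c q d B) * (1 + w_c q d B / (q - 1))"

context
  fixes q :: real and d :: nat
  assumes q: "q > 2" and d: "d \<ge> 3"
begin

lemma crit_ratio_bounds:
  assumes "B \<ge> 0" shows "0 < crit_ratio q d B" "crit_ratio q d B < q - 1"
proof -
  show "0 < crit_ratio q d B" using q by (simp add: crit_ratio_def)
  have "(q - 1) * exp (- B) \<le> (q - 1) * 1" using q assms by (intro mult_left_mono) auto
  then have "crit_ratio q d B \<le> (q - 1) powr (2 / d)"
    unfolding crit_ratio_def using q by (intro powr_mono2) auto
  also have "\<dots> < (q - 1) powr 1" using q d by (intro powr_less_mono) auto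
  finally show "crit_ratio q d B < q - 1" using q by simp
qed

lemma crit_ratio_strict_antimono: "B < B' \<Longrightarrow> crit_ratio q d B' < crit_ratio q d B"
  unfolding crit_ratio_def using q d by (intro powr_less_mono2) auto

lemma w_c_weights:
  assumes "B \<ge> 0"
  shows "1 + w_c q d B / (q - 1) = crit_weight q (crit_ratio q d B)"
    and "1 + w_c q d B = crit_ratio q d B * crit_weight q (crit_ratio q d B)"
    and "crit_weight q (crit_ratio q d B) > 0"
proof -
  define l where "l = crit_ratio q d B"
  have l: "0 < l" "l < q - 1" unfolding l_def using crit_ratio_bounds[OF assms] .
  have D: "1 - l / (q - 1) > 0" using l q by simp
  have w: "w_c q d B = (l - 1) / (1 - l / (q - 1))"
    by (simp add: w_c_def ell_def l_def crit_ratio_def)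
  define m where "m = q - 1"
  have m: "m > 0" "m - l > 0" using l q by (auto simp: m_def)
  have e: "1 - l / m = (m - l) / m" using m by (simp add: diff_divide_distrib)
  have w': "w_c q d B = (l - 1) * m / (m - l)" using w unfolding m_def[symmetric] e by simp
  have cw: "crit_weight q l = (m - 1) / (m - l)"
    unfolding crit_weight_def m_def[symmetric] e using m by (simp add: field_simps)
  have "1 + (l - 1) * m / (m - l) / m = (m - 1) / (m - l)"
    using m by (simp add: add_divide_eq_iff)
  then show "1 + w_c q d B / (q - 1) = crit_weight q (crit_ratio q d B)"
    unfolding l_def[symmetric] cw w' by (simp add: m_def)
  show "1 + w_c q d B = crit_ratio q d B * crit_weight q (crit_ratio q d B)"
    unfolding l_def[symmetric] cw w' using m by (simp add: field_simps)
  show "crit_weight q (crit_ratio q d B) > 0"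
    unfolding crit_weight_def l_def[symmetric] using D q by simp
qed

lemma crit_product_eq:
  "B \<ge> 0 \<Longrightarrow> crit_product q d B = crit_ratio q d B * (crit_weight q (crit_ratio q d B))\<^sup>2"
  unfolding crit_product_def by (simp add: w_c_weights power2_eq_square)

text \<open>Both factors in \<open>crit_product_eq\<close> increase with \<open>crit_ratio\<close>,
  which decreases in \<open>B\<close>.\<close>

lemma crit_product_strict_antimono:
  assumes "0 \<le> B" "B < B'" shows "crit_product q d B' < crit_product q d B"
proof -
  let ?l = "crit_ratio q d B" and ?l' = "crit_ratio q d B'"
  have l: "0 < ?l'" "?l' < ?l" "?l < q - 1"
    using crit_ratio_bounds crit_ratio_strict_antimono assms by auto
  have "?l' < q - 1" using l by linarith
  then have "1 - ?l / (q - 1) > 0" "1 - ?l' / (q - 1) > 0" "1 - ?l / (q - 1) < 1 - ?l' / (q - 1)" using l q by (auto simp: divide_strict_right_mono)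
  then have "crit_weight q ?l' \<le> crit_weight q ?l"
    unfolding crit_weight_def using q by (intro divide_left_mono mult_pos_pos) auto
  then have "(crit_weight q ?l')\<^sup>2 \<le> (crit_weight q ?l)\<^sup>2"
    using w_c_weights(3)[of B'] assms by (intro power_mono) auto
  then have "?l' * (crit_weight q ?l')\<^sup>2 < ?l * (crit_weight q ?l)\<^sup>2"
    using l w_c_weights(3)[of B'] assms by (intro mult_less_le_imp_less) auto
  then show ?thesis using assms by (simp add: crit_product_eq)
qed

lemma crit_product_continuous: "continuous_on {0..b} (crit_product q d)"
proof -
  have "continuous_on {0..b} (\<lambda>B. crit_ratio q d B * (crit_weight q (crit_ratio q d B))\<^sup>2)"
  proof -
    have "1 - crit_ratio q d B / (q - 1) \<noteq> 0" if "B \<in> {0..b}" for B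
      using crit_ratio_bounds[of B] that q by auto
    then show ?thesis using q unfolding crit_weight_def crit_ratio_def by (intro continuous_intros) auto
  qed
  then show ?thesis by (rule continuous_on_eq) (simp add: crit_product_eq)
qed

text \<open>The polynomial form of \<open>crit_product_0\<close>. For \<open>n = 3\<close> the
  difference is \<open>(z - 1) ^ 3\<close>; the induction step adds a term that is nonnegative by
  Bernoulli's inequality.\<close>

lemma power_difference_bound:
  assumes "z > (1::real)" and "n \<ge> 3"
  shows "real n * (z ^ (n - 1) - z) < (real n - 2) * (z ^ n - 1)"
  using assms(2)
proof (induction n rule: nat_induct_at_least)
  case base
  have "(z - 1) ^ 3 > 0" using assms(1) by simp
  then show ?case by (simp add: power3_eq_cube power2_eq_square algebra_simps)
next
  case (Suc n)
  have "1 + real n * (z - 1) \<le> (1 + (z - 1)) ^ n" using assms(1) by (intro Bernoulli_inequality) simp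
  then have "(z - 1) * (z ^ n - (1 + real n * (z - 1))) \<ge> 0" using assms(1) by simp
  moreover have "real n * (z ^ n - z * z) < z * ((real n - 2) * (z ^ n - 1))"
  proof -
    have "z * z ^ (n - 1) = z ^ n" using Suc by (simp add: power_eq_if)
    then have "real n * (z ^ n - z * z) = z * (real n * (z ^ (n - 1) - z))" by (simp add: algebra_simps)
    also have "\<dots> < z * ((real n - 2) * (z ^ n - 1))"
      using Suc assms(1) by (intro mult_strict_left_mono) auto
    finally show ?thesis .
  qed
  ultimately show ?case by (simp add: algebra_simps)
qed

lemma crit_product_0: "crit_product q d 0 > (real d / (real d - 2))\<^sup>2"
proof -
  \<comment> \<open>In terms of \<open>z\<close> everything is rational:
    \<open>q - 1 = z ^ d\<close>, \<open>crit_ratio q d 0 = z\<^sup>2\<close>, and the square root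
    of the product is \<open>(z ^ d - 1) / (z ^ (d - 1) - z)\<close>.\<close>
  define z where "z = (q - 1) powr (1 / d)"
  have z: "z > 1" unfolding z_def using q d by (intro gr_one_powr) auto
  have "z ^ d = z powr real d" using z by (simp add: powr_realpow)
  then have zd: "z ^ d = q - 1" using q d by (simp add: z_def powr_powr)
  have "z * z = (q - 1) powr (1 / d + 1 / d)" unfolding z_def powr_add by simp
  then have l: "crit_ratio q d 0 = z\<^sup>2" by (simp add: crit_ratio_def power2_eq_square)
  have "d = Suc (d - 1)" "d - 1 = Suc (d - 2)" using d by simp_all
  then have zd1: "z ^ d = z * z ^ (d - 1)" "z ^ (d - 1) = z * z ^ (d - 2)" by (metis power_Suc)+
  have D: "z ^ (d - 1) - z > 0"
  proof -
    have "z ^ (d - 2) > 1" using z d by (intro one_less_power) auto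
    then have "z * z ^ (d - 2) > z * 1" using z by (intro mult_strict_left_mono) auto
    then show ?thesis unfolding zd1(2) by simp
  qed
  have "z * crit_weight q (z\<^sup>2) = (z ^ d - 1) / (z ^ (d - 1) - z)"
  proof -
    have "crit_weight q (z\<^sup>2) = (z ^ d - 1) / (z ^ d - z\<^sup>2)"
    proof -
      have "(1 - 1 / m) / (1 - y / m) = (m - 1) / (m - y)" if "m > 0" for m y :: real
      proof -
        have "1 - 1 / m = (m - 1) / m" "1 - y / m = (m - y) / m" using that by (simp_all add: diff_divide_distrib)
        then show ?thesis using that by simp
      qed
      then show ?thesis unfolding crit_weight_def zd[symmetric] using z by simp
    qed
    also have "z ^ d - z\<^sup>2 = z * (z ^ (d - 1) - z)" unfolding zd1(1) by (simp add: power2_eq_square algebra_simps)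
    finally show ?thesis using z by simp
  qed
  moreover have "real d / (real d - 2) < (z ^ d - 1) / (z ^ (d - 1) - z)"
  proof -
    have "x / y < u / v" if "y > 0" "v > 0" "x * v < y * u" for x y u v :: real
      using that by (simp add: field_simps)
    then show ?thesis using power_difference_bound[OF z d] D d by simp
  qed
  ultimately have "real d / (real d - 2) < z * crit_weight q (z\<^sup>2)" by simp
  moreover have "real d / (real d - 2) > 0" using d by simp
  ultimately have "(real d / (real d - 2))\<^sup>2 < (z * crit_weight q (z\<^sup>2))\<^sup>2" by (intro power_strict_mono) auto
  then show ?thesis by (simp add: crit_product_eq l power_mult_distrib)
qed

text \<open>The product is too large at \<open>B = 0\<close> and equals 1 at
  \<open>B = ln (q - 1)\<close>, where the critical weight vanishes. Strict monotonicity on all of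
  \<open>B \<ge> 0\<close> makes the definite description meaningful.\<close>

lemma B_plus_props:
  shows "0 < B_plus q d" "B_plus q d < ln (q - 1)"
    "crit_product q d (B_plus q d) = (real d / (real d - 2))\<^sup>2"
proof -
  have lnq: "ln (q - 1) > 0" using q by simp
  have "crit_ratio q d (ln (q - 1)) = 1" using q by (simp add: crit_ratio_def exp_minus)
  then have end1: "crit_product q d (ln (q - 1)) = 1"
    using q lnq by (simp add: crit_product_eq crit_weight_def)
  have d1: "(real d / (real d - 2))\<^sup>2 > 1" using d by (intro one_less_power) (auto simp: less_divide_eq)
  obtain B where B: "0 \<le> B" "B \<le> ln (q - 1)" "crit_product q d B = (real d / (real d - 2))\<^sup>2"
    using IVT2'[of "crit_product q d" "ln (q - 1)" "(real d / (real d - 2))\<^sup>2" 0]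
      end1 d1 crit_product_0 lnq crit_product_continuous by auto
  have ne: "B \<noteq> 0" "B \<noteq> ln (q - 1)" using B end1 d1 crit_product_0 by auto
  have "B_plus q d = B" unfolding B_plus_def
  proof (rule the_equality)
    show "0 < B \<and> (1 + w_c q d B) * (1 + w_c q d B / (q - 1)) = (real d / (real d - 2))\<^sup>2"
      using B ne by (simp add: crit_product_def)
  next
    fix B' assume B': "0 < B' \<and> (1 + w_c q d B') * (1 + w_c q d B' / (q - 1)) = (real d / (real d - 2))\<^sup>2"
    then have "crit_product q d B' = crit_product q d B" using B by (simp add: crit_product_def)
    then show "B' = B" using crit_product_strict_antimono[of B B'] crit_product_strict_antimono[of B' B] B B'
      by (cases B B' rule: linorder_cases) auto
  qed
  then show "0 < B_plus q d" "B_plus q d < ln (q - 1)"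
    "crit_product q d (B_plus q d) = (real d / (real d - 2))\<^sup>2" using B ne by auto
qed

text \<open>Removing the logarithms leaves an inequality linear in \<open>w\<close> whose slope
  \<open>1 - crit_ratio q d B / (q - 1)\<close> is positive; its solution is
  \<open>w_c q d B\<close>.\<close>

lemma rc_field_sign:
  assumes w: "w \<ge> 0" and B: "B \<ge> 0"
  shows "rc_field q d w B \<ge> 0 \<longleftrightarrow> w \<ge> w_c q d B" "rc_field q d w B \<le> 0 \<longleftrightarrow> w \<le> w_c q d B"
proof -
  define l where "l = crit_ratio q d B"
  have l: "0 < l" "l < q - 1" unfolding l_def using crit_ratio_bounds[OF B] .
  have D: "1 - l / (q - 1) > 0" using l q by simp
  have c: "1 + w / (q - 1) > 0" using w q by (auto simp: add_pos_nonneg)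
  have wc: "w_c q d B = (l - 1) / (1 - l / (q - 1))"
    by (simp add: w_c_def ell_def l_def crit_ratio_def)
  have "ln l = 2 / d * (ln (q - 1) - B)" using q by (simp add: l_def crit_ratio_def ln_powr ln_mult)
  then have "d / 2 * ln l = ln (q - 1) - B" using d by simp
  then have s: "rc_field q d w B = d / 2 * (ln (1 + w) - ln (l * (1 + w / (q - 1))))"
  proof -
    have "ln (l * (1 + w / (q - 1))) = ln l + ln (1 + w / (q - 1))" using l c by (simp only: ln_mult_pos)
    then show ?thesis unfolding rc_field_def
      using \<open>d / 2 * ln l = ln (q - 1) - B\<close> unfolding right_diff_distrib distrib_left by (simp only: distrib_left)
  qed
  have d0: "real d / 2 > 0" using d by simp
  have "rc_field q d w B \<ge> 0 \<longleftrightarrow> l * (1 + w / (q - 1)) \<le> 1 + w"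
    unfolding s using d0 l c w by (simp add: zero_le_mult_iff)
  also have "\<dots> \<longleftrightarrow> l - 1 \<le> w * (1 - l / (q - 1))" by (simp add: algebra_simps)
  also have "\<dots> \<longleftrightarrow> w \<ge> w_c q d B" unfolding wc using D by (simp add: divide_le_eq)
  finally show "rc_field q d w B \<ge> 0 \<longleftrightarrow> w \<ge> w_c q d B" .
  have "rc_field q d w B \<le> 0 \<longleftrightarrow> 1 + w \<le> l * (1 + w / (q - 1))"
    unfolding s using d0 l c w by (simp add: mult_le_0_iff)
  also have "\<dots> \<longleftrightarrow> w * (1 - l / (q - 1)) \<le> l - 1" by (simp add: algebra_simps)
  also have "\<dots> \<longleftrightarrow> w \<le> w_c q d B" unfolding wc using D by (simp add: le_divide_eq)
  finally show "rc_field q d w B \<le> 0 \<longleftrightarrow> w \<le> w_c q d B" .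
qed

lemma w_c_pos:
  assumes "0 \<le> B" "B < ln (q - 1)" shows "w_c q d B > 0"
proof -
  have "exp B < exp (ln (q - 1))" using assms by simp
  then have "exp B < q - 1" using q by simp
  then have "(q - 1) * exp (- B) > 1" by (simp add: exp_minus divide_inverse[symmetric] less_divide_eq)
  then have "crit_ratio q d B > 1" unfolding crit_ratio_def using d by (intro gr_one_powr) auto
  moreover have "crit_ratio q d B < q - 1" using crit_ratio_bounds assms by simp
  ultimately show ?thesis using q by (simp add: w_c_def ell_def crit_ratio_def)
qed

text \<open>At \<open>R = 1\<close> the slope has the sign of \<open>\<kappa> * d - (d - 2)\<close>.
  On the zero-field curve \<open>1 / \<kappa>\<^sup>2\<close> is \<open>crit_product q d B\<close>,
  so this compares the product with its value at \<open>B_plus q d\<close>.\<close>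

lemma slope_at_critical:
  assumes B: "B \<ge> 0" and w: "w_c q d B \<ge> 0"
  defines "\<kappa> \<equiv> rc_coupling q (w_c q d B)"
  shows "B < B_plus q d \<Longrightarrow> slope_num d \<kappa> 1 < 0"
    and "B = B_plus q d \<Longrightarrow> slope_num d \<kappa> 1 = 0"
    and "B > B_plus q d \<Longrightarrow> slope_num d \<kappa> 1 > 0"
proof -
  have \<kappa>: "0 < \<kappa>" "\<kappa> \<le> 1" unfolding \<kappa>_def using rc_coupling_bounds[OF q w] .
  have "1 + w_c q d B > 0" "1 + w_c q d B / (q - 1) > 0" using rc_weights_pos[OF q w] .
  then have \<kappa>2: "\<kappa>\<^sup>2 = 1 / crit_product q d B"
    by (simp add: \<kappa>_def rc_coupling_def crit_product_def power_divide power_mult_distrib)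
  have pos: "crit_product q d B > 0"
    unfolding crit_product_eq[OF B] using w_c_weights(3)[OF B] crit_ratio_bounds(1)[OF B] by simp
  have prod: "crit_product q d B = (1 / \<kappa>)\<^sup>2" unfolding power_divide \<kappa>2 using pos by simp
  have D: "real d / (real d - 2) > 0" using d by simp
  have sl: "slope_num d \<kappa> 1 = (1 + \<kappa>) * (\<kappa> * d - (real d - 2))"
  proof -
    have "real (d - 1) = real d - 1" using d by simp
    then show ?thesis unfolding slope_num_def by (simp add: algebra_simps)
  qed
  have Bp: "B_plus q d \<ge> 0" using B_plus_props(1) by simp
  have cmp: "\<kappa> * d < real d - 2 \<longleftrightarrow> real d / (real d - 2) < 1 / \<kappa>"
    "\<kappa> * d > real d - 2 \<longleftrightarrow> real d / (real d - 2) > 1 / \<kappa>"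
    using \<kappa>(1) d by (simp_all add: divide_less_eq less_divide_eq mult.commute)
  have "x\<^sup>2 < y\<^sup>2 \<longleftrightarrow> x < y" if "x \<ge> 0" "y \<ge> 0" for x y :: real
    using power_mono_iff[of y x 2] that by (simp only: not_le[symmetric])
  then have sq: "real d / (real d - 2) < 1 / \<kappa> \<longleftrightarrow> crit_product q d (B_plus q d) < crit_product q d B"
    "real d / (real d - 2) > 1 / \<kappa> \<longleftrightarrow> crit_product q d (B_plus q d) > crit_product q d B"
    unfolding B_plus_props(3) prod using \<kappa>(1) less_imp_le[OF D] by simp_all
  have "slope_num d \<kappa> 1 < 0 \<longleftrightarrow> \<kappa> * d < real d - 2" "slope_num d \<kappa> 1 > 0 \<longleftrightarrow> \<kappa> * d > real d - 2"
    unfolding sl using \<kappa>(1) by (simp_all add: mult_less_0_iff zero_less_mult_iff)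
  then have iff: "slope_num d \<kappa> 1 < 0 \<longleftrightarrow> crit_product q d (B_plus q d) < crit_product q d B"
    "slope_num d \<kappa> 1 > 0 \<longleftrightarrow> crit_product q d (B_plus q d) > crit_product q d B"
    by (simp_all only: cmp sq)
  show "B < B_plus q d \<Longrightarrow> slope_num d \<kappa> 1 < 0"
    using crit_product_strict_antimono[OF B] iff(1) by blast
  show "B > B_plus q d \<Longrightarrow> slope_num d \<kappa> 1 > 0"
    using crit_product_strict_antimono[OF less_imp_le[OF B_plus_props(1)]] iff(2) by blast
  show "slope_num d \<kappa> 1 = 0" if "B = B_plus q d"
    using iff unfolding that by linarith
qed

end

lemma top_root_0_eq_1:
  assumes \<kappa>: "0 < \<kappa>" "\<kappa> \<le> 1" and "slope_num d \<kappa> 1 \<ge> 0"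
  shows "top_root d \<kappa> 0 = 1"
  using assms field_at_1[of \<kappa> d] field_at_increasing[of \<kappa> 1 _ d]
  by (intro top_root_eq \<kappa>) (auto simp: is_top_root_def)

text \<open>A negative slope makes \<open>field_at\<close> negative just to the right of 1, so 1 is
  not its last zero.\<close>

lemma top_root_0_gt_1:
  assumes \<kappa>: "0 < \<kappa>" "\<kappa> \<le> 1" and sl: "slope_num d \<kappa> 1 < 0"
  shows "top_root d \<kappa> 0 > 1"
proof (rule ccontr)
  note T = top_root[OF \<kappa> order_refl, of d]
  assume "\<not> top_root d \<kappa> 0 > 1"
  then have T1: "top_root d \<kappa> 0 = 1" using T by (simp add: is_top_root_def)
  have "(field_at d \<kappa> has_real_derivative slope_num d \<kappa> 1 / ((1 + \<kappa>) * (\<kappa> * 1 + 1))) (at 1)"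
    using field_at_deriv[of 1 \<kappa> d] \<kappa> by simp
  moreover have "slope_num d \<kappa> 1 / ((1 + \<kappa>) * (\<kappa> * 1 + 1)) < 0" using sl \<kappa> by (intro divide_neg_pos) auto
  ultimately obtain e where e: "e > 0" "\<And>h. 0 < h \<Longrightarrow> h < e \<Longrightarrow> field_at d \<kappa> (1 + h) < field_at d \<kappa> 1"
    using DERIV_neg_dec_right by blast
  have "field_at d \<kappa> (1 + e / 2) < 0" using e(2)[of "e / 2"] e(1) field_at_1[of \<kappa> d] \<kappa> by simp
  moreover have "0 < field_at d \<kappa> (1 + e / 2)" using T T1 e(1) by (simp add: is_top_root_def)
  ultimately show False by simp
qed


section \<open>The phase transition\<close>

text \<open>Over a common denominator the numerators differ by
  \<open>(\<tau>\<^sup>2 - e) * (T\<^sup>2 - 1)\<close>, and \<open>\<tau>\<^sup>2 > e\<close> says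
  exactly that \<open>1 + w < q - 1 + w\<close>.\<close>

lemma rc_critical_slopes_differ:
  fixes q w T :: real
  assumes q: "q > 2" and w: "w \<ge> 0" and T: "T > 1"
  defines "D \<equiv> \<lambda>X. ((X\<^sup>2 + 1 / (q - 1)) / ((1 + w) * X\<^sup>2 + 2 * X + (1 + w / (q - 1))))"
  shows "D (rc_scale q w * T) \<noteq> D (rc_scale q w * (1 / T))"
proof
  define \<tau> \<kappa> c e where "\<tau> = rc_scale q w" and "\<kappa> = rc_coupling q w" and "c = 1 + w / (q - 1)" and "e = 1 / (q - 1)"
  have \<kappa>: "\<kappa> > 0" and c: "c > 0" "1 + w > 0"
    using rc_coupling_bounds[OF q w] rc_weights_pos[OF q w] by (auto simp: \<kappa>_def c_def)
  define V where "V = T\<^sup>2 + 2 * \<kappa> * T + 1"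
  have V: "V > 0" using edge_sum_pos[of T \<kappa>] T \<kappa> by (simp add: V_def)
  have T2: "T\<^sup>2 > 1" using T by (simp add: one_less_power)
  have \<tau>2: "\<tau>\<^sup>2 = c / (1 + w)" using c by (simp add: \<tau>_def rc_scale_def c_def power_divide)
  have "(q - 1) * c = q - 1 + w" using q by (simp add: c_def distrib_left)
  then have "1 + w < (q - 1) * c" using q by linarith
  then have "e < \<tau>\<^sup>2" unfolding \<tau>2 e_def using c q by (simp add: field_simps)
  then have pos: "(\<tau>\<^sup>2 - e) * (T\<^sup>2 - 1) > 0" using T2 by simp
  have e1: "D (\<tau> * T) = (\<tau>\<^sup>2 * T\<^sup>2 + e) / (c * V)"
    unfolding D_def \<tau>_def rc_scale_identities[OF q w] by (simp add: V_def c_def e_def \<kappa>_def power_mult_distrib)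
  have "D (\<tau> * (1 / T)) = (\<tau>\<^sup>2 * (1 / T)\<^sup>2 + e) / (c * ((1 / T)\<^sup>2 + 2 * \<kappa> * (1 / T) + 1))"
    unfolding D_def \<tau>_def rc_scale_identities[OF q w] by (simp add: c_def e_def \<kappa>_def power_mult_distrib power_divide)
  also have "\<tau>\<^sup>2 * (1 / T)\<^sup>2 + e = (\<tau>\<^sup>2 + e * T\<^sup>2) / T\<^sup>2" using T by (simp add: field_simps)
  also have "(1 / T)\<^sup>2 + 2 * \<kappa> * (1 / T) + 1 = V / T\<^sup>2" using T by (simp add: V_def field_simps power2_eq_square)
  finally have e2: "D (\<tau> * (1 / T)) = (\<tau>\<^sup>2 + e * T\<^sup>2) / (c * V)" using T by simp
  assume "D (rc_scale q w * T) = D (rc_scale q w * (1 / T))"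
  then have "(\<tau>\<^sup>2 * T\<^sup>2 + e) / (c * V) = (\<tau>\<^sup>2 + e * T\<^sup>2) / (c * V)" using e1 e2 by (simp add: \<tau>_def)
  then have "\<tau>\<^sup>2 * T\<^sup>2 + e = \<tau>\<^sup>2 + e * T\<^sup>2" using c V by simp
  then show False using pos by (simp add: algebra_simps)
qed

section \<open>Holomorphic continuation of the root and of the pressure\<close>

lemma slope_num_inverse: "R > 0 \<Longrightarrow> slope_num d \<kappa> (1 / R) = slope_num d \<kappa> R"
  by (simp add: slope_num_def field_simps power2_eq_square)

lemma signed_root_simple:
  assumes \<kappa>: "0 < \<kappa>" "\<kappa> \<le> 1" and reg: "s = 0 \<Longrightarrow> slope_num d \<kappa> 1 > 0"
  shows "slope_num d \<kappa> (signed_root d \<kappa> s) \<noteq> 0"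
proof -
  have pos: "slope_num d \<kappa> (top_root d \<kappa> t) > 0" "top_root d \<kappa> t > 0" if "t > 0" for t
  proof -
    have "top_root d \<kappa> t \<ge> 1" "field_at d \<kappa> (top_root d \<kappa> t) = t"
      using top_root[OF \<kappa>, of t d] that by (auto simp: is_top_root_def)
    moreover from this have "top_root d \<kappa> t \<noteq> 1" using field_at_1[of \<kappa> d] \<kappa> that by auto
    ultimately show "slope_num d \<kappa> (top_root d \<kappa> t) > 0" "top_root d \<kappa> t > 0"
      using that by (auto intro!: slope_num_pos[OF \<kappa>(1)])
  qed
  consider "s > 0" | "s < 0" | "s = 0" by linarith
  then show ?thesis
  proof cases
    case 1
    then show ?thesis using pos[of s] by (simp add: signed_root_def)
  next
    case 2
    then show ?thesis using pos[of "- s"] by (simp add: signed_root_def slope_num_inverse)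
  next
    case 3
    then show ?thesis using reg top_root_0_eq_1[OF \<kappa>, of d] by (simp add: signed_root_def)
  qed
qed

text \<open>The stationarity equation is polynomial in \<open>X\<close> and in \<open>w\<close>, so a simple zero continues
  holomorphically.\<close>

lemma rc_root_continuation:
  fixes q B w :: real and d :: nat
  assumes q: "q > 2" and d: "d \<ge> 3" and w: "w \<ge> 0"
    and sl: "slope_num d (rc_coupling q w) (signed_root d (rc_coupling q w) (rc_field q d w B)) \<noteq> 0"
    and lim: "(rc_root q d B \<longlongrightarrow> rc_root q d B w) (at w within {0..})"
  shows "\<exists>r>0. \<exists>h. h holomorphic_on ball (complex_of_real w) r \<and>
    (\<forall>x\<ge>0. \<bar>x - w\<bar> < r \<longrightarrow> h (of_real x) = of_real (rc_root q d B x))"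
proof -
  define l m where "l = (q - 1) * exp (- B)" and "m = q - 1"
  define X where "X = rc_root q d B"
  define F :: "complex \<Rightarrow> complex \<Rightarrow> complex" where
    "F w x = ((1 + w) * x + 1) ^ (d - 1) - of_real l * x * (x + (1 + w / of_real m)) ^ (d - 1)" for w x
  define F' :: "complex \<Rightarrow> complex \<Rightarrow> complex" where
    "F' w x = of_nat (d - 1) * ((1 + w) * x + 1) ^ (d - 2) * (1 + w)
       - of_real l * ((x + (1 + w / of_real m)) ^ (d - 1)
       + x * (of_nat (d - 1) * (x + (1 + w / of_real m)) ^ (d - 2)))" for w x
  have m: "m > 0" "m \<noteq> 0" using q by (auto simp: m_def)
  have Xpos: "X x > 0" if "x \<ge> 0" for x unfolding X_def by (rule rc_root_pos[OF q that])
  have zero: "F (of_real x) (of_real (X x)) = 0" if "x \<ge> 0" for x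
  proof -
    have "((1 + x) * X x + 1) ^ (d - 1) = l * X x * (X x + (1 + x / m)) ^ (d - 1)"
      using rc_stationary[OF q that _ signed_root[OF rc_coupling_bounds[OF q that]]] d
      unfolding X_def rc_root_def l_def m_def by simp
    then have "complex_of_real (((1 + x) * X x + 1) ^ (d - 1)) =
        complex_of_real (l * X x * (X x + (1 + x / m)) ^ (d - 1))" by simp
    then show ?thesis unfolding F_def by simp
  qed
  have deriv: "(F w has_field_derivative F' w x) (at x)" for w x
  proof -
    have "d - 1 - 1 = d - 2" by simp
    then show ?thesis unfolding F_def[abs_def] F'_def
      by (auto intro!: derivative_eq_intros simp: algebra_simps)
  qed
  have cont': "continuous (at (w0, x0)) (\<lambda>(w, x). F' w x)" for w0 x0
    unfolding F'_def case_prod_unfold using m by (intro continuous_intros) auto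
  have cont: "continuous (at w0) (\<lambda>w. F w x0)" for w0 x0
    unfolding F_def using m by (intro continuous_intros) auto
  have hol: "(\<lambda>w. F w (h w)) holomorphic_on S" if "h holomorphic_on S" for h S
    unfolding F_def using m that by (intro holomorphic_intros) auto
  have nz: "F' (of_real w) (of_real (X w)) \<noteq> 0"
  proof
    assume "F' (of_real w) (of_real (X w)) = 0"
    define A C where "A = (1 + w) * X w + 1" and "C = X w + (1 + w / m)"
    define n where "n = real (d - 1)"
    have p: "A > 0" "C > 0" "X w > 0" using Xpos[OF w] w m by (auto simp: A_def C_def add_pos_pos add_pos_nonneg)
    have "F' (of_real w) (of_real (X w)) =
        of_real (n * A ^ (d - 2) * (1 + w) - l * (C ^ (d - 1) + X w * (n * C ^ (d - 2))))"
      by (simp add: F'_def A_def C_def n_def)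
    with \<open>F' (of_real w) (of_real (X w)) = 0\<close>
    have z: "n * A ^ (d - 2) * (1 + w) - l * (C ^ (d - 1) + X w * (n * C ^ (d - 2))) = 0"
      by (simp only: of_real_eq_0_iff)
    have pw: "y ^ (d - 1) = y * y ^ (d - 2)" for y :: real
    proof -
      have "d - 1 = Suc (d - 2)" using d by simp
      then show ?thesis by (simp only: power_Suc)
    qed
    have "complex_of_real (A ^ (d - 1) - l * X w * C ^ (d - 1)) = 0"
      using zero[OF w] by (simp add: F_def A_def C_def)
    then have st: "l * X w * C ^ (d - 1) = A ^ (d - 1)" by (simp only: of_real_eq_0_iff)
    \<comment> \<open>Multiplying by \<open>A * C * X w\<close> produces the combinations in which
      the stationarity equation eliminates \<open>l\<close>.\<close>
    have "0 = A * C * X w * (n * A ^ (d - 2) * (1 + w) - l * (C ^ (d - 1) + X w * (n * C ^ (d - 2))))"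
      unfolding z by simp
    also have "\<dots> = n * (A * A ^ (d - 2)) * (1 + w) * C * X w
        - A * C * (l * X w * C ^ (d - 1)) - A * X w * n * (l * X w * (C * C ^ (d - 2)))"
      by (simp add: algebra_simps)
    also have "\<dots> = A ^ (d - 1) * (n * X w * ((1 + w) * C - A) - A * C)"
      unfolding pw[symmetric] st by (simp add: algebra_simps)
    also have "(1 + w) * C - A = (1 + w) * (1 + w / m) - 1" by (simp add: A_def C_def algebra_simps)
    finally have "n * X w * ((1 + w) * (1 + w / m) - 1) - A * C = 0" using p by simp
    moreover have "A * C - n * (((1 + w) * (1 + w / m) - 1) * X w) \<noteq> 0"
      using rc_simple_zero[OF q w signed_root(1)[OF rc_coupling_bounds[OF q w]] sl]
      unfolding A_def C_def n_def m_def X_def rc_root_def by simp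
    ultimately show False by (simp add: mult_ac)
  qed
  obtain r \<rho> h where r: "r > 0" "\<rho> > 0" and h: "h holomorphic_on ball (of_real w) r"
    and uniq: "\<And>w' x. w' \<in> ball (of_real w) r \<Longrightarrow> x \<in> cball (of_real (X w)) \<rho> \<Longrightarrow> F w' x = 0 \<Longrightarrow> x = h w'"
    using holomorphic_implicit_function[of F "of_real w" "of_real (X w)" F', OF zero[OF w] deriv cont' cont nz hol]
    by blast
  \<comment> \<open>Continuity keeps the real root inside the ball where the zero is unique, so the
    holomorphic branch passes through it.\<close>
  obtain r' where r': "r' > 0" "\<And>x. x \<ge> 0 \<Longrightarrow> dist x w < r' \<Longrightarrow> dist (X x) (X w) < \<rho>"
    using lim[unfolded Lim_within, rule_format, OF r(2)] r(2) unfolding X_def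
    by (metis atLeast_iff dist_self zero_less_dist_iff)
  show ?thesis
  proof (intro exI[of _ "min r r'"] exI[of _ h] conjI allI impI)
    show "min r r' > 0" using r r' by simp
    show "h holomorphic_on ball (of_real w) (min r r')" using h by (rule holomorphic_on_subset) auto
    fix x assume x: "x \<ge> 0" "\<bar>x - w\<bar> < min r r'"
    have "dist (X x) (X w) < \<rho>" using r'(2)[of x] x by (simp add: dist_real_def)
    then have "of_real (X x) \<in> cball (complex_of_real (X w)) \<rho>" by (simp add: dist_of_real dist_commute)
    moreover have "of_real x \<in> ball (complex_of_real w) r" using x by (simp add: dist_of_real dist_real_def abs_minus_commute)
    ultimately show "h (of_real x) = of_real (rc_root q d B x)" using uniq zero[OF x(1)] unfolding X_def by metis
  qed
qed

text \<open>Near \<open>w\<close> the arguments of both logarithms have positive real part, so the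
  principal branch is holomorphic there and agrees with \<open>ln\<close> on the real
  points.\<close>

lemma rc_bethe_analytic:
  fixes q B w :: real and d :: nat
  assumes q: "q > 2" and w: "w \<ge> 0" and r: "r > 0"
    and h: "h holomorphic_on ball (complex_of_real w) r"
    and eq: "\<And>x. x \<ge> 0 \<Longrightarrow> \<bar>x - w\<bar> < r \<Longrightarrow> h (of_real x) = of_real (X x) \<and> X x > 0"
  shows "analytic_at_nonneg (\<lambda>x. rc_bethe q d B x (X x)) w"
proof -
  define l m where "l = (q - 1) * exp (- B)" and "m = q - 1"
  have m: "m > 0" "m \<noteq> 0" using q by (auto simp: m_def)
  define u where "u z = ((1 + z) * h z + 1) ^ d + of_real l * (h z + (1 + z / of_real m)) ^ d" for z
  define v where "v z = (1 + z) * (h z)\<^sup>2 + 2 * h z + (1 + z / of_real m)" for z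
  define U where "U x = ((1 + x) * X x + 1) ^ d + l * (X x + (1 + x / m)) ^ d" for x
  define V where "V x = (1 + x) * (X x)\<^sup>2 + 2 * X x + (1 + x / m)" for x
  have uv: "u (of_real x) = of_real (U x)" "v (of_real x) = of_real (V x)" "U x > 0" "V x > 0"
    if "x \<ge> 0" "\<bar>x - w\<bar> < r" for x
    using eq[OF that] rc_sums_pos[OF q that(1), of "X x"] by (simp_all add: u_def v_def U_def V_def l_def m_def)
  have hol: "u holomorphic_on ball (of_real w) r" "v holomorphic_on ball (of_real w) r"
    unfolding u_def[abs_def] v_def[abs_def] using h m by (auto intro!: holomorphic_intros)
  have c: "continuous (at (complex_of_real w)) u" "continuous (at (complex_of_real w)) v"
    using hol r by (auto intro!: continuous_on_interior holomorphic_on_imp_continuous_on simp: interior_open)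
  have Re0: "Re (u (of_real w)) > 0" "Re (v (of_real w)) > 0" using uv[OF w] r by auto
  have "((\<lambda>z. Re (u z)) \<longlongrightarrow> Re (u (of_real w))) (at (of_real w))"
    "((\<lambda>z. Re (v z)) \<longlongrightarrow> Re (v (of_real w))) (at (of_real w))"
    using c by (auto intro!: tendsto_Re simp: isCont_def)
  then have "\<forall>\<^sub>F z in at (of_real w). Re (u z) > 0 \<and> Re (v z) > 0"
    using Re0 by (intro eventually_conj order_tendstoD(1)[OF _ Re0(1)] order_tendstoD(1)[OF _ Re0(2)])
  then obtain r' where r': "r' > 0" "\<And>z. z \<noteq> of_real w \<Longrightarrow> dist z (of_real w) < r' \<Longrightarrow> Re (u z) > 0 \<and> Re (v z) > 0"
    unfolding eventually_at by blast
  have pos: "Re (u z) > 0 \<and> Re (v z) > 0" if "z \<in> ball (of_real w) r'" for z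
    using r'(2)[of z] that \<open>Re (u (of_real w)) > 0\<close> \<open>Re (v (of_real w)) > 0\<close>
    by (cases "z = of_real w") (auto simp: dist_commute)
  have np: "u z \<notin> \<real>\<^sub>\<le>\<^sub>0" "v z \<notin> \<real>\<^sub>\<le>\<^sub>0" if "z \<in> ball (of_real w) r'" for z
    using pos[OF that] by (auto simp: complex_nonpos_Reals_iff)
  have sub: "ball (complex_of_real w) (min r r') \<subseteq> ball (of_real w) r" by auto
  show ?thesis
  proof (rule analytic_at_nonneg_of_holomorphic[where r = "min r r'" and \<Phi> = "\<lambda>z. Ln (u z) - of_real (real d / 2) * Ln (v z)"])
    show "(\<lambda>z. Ln (u z) - of_real (real d / 2) * Ln (v z)) holomorphic_on ball (of_real w) (min r r')"
      using np holomorphic_on_subset[OF hol(1) sub] holomorphic_on_subset[OF hol(2) sub]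
      by (intro holomorphic_intros) auto
    show "min r r' > 0" using r r' by simp
    fix x assume x: "x \<ge> 0" "\<bar>x - w\<bar> < min r r'"
    then have "\<bar>x - w\<bar> < r" by simp
    note x = uv[OF x(1) this]
    show "Ln (u (of_real x)) - of_real (real d / 2) * Ln (v (of_real x)) = of_real (rc_bethe q d B x (X x))"
      unfolding x(1,2) Ln_of_real[OF x(3)] Ln_of_real[OF x(4)]
      by (simp add: rc_bethe_def U_def V_def l_def m_def)
  qed
qed

section \<open>One-sided derivatives and analyticity of the pressure\<close>

context tree_like_sequence
begin

context
  fixes q :: real and \<phi> :: "real \<Rightarrow> real \<Rightarrow> real"
  assumes q: "q > 2" and pressure: "is_pressure N G q \<phi>"
begin

lemma pressure_eq_root:
  assumes w: "w \<ge> 0" and B: "B \<ge> 0"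
  shows "\<phi> w B = rc_bethe q d B w (rc_root q d B w)"
  unfolding rc_root_def rc_bethe_scale[OF q w signed_root(1)[OF rc_coupling_bounds[OF q w]]]
    bethe_signed_root[OF rc_coupling_bounds[OF q w]]
  by (rule rc_pressure[OF q pressure w B])

text \<open>At zero field the two reciprocal messages have the same Bethe free energy, so either
  represents the pressure.\<close>

lemma pressure_eq_left_root:
  assumes w: "w \<ge> 0" and B: "B \<ge> 0" and s: "rc_field q d w B \<le> 0"
  shows "\<phi> w B = rc_bethe q d B w (rc_left_root q d B w)"
proof (cases "rc_field q d w B = 0")
  case True
  note \<kappa> = rc_coupling_bounds[OF q w]
  let ?T = "top_root d (rc_coupling q w) 0"
  have T: "?T > 0" using top_root[OF \<kappa>, of 0 d] by (simp add: is_top_root_def)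
  have "rc_left_root q d B w = rc_scale q w * (1 / ?T)" using True by (simp add: rc_left_root_def)
  moreover have "rc_root q d B w = rc_scale q w * ?T" using True by (simp add: rc_root_def signed_root_def)
  ultimately show ?thesis
    using pressure_eq_root[OF w B] rc_bethe_scale[OF q w T, of d B] rc_bethe_scale[OF q w, of "1 / ?T" d B]
      bethe_flip[OF T \<kappa>(1), of d 0] T True by simp
next
  case False
  then show ?thesis using pressure_eq_root[OF w B] s by (simp add: rc_root_eq_left_root)
qed

lemma pressure_ge: "w \<ge> 0 \<Longrightarrow> B \<ge> 0 \<Longrightarrow> X > 0 \<Longrightarrow> rc_bethe q d B w X \<le> \<phi> w B"
  using rc_bethe_le_root[OF q _ _ d1, of w X B] by (simp add: pressure_eq_root)

lemma pressure_derivative: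
  assumes S: "is_interval S" "w \<in> S" "S \<subseteq> {0..}" and B: "B \<ge> 0"
    and X: "\<And>x. x \<in> S \<Longrightarrow> X x > 0 \<and> \<phi> x B = rc_bethe q d B x (X x)"
    and lim: "(X \<longlongrightarrow> X w) (at w within S)"
  shows "((\<lambda>w. \<phi> w B) has_real_derivative rc_bethe_dw q d B w (X w)) (at w within S)"
proof (rule envelope_derivative[where \<Psi> = "rc_bethe q d B" and \<Psi>' = "rc_bethe_dw q d B" and X = X, OF S(1,2)])
  show "continuous (at (w, X w)) (\<lambda>(w, x). rc_bethe_dw q d B w x)"
    using S X[OF S(2)] by (intro rc_bethe_dw_continuous q) auto
  show "rc_bethe q d B x y \<le> \<phi> x B" if "x \<in> S" "y > 0" for x y
    using that S(3) by (intro pressure_ge B) auto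
qed (use S X lim in \<open>auto intro!: rc_bethe_deriv_w[OF q]\<close>)

lemma rc_left_root_pos:
  assumes "w \<ge> 0" "rc_field q d w B \<le> 0" shows "rc_left_root q d B w > 0"
  using top_root[OF rc_coupling_bounds[OF q assms(1)], of "- rc_field q d w B" d] rc_scale_pos[OF q assms(1)] assms(2)
  by (simp add: rc_left_root_def is_top_root_def)

text \<open>The field is nonnegative on the closed half-line from the critical weight, so the
  maximizer is continuous there and the envelope theorem applies on that side alone.\<close>

lemma pressure_right_derivative:
  assumes B: "B \<ge> 0" and w: "w_c q d B \<ge> 0"
  shows "((\<lambda>w. \<phi> w B) has_real_derivative rc_bethe_dw q d B (w_c q d B) (rc_root q d B (w_c q d B)))
    (at_right (w_c q d B))"
proof -
  let ?w = "w_c q d B"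
  have s: "rc_field q d x B \<ge> 0" if "x \<ge> ?w" for x using rc_field_sign(1)[OF q d3, of x B] that w B by simp
  have "((\<lambda>w. \<phi> w B) has_real_derivative rc_bethe_dw q d B ?w (rc_root q d B ?w)) (at ?w within {?w..})"
  proof (rule pressure_derivative)
    show "(rc_root q d B \<longlongrightarrow> rc_root q d B ?w) (at ?w within {?w..})"
      using s w by (intro rc_root_tendsto_pos[OF q w]) (auto simp: eventually_at_filter)
  qed (use w B in \<open>auto intro!: rc_root_pos q pressure_eq_root is_interval_ci\<close>)
  then show ?thesis by (simp add: at_within_Ici_at_right)
qed

lemma pressure_left_derivative:
  assumes B: "B \<ge> 0" and w: "w_c q d B > 0"
  shows "((\<lambda>w. \<phi> w B) has_real_derivative rc_bethe_dw q d B (w_c q d B) (rc_left_root q d B (w_c q d B)))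
    (at_left (w_c q d B))"
proof -
  let ?w = "w_c q d B"
  have s: "rc_field q d x B \<le> 0" if "0 \<le> x" "x \<le> ?w" for x using rc_field_sign(2)[OF q d3, of x B] that B by simp
  have "((\<lambda>w. \<phi> w B) has_real_derivative rc_bethe_dw q d B ?w (rc_left_root q d B ?w)) (at ?w within {0..?w})"
  proof (rule pressure_derivative)
    show "(rc_left_root q d B \<longlongrightarrow> rc_left_root q d B ?w) (at ?w within {0..?w})"
      using s w by (intro rc_left_root_tendsto[OF q]) (auto simp: eventually_at_filter)
  qed (use w B s in \<open>auto intro!: rc_left_root_pos pressure_eq_left_root\<close>)
  then show ?thesis using w by (simp add: at_within_Icc_at_left)
qed

lemma pressure_jump:
  assumes B: "0 \<le> B" "B < B_plus q d"
  shows "\<exists>D\<^sub>r D\<^sub>l. ((\<lambda>w. \<phi> w B) has_real_derivative D\<^sub>r) (at_right (w_c q d B)) \<and>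
     ((\<lambda>w. \<phi> w B) has_real_derivative D\<^sub>l) (at_left (w_c q d B)) \<and> D\<^sub>r \<noteq> D\<^sub>l"
proof -
  let ?w = "w_c q d B"
  have w: "?w > 0" using w_c_pos[OF q d3 B(1)] B B_plus_props(2)[OF q d3] by simp
  then have w0: "?w \<ge> 0" by simp
  note \<kappa> = rc_coupling_bounds[OF q w0]
  have s: "rc_field q d ?w B = 0" using rc_field_sign[OF q d3 w0 B(1)] by simp
  define T where "T = top_root d (rc_coupling q ?w) 0"
  have T: "T > 1" unfolding T_def by (rule top_root_0_gt_1[OF \<kappa> slope_at_critical(1)[OF q d3 B(1) w0 B(2)]])
  have fT: "field_at d (rc_coupling q ?w) T = 0" using top_root[OF \<kappa>, of 0 d] by (simp add: T_def is_top_root_def)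
  then have fT': "field_at d (rc_coupling q ?w) (1 / T) = 0" using field_at_inverse[of T] T \<kappa> by simp
  have R: "rc_root q d B ?w = rc_scale q ?w * T" "rc_left_root q d B ?w = rc_scale q ?w * (1 / T)"
    using s by (simp_all add: rc_root_def rc_left_root_def signed_root_def T_def)
  have dw: "rc_bethe_dw q d B ?w (rc_scale q ?w * R) = d / 2 * (((rc_scale q ?w * R)\<^sup>2 + 1 / (q - 1)) /
      ((1 + ?w) * (rc_scale q ?w * R)\<^sup>2 + 2 * (rc_scale q ?w * R) + (1 + ?w / (q - 1))))"
    if "R > 0" "field_at d (rc_coupling q ?w) R = 0" for R
  proof -
    have f: "field_at d (rc_coupling q ?w) R = rc_field q d ?w B" using that(2) s by simp
    show ?thesis
      by (rule rc_bethe_dw_stationary[OF q w0 mult_pos_pos[OF rc_scale_pos[OF q w0] that(1)] d1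
            rc_stationary[OF q w0 d1 that(1) f]])
  qed
  have "rc_bethe_dw q d B ?w (rc_root q d B ?w) \<noteq> rc_bethe_dw q d B ?w (rc_left_root q d B ?w)"
  proof -
    have "T > 0" "1 / T > 0" using T by simp_all
    then show ?thesis unfolding R dw[OF \<open>T > 0\<close> fT] dw[OF \<open>1 / T > 0\<close> fT'] mult_cancel_left
      using rc_critical_slopes_differ[OF q w0 T] d1 by auto
  qed
  then show ?thesis using pressure_right_derivative[OF B(1) w0] pressure_left_derivative[OF B(1) w] by blast
qed

lemma pressure_analytic:
  assumes w: "w \<ge> 0" and B: "B \<ge> 0" and nc: "(w, B) \<notin> critical_curve q d" "(w, B) \<noteq> critical_endpoint q d"
  shows "analytic_at_nonneg (\<lambda>x. \<phi> x B) w"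
proof -
  note \<kappa> = rc_coupling_bounds[OF q w]
  \<comment> \<open>Zero field places \<open>w\<close> at \<open>w_c q d B\<close>; with the curve
    and its end point excluded, \<open>B\<close> exceeds \<open>B_plus q d\<close>, where the
    symmetric root is the only maximizer and is simple.\<close>
  have reg: "slope_num d (rc_coupling q w) 1 > 0" if "rc_field q d w B = 0"
  proof -
    have wc: "w = w_c q d B" using rc_field_sign[OF q d3 w B] that by simp
    then have "B > B_plus q d"
    proof -
      have "\<not> B < B_plus q d" using nc(1) wc B by (auto simp: critical_curve_def)
      moreover have "B \<noteq> B_plus q d" using nc(2) wc by (auto simp: critical_endpoint_def)
      ultimately show ?thesis by simp
    qed
    then show ?thesis using slope_at_critical(3)[OF q d3 B] w wc by simp
  qed
  have "(rc_root q d B \<longlongrightarrow> rc_root q d B w) (at w within {0..})"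
    using reg top_root_0_eq_1[OF \<kappa>, of d] by (intro rc_root_tendsto q w) auto
  from rc_root_continuation[OF q d3 w signed_root_simple[OF \<kappa> reg] this]
  obtain r h where r: "r > 0" and h: "h holomorphic_on ball (complex_of_real w) r"
    and eq: "\<And>x. x \<ge> 0 \<Longrightarrow> \<bar>x - w\<bar> < r \<Longrightarrow> h (of_real x) = of_real (rc_root q d B x)" by blast
  have "analytic_at_nonneg (\<lambda>x. rc_bethe q d B x (rc_root q d B x)) w"
    by (rule rc_bethe_analytic[OF q w r h]) (use eq rc_root_pos[OF q] in auto)
  then show ?thesis unfolding analytic_at_nonneg_def using pressure_eq_root[OF _ B] by simp
qed

text \<open>With slope 0 at \<open>R = 1\<close> the top root is still 1, so the two one-sided
  limits of the maximizer agree and the envelope theorem applies on both sides at once.\<close>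

lemma pressure_differentiable_at_endpoint:
  "(\<lambda>w. \<phi> w (B_plus q d)) differentiable (at (w_c q d (B_plus q d)))"
proof -
  let ?B = "B_plus q d" and ?w = "w_c q d (B_plus q d)"
  have B: "?B \<ge> 0" using B_plus_props(1)[OF q d3] by simp
  have w: "?w > 0" using w_c_pos[OF q d3 B] B_plus_props(2)[OF q d3] by simp
  then have w0: "?w \<ge> 0" by simp
  note \<kappa> = rc_coupling_bounds[OF q w0]
  have "top_root d (rc_coupling q ?w) 0 = 1"
    using slope_at_critical(2)[OF q d3 B w0] by (intro top_root_0_eq_1 \<kappa>) simp
  then have lim: "(rc_root q d ?B \<longlongrightarrow> rc_root q d ?B ?w) (at ?w within {0..})"
    by (intro rc_root_tendsto q w0)
  have "((\<lambda>w. \<phi> w ?B) has_real_derivative rc_bethe_dw q d ?B ?w (rc_root q d ?B ?w)) (at ?w within {0..})"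
    by (rule pressure_derivative[OF _ _ _ B _ lim])
      (use w0 B in \<open>auto intro!: rc_root_pos q pressure_eq_root is_interval_ci\<close>)
  moreover have "at ?w within {0..} = at ?w" using w by (intro at_within_interior) (simp add: interior_real_atLeast)
  ultimately show ?thesis by (auto simp: real_differentiable_def)
qed

end

end

theorem theorem1p12:
  fixes d :: nat and q :: real
    and N :: "nat \<Rightarrow> nat" and G :: "nat \<Rightarrow> nat set set pmf"
    and \<phi> :: "real \<Rightarrow> real \<Rightarrow> real"
  assumes "d \<ge> 3" and "q > 2"
    and "filterlim N at_top sequentially"
    and "\<forall>k. \<forall>E\<in>set_pmf (G k). regular_graph d {..<N k} E"
    and "locally_tree_like N G"
    and "is_pressure N G q \<phi>"
  shows "(\<forall>B. 0 \<le> B \<and> B < B_plus q d \<longrightarrow>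
            (\<exists>D\<^sub>r D\<^sub>l.
               ((\<lambda>w. \<phi> w B) has_real_derivative D\<^sub>r) (at_right (w_c q d B)) \<and>
               ((\<lambda>w. \<phi> w B) has_real_derivative D\<^sub>l) (at_left (w_c q d B)) \<and>
               D\<^sub>r \<noteq> D\<^sub>l)) \<and>
         (\<forall>w B. w \<ge> 0 \<and> B \<ge> 0 \<and> (w, B) \<notin> critical_curve q d \<and> (w, B) \<noteq> critical_endpoint q d \<longrightarrow>
            analytic_at_nonneg (\<lambda>x. \<phi> x B) w) \<and>
         (\<lambda>w. \<phi> w (B_plus q d)) differentiable (at (w_c q d (B_plus q d)))"
proof -
  interpret tree_like_sequence d N G
    using assms by unfold_locales
  show ?thesis
    using pressure_jump[OF assms(2,6)] pressure_analytic[OF assms(2,6)]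
      pressure_differentiable_at_endpoint[OF assms(2,6)]
    by blast
qed

end
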